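(* Let $V$ be a finite dimensional rational $G$-module and let $M$ be a $G_r$-summand of $V$. Then there is an isomorphism of $\mathcal{S}$-varieties $$\mathfrak{X}^V_M \cong \mathcal{S}/\mathcal{S}_M,$$ where $\mathcal{S}_M$ is the stabilizer in $\mathcal{S}$ of the point $M\in\mathfrak{X}^V_M$. In particular, this isomorphism is $G$-equivariant.
   Context: $k$ is an algebraically closed field of characteristic $p>0$, $G$ is a simple simply connected algebraic group over $k$, and $G_r$ ($r\ge 1$) is its $r$-th Frobenius kernel. $G_r$-modules are the same as modules over the finite dimensional distribution algebra $\mathrm{Dist}(G_r)$. A $G_r$-summand of $V$ is a $G_r$-submodule of $V$ that has a $G_r$-stable vector space complement in $V$. Let $\phi:G\to GL(V)$ be the representation, and let $\mathcal{C}=\mathrm{Aut}_{G_r}(V)=\mathrm{End}_{G_r}(V)^\times\le GL(V)$, the centralizer in $GL(V)$ of the image of $\mathrm{Dist}(G_r)$ in $\mathrm{End}_k(V)$. It is a connected closed subgroup of $GL(V)$ normalized by $\phi(G)$. Set $\mathcal{S}=G\ltimes\mathcal{C}$, where $G$ acts on $\mathcal{C}$ by conjugation via $\phi$; $\mathcal{S}$ is a connected linear algebraic group acting rationally on $V$ through $\phi$ and the inclusion $\mathcal{C}\le GL(V)$. For $m=\dim_k M$, $\mathfrak{Grass}_m(V)$ is the Grassmannian of $m$-dimensional subspaces of $V$, on which $\mathcal{S}$ acts. $\mathfrak{X}^V_M\subseteq\mathfrak{Grass}_m(V)$ is the set of all $G_r$-summands of $V$ that are isomorphic to $M$ as $G_r$-modules;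 it is a single orbit for $\mathcal{C}$ and for $\mathcal{S}$, and is regarded as a (reduced, locally closed) subvariety of $\mathfrak{Grass}_m(V)$ with its actions of $\mathcal{S}$, $\mathcal{C}$ and $G$. *)

theory Defs
  imports
    "HOL-Analysis.Abstract_Topology"
    "HOL-Algebra.Group_Action"
    "HOL-Algebra.Left_Coset"
    "Jordan_Normal_Form.Determinant"
begin

section \<open>Spaces with functions\<close>

text \<open>Varieties over an algebraically closed field are treated classically: a set of points with
  its Zariski topology and, for each open set \<open>U\<close>, the \<open>k\<close>-valued functions regular on \<open>U\<close>.
  A member of \<open>reg X U\<close> is a total HOL function, and only its values on \<open>U\<close> matter;
  \<open>reg X U\<close> is used for open \<open>U\<close> only.\<close>

record ('a, 'k) fun_space =
  ztop :: "'a topology"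
  reg :: "'a set \<Rightarrow> ('a \<Rightarrow> 'k) set"

definition points :: "('a, 'k) fun_space \<Rightarrow> 'a set" where
  "points X = topspace (ztop X)"

definition fs_morphism :: "('a, 'k) fun_space \<Rightarrow> ('b, 'k) fun_space \<Rightarrow> ('a \<Rightarrow> 'b) \<Rightarrow> bool" where
  "fs_morphism X Y f \<longleftrightarrow>
     continuous_map (ztop X) (ztop Y) f \<and>
     (\<forall>U h. openin (ztop Y) U \<longrightarrow> h \<in> reg Y U \<longrightarrow> h \<circ> f \<in> reg X {x \<in> points X. f x \<in> U})"

definition fs_iso :: "('a, 'k) fun_space \<Rightarrow> ('b, 'k) fun_space \<Rightarrow> ('a \<Rightarrow> 'b) \<Rightarrow> bool" where
  "fs_iso X Y f \<longleftrightarrow> fs_morphism X Y f \<and>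
     (\<exists>f'. fs_morphism Y X f' \<and>
        (\<forall>x \<in> points X. f' (f x) = x) \<and> (\<forall>y \<in> points Y. f (f' y) = y))"

definition equivariant_iso ::
  "('s, 'm) monoid_scheme \<Rightarrow> ('a, 'k) fun_space \<Rightarrow> ('s \<Rightarrow> 'a \<Rightarrow> 'a) \<Rightarrow>
   ('b, 'k) fun_space \<Rightarrow> ('s \<Rightarrow> 'b \<Rightarrow> 'b) \<Rightarrow> ('a \<Rightarrow> 'b) \<Rightarrow> bool" where
  "equivariant_iso S X actX Y actY f \<longleftrightarrow>
     fs_iso X Y f \<and> (\<forall>s \<in> carrier S. \<forall>x \<in> points X. f (actX s x) = actY s (f x))"

text \<open>The algebra of functions on \<open>X\<close> generated over \<open>k\<close> by \<open>E\<close>. Functions on \<open>X\<close> are represented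
  by their extension by \<open>0\<close>, so that equality of functions on \<open>X\<close> is HOL equality.\<close>

inductive_set fun_alg :: "('a \<Rightarrow> 'k::field) set \<Rightarrow> ('a \<Rightarrow> 'k) set" for E where
  const: "(\<lambda>_. a) \<in> fun_alg E"
| gen: "f \<in> E \<Longrightarrow> f \<in> fun_alg E"
| add: "f \<in> fun_alg E \<Longrightarrow> g \<in> fun_alg E \<Longrightarrow> (\<lambda>x. f x + g x) \<in> fun_alg E"
| mult: "f \<in> fun_alg E \<Longrightarrow> g \<in> fun_alg E \<Longrightarrow> (\<lambda>x. f x * g x) \<in> fun_alg E"

definition on_set :: "'a set \<Rightarrow> ('a \<Rightarrow> 'k::field) \<Rightarrow> 'a \<Rightarrow> 'k" where
  "on_set X f = (\<lambda>x. if x \<in> X then f x else 0)"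

definition coord_ring :: "'a set \<Rightarrow> ('a \<Rightarrow> 'k::field) set \<Rightarrow> ('a \<Rightarrow> 'k) set" where
  "coord_ring X E = on_set X ` fun_alg E"

definition coord_prod ::
  "'a set \<Rightarrow> ('a \<Rightarrow> 'k::field) set \<Rightarrow> 'b set \<Rightarrow> ('b \<Rightarrow> 'k) set \<Rightarrow> ('a \<times> 'b \<Rightarrow> 'k) set" where
  "coord_prod X A Y B = coord_ring (X \<times> Y) ((\<lambda>f. f \<circ> fst) ` A \<union> (\<lambda>f. f \<circ> snd) ` B)"

text \<open>The affine variety with point set \<open>X\<close> and coordinate ring \<open>A\<close>: the topology is generated by
  the principal open sets, and a function is regular if it is locally a quotient of elements
  of \<open>A\<close>.\<close>

definition affine_space :: "'a set \<Rightarrow> ('a \<Rightarrow> 'k::field) set \<Rightarrow> ('a, 'k) fun_space" where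
  "affine_space X A =
     (let T = topology_generated_by {{x \<in> X. f x \<noteq> 0} | f. f \<in> A} in
      \<lparr> ztop = T,
        reg = (\<lambda>U. {h. \<forall>x \<in> U. \<exists>W. \<exists>a \<in> A. \<exists>b \<in> A. openin T W \<and> x \<in> W \<and> W \<subseteq> U \<and>
                          (\<forall>y \<in> W. b y \<noteq> 0 \<and> h y = a y / b y)}) \<rparr>)"

text \<open>The structure induced on a subset: regular functions are locally restrictions of regular
  functions on the ambient space. For a locally closed subset of a variety this is the reduced
  subvariety.\<close>

definition sub_space :: "('a, 'k) fun_space \<Rightarrow> 'a set \<Rightarrow> ('a, 'k) fun_space" where
  "sub_space Y X =
     \<lparr> ztop = subtopology (ztop Y) X,
       reg = (\<lambda>U. {h. \<forall>x \<in> U. \<exists>W h'. openin (ztop Y) W \<and> x \<in> W \<and> W \<inter> X \<subseteq> U \<and>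
                         h' \<in> reg Y W \<and> (\<forall>y \<in> W \<inter> X. h y = h' y)}) \<rparr>"

text \<open>The quotient structure on the image of \<open>q\<close>: a set is open (a function is regular) iff its
  preimage (its pullback) is. For \<open>q\<close> the projection of an algebraic group onto the cosets of a
  closed subgroup, this is the quotient variety.\<close>

definition quot_space :: "('a \<Rightarrow> 'b) \<Rightarrow> ('a, 'k) fun_space \<Rightarrow> ('b, 'k) fun_space" where
  "quot_space q X =
     \<lparr> ztop = topology (\<lambda>U. U \<subseteq> q ` points X \<and> openin (ztop X) {x \<in> points X. q x \<in> U}),
       reg = (\<lambda>U. {h. h \<circ> q \<in> reg X {x \<in> points X. q x \<in> U}}) \<rparr>"

lemma openin_quot_space:
  "openin (ztop (quot_space q X)) U \<longleftrightarrow>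
     U \<subseteq> q ` points X \<and> openin (ztop X) {x \<in> points X. q x \<in> U}"
proof -
  have "istopology (\<lambda>U. U \<subseteq> q ` points X \<and> openin (ztop X) {x \<in> points X. q x \<in> U})"
    unfolding istopology_def
  proof (intro conjI allI impI)
    fix S T
    assume "S \<subseteq> q ` points X \<and> openin (ztop X) {x \<in> points X. q x \<in> S}"
      and "T \<subseteq> q ` points X \<and> openin (ztop X) {x \<in> points X. q x \<in> T}"
    moreover have "{x \<in> points X. q x \<in> S \<inter> T} = {x \<in> points X. q x \<in> S} \<inter> {x \<in> points X. q x \<in> T}"
      by auto
    ultimately show "S \<inter> T \<subseteq> q ` points X" "openin (ztop X) {x \<in> points X. q x \<in> S \<inter> T}"
      by auto
  next
    fix K
    assume K: "\<forall>S\<in>K. S \<subseteq> q ` points X \<and> openin (ztop X) {x \<in> points X. q x \<in> S}"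
    then show "\<Union>K \<subseteq> q ` points X" by auto
    have "{x \<in> points X. q x \<in> \<Union>K} = (\<Union>S\<in>K. {x \<in> points X. q x \<in> S})" by auto
    then show "openin (ztop X) {x \<in> points X. q x \<in> \<Union>K}" using K by auto
  qed
  then show ?thesis by (simp add: quot_space_def)
qed

lemma points_quot_space: "points (quot_space q X) = q ` points X"
proof -
  have "{x \<in> points X. q x \<in> q ` points X} = points X" by auto
  then have "openin (ztop (quot_space q X)) (q ` points X)"
    by (simp add: openin_quot_space points_def)
  then have "q ` points X \<subseteq> points (quot_space q X)"
    unfolding points_def[of "quot_space q X"] by (rule openin_subset)
  moreover have "openin (ztop (quot_space q X)) (points (quot_space q X))"
    by (simp add: points_def)
  ultimately show ?thesis
    unfolding openin_quot_space by blast
qed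

lemma points_sub_space: "points (sub_space Y X) = points Y \<inter> X"
  by (simp add: points_def sub_space_def)

lemma points_affine_space:
  fixes E :: "('a \<Rightarrow> 'k::field) set"
  shows "points (affine_space X (coord_ring X E)) = X"
proof -
  have "on_set X (\<lambda>_. 1::'k) \<in> coord_ring X E"
    unfolding coord_ring_def by (intro imageI fun_alg.const)
  moreover have "{x \<in> X. on_set X (\<lambda>_. 1::'k) x \<noteq> 0} = X" by (auto simp: on_set_def)
  ultimately have X: "X \<in> {{x \<in> X. f x \<noteq> 0} | f. f \<in> coord_ring X E}" by blast
  have "\<Union>{{x \<in> X. f x \<noteq> 0} | f. f \<in> coord_ring X E} = X"
  proof
    show "X \<subseteq> \<Union>{{x \<in> X. f x \<noteq> 0} | f. f \<in> coord_ring X E}" using X by (rule Union_upper)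
  qed blast
  then show ?thesis
    by (simp add: points_def affine_space_def Let_def)
qed


section \<open>Linear algebraic groups\<close>

definition GL :: "nat \<Rightarrow> 'k::field mat monoid" where
  "GL n = units_of (ring_mat TYPE('k) n ())"

definition GL_gens :: "nat \<Rightarrow> ('k::field mat \<Rightarrow> 'k) set" where
  "GL_gens n = {\<lambda>g. g $$ (i, j) | i j. i < n \<and> j < n} \<union> {\<lambda>g. inverse (det g)}"

definition grp_coord :: "nat \<Rightarrow> 'k::field mat set \<Rightarrow> ('k mat \<Rightarrow> 'k) set" where
  "grp_coord n G = coord_ring G (GL_gens n)"

definition grp_space :: "nat \<Rightarrow> 'k::field mat set \<Rightarrow> ('k mat, 'k) fun_space" where
  "grp_space n G = affine_space G (grp_coord n G)"

definition closed_subgroup :: "nat \<Rightarrow> 'k::field mat set \<Rightarrow> bool" where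
  "closed_subgroup n G \<longleftrightarrow>
     subgroup G (GL n) \<and> closedin (ztop (grp_space n (carrier (GL n)))) G"

definition connected_alg_group :: "nat \<Rightarrow> 'k::field mat set \<Rightarrow> bool" where
  "connected_alg_group n G \<longleftrightarrow> closed_subgroup n G \<and> connected_space (ztop (grp_space n G))"

abbreviation grp :: "nat \<Rightarrow> 'k::field mat set \<Rightarrow> 'k mat monoid" where
  "grp n G \<equiv> (GL n)\<lparr>carrier := G\<rparr>"

definition simple_alg_group :: "nat \<Rightarrow> 'k::field mat set \<Rightarrow> bool" where
  "simple_alg_group n G \<longleftrightarrow>
     connected_alg_group n G \<and> \<not> comm_group (grp n G) \<and>
     (\<forall>H. connected_alg_group n H \<longrightarrow> H \<lhd> grp n G \<longrightarrow> H = {\<one>\<^bsub>GL n\<^esub>} \<or> H = G)"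

definition alg_hom ::
  "nat \<Rightarrow> 'k::field mat set \<Rightarrow> nat \<Rightarrow> 'k mat set \<Rightarrow> ('k mat \<Rightarrow> 'k mat) \<Rightarrow> bool" where
  "alg_hom m H n G f \<longleftrightarrow>
     f \<in> hom (grp m H) (grp n G) \<and> (\<forall>u \<in> grp_coord n G. on_set H (u \<circ> f) \<in> grp_coord m H)"

definition alg_iso ::
  "nat \<Rightarrow> 'k::field mat set \<Rightarrow> nat \<Rightarrow> 'k mat set \<Rightarrow> ('k mat \<Rightarrow> 'k mat) \<Rightarrow> bool" where
  "alg_iso m H n G f \<longleftrightarrow> alg_hom m H n G f \<and>
     (\<exists>f'. alg_hom n G m H f' \<and> (\<forall>h \<in> H. f' (f h) = h) \<and> (\<forall>g \<in> G. f (f' g) = g))"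

inductive_set ideal_gen :: "('a \<Rightarrow> 'k::field) set \<Rightarrow> ('a \<Rightarrow> 'k) set \<Rightarrow> ('a \<Rightarrow> 'k) set" for A E where
  zero: "(\<lambda>_. 0) \<in> ideal_gen A E"
| step: "f \<in> ideal_gen A E \<Longrightarrow> a \<in> A \<Longrightarrow> e \<in> E \<Longrightarrow> (\<lambda>x. f x + a x * e x) \<in> ideal_gen A E"

definition aug_ideal :: "nat \<Rightarrow> 'k::field mat set \<Rightarrow> ('k mat \<Rightarrow> 'k) set" where
  "aug_ideal n G = {u \<in> grp_coord n G. u \<one>\<^bsub>GL n\<^esub> = 0}"

text \<open>The scheme-theoretic kernel \<open>K\<close> of \<open>f : H \<rightarrow> G\<close> is cut out in \<open>H\<close> by the pullbacks of the
  functions on \<open>G\<close> vanishing at \<open>1\<close>. It is central iff the two morphisms \<open>(h, x) \<mapsto> h x h\<^sup>-\<^sup>1\<close> and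
  \<open>(h, x) \<mapsto> x\<close> agree on \<open>H \<times> K\<close>, i.e. their comorphisms agree modulo the ideal of \<open>H \<times> K\<close>.
  In positive characteristic this is stronger than centrality of the group of points of \<open>K\<close>;
  for example, it excludes the Frobenius morphism.\<close>

definition central_kernel ::
  "nat \<Rightarrow> 'k::field mat set \<Rightarrow> nat \<Rightarrow> 'k mat set \<Rightarrow> ('k mat \<Rightarrow> 'k mat) \<Rightarrow> bool" where
  "central_kernel m H n G f \<longleftrightarrow>
     (\<forall>u \<in> grp_coord m H.
        on_set (H \<times> H) (\<lambda>(h, x). u (h \<otimes>\<^bsub>GL m\<^esub> x \<otimes>\<^bsub>GL m\<^esub> inv\<^bsub>GL m\<^esub> h) - u x)
        \<in> ideal_gen (coord_prod H (grp_coord m H) H (grp_coord m H))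
             {on_set (H \<times> H) (\<lambda>(h, x). w (f x)) | w. w \<in> aug_ideal n G})"

definition central_isogeny ::
  "nat \<Rightarrow> 'k::field mat set \<Rightarrow> nat \<Rightarrow> 'k mat set \<Rightarrow> ('k mat \<Rightarrow> 'k mat) \<Rightarrow> bool" where
  "central_isogeny m H n G f \<longleftrightarrow>
     alg_hom m H n G f \<and> f ` H = G \<and> finite (kernel (grp m H) (grp n G) f) \<and>
     central_kernel m H n G f"

text \<open>For semisimple \<open>G\<close>; a connected group \<open>H\<close> isogenous to \<open>G\<close> is then semisimple as well.\<close>

definition simply_connected_group :: "nat \<Rightarrow> 'k::field mat set \<Rightarrow> bool" where
  "simply_connected_group n G \<longleftrightarrow>
     (\<forall>m H f. connected_alg_group m H \<longrightarrow> central_isogeny m H n G f \<longrightarrow> alg_iso m H n G f)"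


section \<open>Frobenius kernels and their modules\<close>

text \<open>The ideal of the \<open>r\<close>-th Frobenius kernel in the coordinate ring of \<open>G\<close>.\<close>

definition frob_ideal :: "nat \<Rightarrow> 'k::field mat set \<Rightarrow> nat \<Rightarrow> ('k mat \<Rightarrow> 'k) set" where
  "frob_ideal n G r =
     ideal_gen (grp_coord n G) {\<lambda>g. u g ^ (CHAR('k) ^ r) | u. u \<in> aug_ideal n G}"

text \<open>Since the \<open>r\<close>-th Frobenius kernel is infinitesimal, its distributions are all the linear forms on its
  coordinate ring, i.e. the linear forms on the coordinate ring of \<open>G\<close> that vanish on the ideal
  above. (Values of \<open>\<mu>\<close> off the coordinate ring are irrelevant.)\<close>

definition dist_frob :: "nat \<Rightarrow> 'k::field mat set \<Rightarrow> nat \<Rightarrow> (('k mat \<Rightarrow> 'k) \<Rightarrow> 'k) set" where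
  "dist_frob n G r =
     {\<mu>. (\<forall>u \<in> grp_coord n G. \<forall>w \<in> grp_coord n G. \<mu> (\<lambda>g. u g + w g) = \<mu> u + \<mu> w) \<and>
         (\<forall>u \<in> grp_coord n G. \<forall>a. \<mu> (\<lambda>g. a * u g) = a * \<mu> u) \<and>
         (\<forall>u \<in> frob_ideal n G r. \<mu> u = 0)}"

abbreviation functional :: "('k::field \<Rightarrow> 'v::ab_group_add \<Rightarrow> 'v) \<Rightarrow> ('v \<Rightarrow> 'k) \<Rightarrow> bool" where
  "functional scale \<equiv> Vector_Spaces.linear scale (*)"

definition rational_module ::
  "nat \<Rightarrow> 'k::field mat set \<Rightarrow> ('k \<Rightarrow> 'v::ab_group_add \<Rightarrow> 'v) \<Rightarrow> ('k mat \<Rightarrow> 'v \<Rightarrow> 'v) \<Rightarrow> bool" where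
  "rational_module n G scale \<phi> \<longleftrightarrow>
     (\<forall>g \<in> G. Vector_Spaces.linear scale scale (\<phi> g)) \<and>
     \<phi> \<one>\<^bsub>GL n\<^esub> = id \<and>
     (\<forall>g \<in> G. \<forall>h \<in> G. \<phi> (g \<otimes>\<^bsub>GL n\<^esub> h) = \<phi> g \<circ> \<phi> h) \<and>
     (\<forall>\<xi> v. functional scale \<xi> \<longrightarrow> on_set G (\<lambda>g. \<xi> (\<phi> g v)) \<in> grp_coord n G)"

text \<open>If \<open>\<Delta> v = \<Sum>b. b \<otimes> f\<^sub>b\<close> is the coaction in terms of the basis \<open>B\<close>, where \<open>f\<^sub>b g\<close> is the
  \<open>b\<close>-coordinate of \<open>\<phi> g v\<close>, then \<open>\<mu>\<close> acts by \<open>v \<mapsto> \<Sum>b. \<mu>(f\<^sub>b) b\<close>. This does not depend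
  on \<open>B\<close>.\<close>

definition dist_act ::
  "'k::field mat set \<Rightarrow> ('k \<Rightarrow> 'v::ab_group_add \<Rightarrow> 'v) \<Rightarrow> 'v set \<Rightarrow> ('k mat \<Rightarrow> 'v \<Rightarrow> 'v) \<Rightarrow>
   (('k mat \<Rightarrow> 'k) \<Rightarrow> 'k) \<Rightarrow> 'v \<Rightarrow> 'v" where
  "dist_act G scale B \<phi> \<mu> v =
     (\<Sum>b\<in>B. scale (\<mu> (on_set G (\<lambda>g. module.representation scale B (\<phi> g v) b))) b)"

text \<open>Below, \<open>D\<close> is a set of operators on \<open>V\<close>; it will be the image of the distribution algebra.\<close>

definition D_submodule ::
  "('k::field \<Rightarrow> 'v::ab_group_add \<Rightarrow> 'v) \<Rightarrow> ('v \<Rightarrow> 'v) set \<Rightarrow> 'v set \<Rightarrow> bool" where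
  "D_submodule scale D W \<longleftrightarrow> module.subspace scale W \<and> (\<forall>d \<in> D. d ` W \<subseteq> W)"

definition D_summand ::
  "('k::field \<Rightarrow> 'v::ab_group_add \<Rightarrow> 'v) \<Rightarrow> ('v \<Rightarrow> 'v) set \<Rightarrow> 'v set \<Rightarrow> bool" where
  "D_summand scale D W \<longleftrightarrow> D_submodule scale D W \<and>
     (\<exists>W'. D_submodule scale D W' \<and> W \<inter> W' = {0} \<and> {x + y | x y. x \<in> W \<and> y \<in> W'} = UNIV)"

definition D_isomorphic ::
  "('k::field \<Rightarrow> 'v::ab_group_add \<Rightarrow> 'v) \<Rightarrow> ('v \<Rightarrow> 'v) set \<Rightarrow> 'v set \<Rightarrow> 'v set \<Rightarrow> bool" where
  "D_isomorphic scale D W W' \<longleftrightarrow>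
     (\<exists>f. bij_betw f W W' \<and>
          (\<forall>x \<in> W. \<forall>y \<in> W. f (x + y) = f x + f y) \<and>
          (\<forall>a. \<forall>x \<in> W. f (scale a x) = scale a (f x)) \<and>
          (\<forall>d \<in> D. \<forall>x \<in> W. f (d x) = d (f x)))"

definition dist_image ::
  "nat \<Rightarrow> 'k::field mat set \<Rightarrow> nat \<Rightarrow> ('k \<Rightarrow> 'v::ab_group_add \<Rightarrow> 'v) \<Rightarrow> 'v set \<Rightarrow>
   ('k mat \<Rightarrow> 'v \<Rightarrow> 'v) \<Rightarrow> ('v \<Rightarrow> 'v) set" where
  "dist_image n G r scale B \<phi> = dist_act G scale B \<phi> ` dist_frob n G r"


section \<open>The group S\<close>

text \<open>The group of \<open>D\<close>-automorphisms of \<open>V\<close>, the semidirect product with \<open>G\<close>, in which \<open>(g, c)\<close> stands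
  for the product \<open>c g\<close>, and its action on subspaces of \<open>V\<close>.\<close>

definition centralizer ::
  "('k::field \<Rightarrow> 'v::ab_group_add \<Rightarrow> 'v) \<Rightarrow> ('v \<Rightarrow> 'v) set \<Rightarrow> ('v \<Rightarrow> 'v) set" where
  "centralizer scale D =
     {c. Vector_Spaces.linear scale scale c \<and> bij c \<and> (\<forall>d \<in> D. c \<circ> d = d \<circ> c)}"

definition semidirect ::
  "nat \<Rightarrow> 'k::field mat set \<Rightarrow> ('k mat \<Rightarrow> 'v \<Rightarrow> 'v) \<Rightarrow> ('v \<Rightarrow> 'v) set \<Rightarrow>
   ('k mat \<times> ('v \<Rightarrow> 'v)) monoid" where
  "semidirect n G \<phi> C =
     \<lparr> carrier = G \<times> C,
       monoid.mult = (\<lambda>(g, c) (g', c'). (g \<otimes>\<^bsub>GL n\<^esub> g', c \<circ> (\<phi> g \<circ> c' \<circ> inv_into UNIV (\<phi> g)))),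
       one = (\<one>\<^bsub>GL n\<^esub>, id) \<rparr>"

definition S_act :: "('k mat \<Rightarrow> 'v \<Rightarrow> 'v) \<Rightarrow> 'k mat \<times> ('v \<Rightarrow> 'v) \<Rightarrow> 'v set \<Rightarrow> 'v set" where
  "S_act \<phi> s W = (snd s \<circ> \<phi> (fst s)) ` W"

text \<open>The coordinate ring of a subgroup of \<open>GL(V)\<close>, without choosing a basis: the matrix coefficients of
  \<open>c\<close> and of its inverse generate the same algebra as those of \<open>c\<close> and \<open>1/det c\<close>.\<close>

definition GLV_coord ::
  "('k::field \<Rightarrow> 'v::ab_group_add \<Rightarrow> 'v) \<Rightarrow> ('v \<Rightarrow> 'v) set \<Rightarrow> (('v \<Rightarrow> 'v) \<Rightarrow> 'k) set" where
  "GLV_coord scale C = coord_ring C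
     ({\<lambda>c. \<xi> (c v) | \<xi> v. functional scale \<xi>} \<union>
      {\<lambda>c. \<xi> (inv_into UNIV c v) | \<xi> v. functional scale \<xi>})"

definition S_space ::
  "nat \<Rightarrow> 'k::field mat set \<Rightarrow> ('k \<Rightarrow> 'v::ab_group_add \<Rightarrow> 'v) \<Rightarrow> ('v \<Rightarrow> 'v) set \<Rightarrow>
   ('k mat \<times> ('v \<Rightarrow> 'v), 'k) fun_space" where
  "S_space n G scale C = affine_space (G \<times> C) (coord_prod G (grp_coord n G) C (GLV_coord scale C))"

definition coset_space ::
  "('s, 'm) monoid_scheme \<Rightarrow> ('s, 'k) fun_space \<Rightarrow> 's set \<Rightarrow> ('s set, 'k) fun_space" where
  "coset_space S X H = quot_space (\<lambda>s. s <#\<^bsub>S\<^esub> H) X"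


section \<open>The Grassmannian\<close>

text \<open>The Grassmannian of \<open>m\<close>-dimensional subspaces is the quotient, by change of basis, of the open
  set of linearly independent \<open>m\<close>-tuples in \<open>V\<^sup>m\<close>; the quotient map sends a tuple to its span.
  Tuples are lists of length \<open>m\<close>.\<close>

definition tuple_space ::
  "('k::field \<Rightarrow> 'v::ab_group_add \<Rightarrow> 'v) \<Rightarrow> nat \<Rightarrow> ('v list, 'k) fun_space" where
  "tuple_space scale m =
     (let L = {vs. length vs = m} in
      affine_space L (coord_ring L {\<lambda>vs. \<xi> (vs ! i) | \<xi> i. functional scale \<xi> \<and> i < m}))"

definition Grass ::
  "('k::field \<Rightarrow> 'v::ab_group_add \<Rightarrow> 'v) \<Rightarrow> nat \<Rightarrow> ('v set, 'k) fun_space" where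
  "Grass scale m =
     quot_space (\<lambda>vs. module.span scale (set vs))
       (sub_space (tuple_space scale m)
          {vs. length vs = m \<and> distinct vs \<and> \<not> module.dependent scale (set vs)})"

lemma points_Grass:
  assumes "finite_dimensional_vector_space scale B"
  shows "points (Grass scale m) =
    {W. module.subspace scale W \<and> vector_space.dim scale W = m}"
proof -
  interpret finite_dimensional_vector_space scale B by fact
  have L: "points (tuple_space scale m) = {vs. length vs = m}"
    by (simp add: tuple_space_def Let_def points_affine_space)
  have "(\<lambda>vs. span (set vs)) ` {vs. length vs = m \<and> distinct vs \<and> independent (set vs)}
        = {W. subspace W \<and> dim W = m}" (is "?A = ?B")
  proof
    show "?A \<subseteq> ?B"
      by (auto simp: subspace_span dim_span dim_eq_card_independent distinct_card)
  next
    show "?B \<subseteq> ?A"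
    proof
      fix W assume W: "W \<in> ?B"
      obtain b where b: "b \<subseteq> W" "independent b" "W \<subseteq> span b" "card b = dim W"
        by (rule basis_exists)
      have "finite b" using b(2) by (rule finiteI_independent)
      then obtain vs where vs: "set vs = b" "distinct vs" using finite_distinct_list by blast
      have "span b = W" using b W span_minimal[of b W] by auto
      moreover have "length vs = m" using vs b W distinct_card[of vs] by simp
      ultimately show "W \<in> ?A" using vs b by (intro image_eqI[of _ _ vs]) simp_all
    qed
  qed
  then show ?thesis
    by (simp add: Grass_def points_quot_space points_sub_space L Int_def)
qed

definition X_set ::
  "('k::field \<Rightarrow> 'v::ab_group_add \<Rightarrow> 'v) \<Rightarrow> ('v \<Rightarrow> 'v) set \<Rightarrow> 'v set \<Rightarrow> 'v set set" where
  "X_set scale D M = {W. D_summand scale D W \<and> D_isomorphic scale D M W}"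

definition X_variety ::
  "('k::field \<Rightarrow> 'v::ab_group_add \<Rightarrow> 'v) \<Rightarrow> ('v \<Rightarrow> 'v) set \<Rightarrow> 'v set \<Rightarrow> ('v set, 'k) fun_space" where
  "X_variety scale D M =
     sub_space (Grass scale (vector_space.dim scale M)) (X_set scale D M)"

end

(* Let p be the D-linear projection onto a summand W0. A D-submodule W of the same dimension on
   which p is injective is the graph of a D-linear map h : W0 -> ker p, and the unipotent
   automorphism 1 + h p lies in C and maps W0 to W. Its matrix coefficients are regular in W by
   Cramer's rule, so on this chart the orbit map S -> X has a regular section. Therefore the
   bijection S/S_M -> X induced by the orbit map, which is a morphism by the universal property of
   the quotient, has a regular inverse. The same charts show that X is a single C-orbit, and that
   the C-orbits are open in the set of summands of a given dimension, so that the connected group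
   G preserves each of them. *)
theory Submission
  imports Defs
begin

section \<open>Sheaves of functions\<close>

text \<open>In characteristic \<open>p\<close> a bijective orbit morphism need not be an
  isomorphism: it may be purely inseparable, like the Frobenius morphism. Regular local sections are
  what rules this out. The charts are indexed by projections that commute with the operators,
  because only then does the correcting automorphism commute with them too.

  Two obstacles concern the orbit itself. Isomorphic summands need not lie in each other's charts,
  so a third submodule lying in both is interpolated; it depends on a scalar avoiding finitely many
  values, hence the field must be infinite. And \<open>\<phi> g\<close> is not in the centralizer:
  it carries \<open>M\<close> to a summand isomorphic to a twist of \<open>M\<close> by conjugation.
  That the twist changes nothing up to isomorphism is a consequence of connectedness, not of a
  formula.

  All spaces involved arise from affine ones by passing to subsets and to quotients. The locale
  below collects the closure properties of regular functions that survive both operations, so that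
  Cramer's rule can be applied directly on the Grassmannian.\<close>

locale function_sheaf =
  fixes X :: "('a, 'k::field) fun_space"
  assumes reg_local: "\<And>U h. openin (ztop X) U \<Longrightarrow>
      (\<And>x. x \<in> U \<Longrightarrow> \<exists>W. openin (ztop X) W \<and> x \<in> W \<and> W \<subseteq> U \<and>
         (\<exists>h' \<in> reg X W. \<forall>y \<in> W. h y = h' y)) \<Longrightarrow> h \<in> reg X U"
    and reg_restrict: "\<And>U W h. h \<in> reg X U \<Longrightarrow> openin (ztop X) U \<Longrightarrow> openin (ztop X) W \<Longrightarrow>
      W \<subseteq> U \<Longrightarrow> h \<in> reg X W"
    and reg_const: "\<And>U a. openin (ztop X) U \<Longrightarrow> (\<lambda>_. a) \<in> reg X U"
    and reg_add: "\<And>U f g. openin (ztop X) U \<Longrightarrow> f \<in> reg X U \<Longrightarrow> g \<in> reg X U \<Longrightarrow>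
      (\<lambda>x. f x + g x) \<in> reg X U"
    and reg_mult: "\<And>U f g. openin (ztop X) U \<Longrightarrow> f \<in> reg X U \<Longrightarrow> g \<in> reg X U \<Longrightarrow>
      (\<lambda>x. f x * g x) \<in> reg X U"
    and reg_nonzero: "\<And>U f. openin (ztop X) U \<Longrightarrow> f \<in> reg X U \<Longrightarrow>
      openin (ztop X) {x \<in> U. f x \<noteq> 0}"
    and reg_inverse: "\<And>U f. openin (ztop X) U \<Longrightarrow> f \<in> reg X U \<Longrightarrow> (\<And>x. x \<in> U \<Longrightarrow> f x \<noteq> 0) \<Longrightarrow>
      (\<lambda>x. inverse (f x)) \<in> reg X U"
begin

lemma openin_points: "openin (ztop X) (points X)"
  by (simp add: points_def)

lemma reg_cong:
  assumes "openin (ztop X) U" "h' \<in> reg X U" "\<And>y. y \<in> U \<Longrightarrow> h y = h' y"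
  shows "h \<in> reg X U"
  by (rule reg_local) (use assms in blast)+

lemma reg_sum:
  assumes "openin (ztop X) U" "\<And>i. i \<in> I \<Longrightarrow> f i \<in> reg X U"
  shows "(\<lambda>x. \<Sum>i\<in>I. f i x) \<in> reg X U"
  using assms(2)
proof (induction I rule: infinite_finite_induct)
  case (insert i I)
  then show ?case by (simp add: reg_add assms(1))
qed (simp_all add: reg_const assms(1))

lemma reg_prod:
  assumes "openin (ztop X) U" "\<And>i. i \<in> I \<Longrightarrow> f i \<in> reg X U"
  shows "(\<lambda>x. \<Prod>i\<in>I. f i x) \<in> reg X U"
  using assms(2)
proof (induction I rule: infinite_finite_induct)
  case (insert i I)
  then show ?case by (simp add: reg_mult assms(1))
qed (simp_all add: reg_const assms(1))

lemma reg_fun_alg_comp: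
  assumes "openin (ztop X) U" "\<And>e. e \<in> E \<Longrightarrow> e \<circ> f \<in> reg X U" "a \<in> fun_alg E"
  shows "a \<circ> f \<in> reg X U"
  using assms(3)
proof induction
  case (const a)
  then show ?case using reg_const[OF assms(1)] by (simp add: comp_def)
next
  case (gen e)
  then show ?case by (rule assms(2))
next
  case (add a b)
  then show ?case using reg_add[OF assms(1)] by (simp add: comp_def)
next
  case (mult a b)
  then show ?case using reg_mult[OF assms(1)] by (simp add: comp_def)
qed

text \<open>Polynomials in regular functions are regular, so generators suffice. The condition
  \<open>f x \<in> Y\<close> is what makes an element of the coordinate ring, extended by zero off
  \<open>Y\<close>, agree with its polynomial expression.\<close>

lemma reg_coord_ring_comp:
  assumes "openin (ztop X) U" "\<And>e. e \<in> E \<Longrightarrow> e \<circ> f \<in> reg X U" "\<And>x. x \<in> U \<Longrightarrow> f x \<in> Y"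
    and "a \<in> coord_ring Y E"
  shows "a \<circ> f \<in> reg X U"
proof -
  obtain a' where a': "a' \<in> fun_alg E" "a = on_set Y a'"
    using assms(4) by (auto simp: coord_ring_def)
  have "a' \<circ> f \<in> reg X U" by (rule reg_fun_alg_comp[OF assms(1,2) a'(1)])
  then show ?thesis
    by (rule reg_cong[OF assms(1)]) (simp add: a' on_set_def assms(3))
qed

end

section \<open>Affine varieties\<close>

lemma openin_affine_space_principal:
  assumes "f \<in> A"
  shows "openin (ztop (affine_space X A)) {x \<in> X. f x \<noteq> 0}"
  by (auto simp: affine_space_def Let_def intro!: topology_generated_by_Basis) (use assms in blast)

lemma reg_affine_space_iff:
  "h \<in> reg (affine_space X A) U \<longleftrightarrow>
     (\<forall>x \<in> U. \<exists>W. \<exists>a \<in> A. \<exists>b \<in> A. openin (ztop (affine_space X A)) W \<and> x \<in> W \<and> W \<subseteq> U \<and>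
        (\<forall>y \<in> W. b y \<noteq> 0 \<and> h y = a y / b y))"
  by (simp add: affine_space_def Let_def)

lemma reg_affine_spaceE:
  assumes "h \<in> reg (affine_space X A) U" "x \<in> U"
  obtains W a b where "a \<in> A" "b \<in> A" "openin (ztop (affine_space X A)) W" "x \<in> W" "W \<subseteq> U"
    "\<forall>y \<in> W. b y \<noteq> 0 \<and> h y = a y / b y"
  using bspec[OF assms(1)[unfolded reg_affine_space_iff] assms(2)]
  by (elim exE bexE conjE) (rule that)

lemma on_set_in: "x \<in> X \<Longrightarrow> on_set X f x = f x"
  by (simp add: on_set_def)

lemma coord_ring_const: "on_set X (\<lambda>_. c) \<in> coord_ring X E"
  by (simp add: coord_ring_def fun_alg.const)

lemma coord_ring_gen: "f \<in> E \<Longrightarrow> on_set X f \<in> coord_ring X E"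
  by (simp add: coord_ring_def fun_alg.gen)

lemma coord_ring_add:
  assumes "f \<in> coord_ring X E" "g \<in> coord_ring X E"
  shows "(\<lambda>x. f x + g x) \<in> coord_ring X E"
proof -
  obtain f' g' where f: "f' \<in> fun_alg E" "f = on_set X f'" and g: "g' \<in> fun_alg E" "g = on_set X g'"
    using assms by (auto simp: coord_ring_def)
  have "(\<lambda>x. f x + g x) = on_set X (\<lambda>x. f' x + g' x)" by (auto simp: f g on_set_def)
  then show ?thesis using fun_alg.add[OF f(1) g(1)] by (simp add: coord_ring_def)
qed

lemma coord_ring_mult:
  assumes "f \<in> coord_ring X E" "g \<in> coord_ring X E"
  shows "(\<lambda>x. f x * g x) \<in> coord_ring X E"
proof -
  obtain f' g' where f: "f' \<in> fun_alg E" "f = on_set X f'" and g: "g' \<in> fun_alg E" "g = on_set X g'"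
    using assms by (auto simp: coord_ring_def)
  have "(\<lambda>x. f x * g x) = on_set X (\<lambda>x. f' x * g' x)" by (auto simp: f g on_set_def)
  then show ?thesis using fun_alg.mult[OF f(1) g(1)] by (simp add: coord_ring_def)
qed

lemma coord_ring_outside: "f \<in> coord_ring X E \<Longrightarrow> x \<notin> X \<Longrightarrow> f x = 0"
  by (auto simp: coord_ring_def on_set_def)

text \<open>Local fractions with nonvanishing denominators obey the usual rules of fractions on the
  intersection of their domains; a fraction \<open>a / b\<close> is nonzero exactly where
  \<open>a\<close> is, which is a principal open condition.\<close>

lemma function_sheaf_affine_space:
  fixes E :: "('a \<Rightarrow> 'k::field) set"
  shows "function_sheaf (affine_space X (coord_ring X E))" (is "function_sheaf ?Y")
proof
  let ?A = "coord_ring X E"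
  have sub: "W \<subseteq> X" if "openin (ztop ?Y) W" for W
    using openin_subset[OF that] points_affine_space[of X E] by (simp add: points_def)
  {
    fix U and h :: "'a \<Rightarrow> 'k"
    assume "openin (ztop ?Y) U" and loc: "\<And>x. x \<in> U \<Longrightarrow> \<exists>W. openin (ztop ?Y) W \<and> x \<in> W \<and> W \<subseteq> U \<and>
         (\<exists>h' \<in> reg ?Y W. \<forall>y \<in> W. h y = h' y)"
    show "h \<in> reg ?Y U"
      unfolding reg_affine_space_iff
    proof
      fix x assume "x \<in> U"
      from loc[OF this] obtain W h'
        where W: "W \<subseteq> U" "x \<in> W" "h' \<in> reg ?Y W" "\<forall>y \<in> W. h y = h' y"
        by blast
      from W(3,2) obtain W' a b where "a \<in> ?A" "b \<in> ?A" "openin (ztop ?Y) W'" "x \<in> W'" "W' \<subseteq> W"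
        "\<forall>y \<in> W'. b y \<noteq> 0 \<and> h' y = a y / b y"
        by (rule reg_affine_spaceE)
      moreover from this have "\<forall>y \<in> W'. b y \<noteq> 0 \<and> h y = a y / b y" "W' \<subseteq> U"
        using W(1,4) by (simp_all add: subset_iff)
      ultimately show "\<exists>W. \<exists>a \<in> ?A. \<exists>b \<in> ?A. openin (ztop ?Y) W \<and> x \<in> W \<and> W \<subseteq> U \<and>
          (\<forall>y \<in> W. b y \<noteq> 0 \<and> h y = a y / b y)" by blast
    qed
  next
    fix U W and h :: "'a \<Rightarrow> 'k"
    assume h: "h \<in> reg ?Y U" "openin (ztop ?Y) U" "openin (ztop ?Y) W" "W \<subseteq> U"
    show "h \<in> reg ?Y W"
      unfolding reg_affine_space_iff
    proof
      fix x assume "x \<in> W"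
      then have "x \<in> U" using h(4) by blast
      with h(1) obtain W' a b where "a \<in> ?A" "b \<in> ?A" "openin (ztop ?Y) W'" "x \<in> W'" "W' \<subseteq> U"
        "\<forall>y \<in> W'. b y \<noteq> 0 \<and> h y = a y / b y"
        by (rule reg_affine_spaceE)
      then show "\<exists>W'. \<exists>a \<in> ?A. \<exists>b \<in> ?A. openin (ztop ?Y) W' \<and> x \<in> W' \<and> W' \<subseteq> W \<and>
          (\<forall>y \<in> W'. b y \<noteq> 0 \<and> h y = a y / b y)"
        using h \<open>x \<in> W\<close> by (intro exI[of _ "W' \<inter> W"] bexI[of _ a] bexI[of _ b]) auto
    qed
  next
    fix U and c :: 'k
    assume U: "openin (ztop ?Y) U"
    show "(\<lambda>_. c) \<in> reg ?Y U"
      unfolding reg_affine_space_iff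
    proof
      fix x assume "x \<in> U"
      then show "\<exists>W. \<exists>a \<in> ?A. \<exists>b \<in> ?A. openin (ztop ?Y) W \<and> x \<in> W \<and> W \<subseteq> U \<and>
          (\<forall>y \<in> W. b y \<noteq> 0 \<and> c = a y / b y)"
        using U sub[OF U]
        by - (rule exI[of _ U], rule bexI[of _ "on_set X (\<lambda>_. c)"],
          rule bexI[of _ "on_set X (\<lambda>_. 1)"],
          auto simp: on_set_in coord_ring_const subset_iff)
    qed
  next
    fix U and f g :: "'a \<Rightarrow> 'k"
    assume U: "openin (ztop ?Y) U" and fg: "f \<in> reg ?Y U" "g \<in> reg ?Y U"
    show "(\<lambda>x. f x + g x) \<in> reg ?Y U"
      unfolding reg_affine_space_iff
    proof
      fix x assume "x \<in> U"
      with fg(1) obtain V a b where 1: "a \<in> ?A" "b \<in> ?A" "openin (ztop ?Y) V" "x \<in> V" "V \<subseteq> U"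
        "\<forall>y \<in> V. b y \<noteq> 0 \<and> f y = a y / b y"
        by (rule reg_affine_spaceE)
      obtain W c d where 2: "c \<in> ?A" "d \<in> ?A" "openin (ztop ?Y) W" "x \<in> W" "W \<subseteq> U"
        "\<forall>y \<in> W. d y \<noteq> 0 \<and> g y = c y / d y"
        using fg(2) \<open>x \<in> U\<close> by (rule reg_affine_spaceE)
      show "\<exists>W. \<exists>a \<in> ?A. \<exists>b \<in> ?A. openin (ztop ?Y) W \<and> x \<in> W \<and> W \<subseteq> U \<and>
          (\<forall>y \<in> W. b y \<noteq> 0 \<and> f y + g y = a y / b y)"
        using 1 2 by - (rule exI[of _ "V \<inter> W"], rule bexI[of _ "\<lambda>y. a y * d y + b y * c y"],
            rule bexI[of _ "\<lambda>y. b y * d y"],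
          auto simp: add_frac_eq coord_ring_add coord_ring_mult)
    qed
    show "(\<lambda>x. f x * g x) \<in> reg ?Y U"
      unfolding reg_affine_space_iff
    proof
      fix x assume "x \<in> U"
      with fg(1) obtain V a b where 1: "a \<in> ?A" "b \<in> ?A" "openin (ztop ?Y) V" "x \<in> V" "V \<subseteq> U"
        "\<forall>y \<in> V. b y \<noteq> 0 \<and> f y = a y / b y"
        by (rule reg_affine_spaceE)
      obtain W c d where 2: "c \<in> ?A" "d \<in> ?A" "openin (ztop ?Y) W" "x \<in> W" "W \<subseteq> U"
        "\<forall>y \<in> W. d y \<noteq> 0 \<and> g y = c y / d y"
        using fg(2) \<open>x \<in> U\<close> by (rule reg_affine_spaceE)
      show "\<exists>W. \<exists>a \<in> ?A. \<exists>b \<in> ?A. openin (ztop ?Y) W \<and> x \<in> W \<and> W \<subseteq> U \<and>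
          (\<forall>y \<in> W. b y \<noteq> 0 \<and> f y * g y = a y / b y)"
        using 1 2 by - (rule exI[of _ "V \<inter> W"], rule bexI[of _ "\<lambda>y. a y * c y"],
            rule bexI[of _ "\<lambda>y. b y * d y"],
          auto simp: coord_ring_mult)
    qed
  next
    fix U and f :: "'a \<Rightarrow> 'k"
    assume U: "openin (ztop ?Y) U" and f: "f \<in> reg ?Y U"
    show "openin (ztop ?Y) {x \<in> U. f x \<noteq> 0}"
    proof (subst openin_subopen, intro ballI)
      fix x assume x: "x \<in> {x \<in> U. f x \<noteq> 0}"
      then have "x \<in> U" by blast
      with f obtain V a b where 1: "a \<in> ?A" "b \<in> ?A" "openin (ztop ?Y) V" "x \<in> V" "V \<subseteq> U"
        "\<forall>y \<in> V. b y \<noteq> 0 \<and> f y = a y / b y"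
        by (rule reg_affine_spaceE)
      show "\<exists>T. openin (ztop ?Y) T \<and> x \<in> T \<and> T \<subseteq> {x \<in> U. f x \<noteq> 0}"
        using 1 x openin_affine_space_principal[OF 1(1)] sub[OF U]
        by (intro exI[of _ "V \<inter> {x \<in> X. a x \<noteq> 0}"]) auto
    qed
  next
    fix U and f :: "'a \<Rightarrow> 'k"
    assume U: "openin (ztop ?Y) U" and f: "f \<in> reg ?Y U" and nz: "\<And>x. x \<in> U \<Longrightarrow> f x \<noteq> 0"
    show "(\<lambda>x. inverse (f x)) \<in> reg ?Y U"
      unfolding reg_affine_space_iff
    proof
      fix x assume "x \<in> U"
      with f obtain V a b where 1: "a \<in> ?A" "b \<in> ?A" "openin (ztop ?Y) V" "x \<in> V" "V \<subseteq> U"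
        "\<forall>y \<in> V. b y \<noteq> 0 \<and> f y = a y / b y"
        by (rule reg_affine_spaceE)
      have "a y \<noteq> 0" if "y \<in> V" for y using 1 nz[of y] that by auto
      with 1 show "\<exists>W. \<exists>a \<in> ?A. \<exists>b \<in> ?A. openin (ztop ?Y) W \<and> x \<in> W \<and> W \<subseteq> U \<and>
          (\<forall>y \<in> W. b y \<noteq> 0 \<and> inverse (f y) = a y / b y)"
        by - (rule exI[of _ V], rule bexI[of _ b], rule bexI[of _ a], auto)
    qed
  }
qed

lemma reg_coord_ring:
  assumes "f \<in> coord_ring X E" "openin (ztop (affine_space X (coord_ring X E))) U"
  shows "f \<in> reg (affine_space X (coord_ring X E)) U"
proof -
  have sub: "U \<subseteq> X"
    using openin_subset[OF assms(2)] points_affine_space[of X E] by (simp add: points_def)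
  show ?thesis
    unfolding reg_affine_space_iff
    using assms sub
    by - (intro ballI, rule exI[of _ U], rule bexI[of _ f], rule bexI[of _ "on_set X (\<lambda>_. 1)"],
      auto simp: on_set_in coord_ring_const subset_iff)
qed

text \<open>A generator may be nonzero off \<open>X\<close> and then is not itself in the coordinate
  ring; it agrees on \<open>U\<close> with its extension by zero, which is.\<close>

lemma reg_gen:
  assumes "f \<in> E" "openin (ztop (affine_space X (coord_ring X E))) U"
  shows "f \<in> reg (affine_space X (coord_ring X E)) U"
proof (rule function_sheaf.reg_cong[OF function_sheaf_affine_space assms(2)])
  show "on_set X f \<in> reg (affine_space X (coord_ring X E)) U"
    by (rule reg_coord_ring[OF coord_ring_gen[OF assms(1)] assms(2)])
  show "f y = on_set X f y" if "y \<in> U" for y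
    using openin_subset[OF assms(2)] that points_affine_space[of X E]
    by (auto simp: on_set_def points_def)
qed

section \<open>The structure induced on a subset\<close>

lemma reg_sub_space_iff:
  "h \<in> reg (sub_space Y X) U \<longleftrightarrow>
     (\<forall>x \<in> U. \<exists>W h'. openin (ztop Y) W \<and> x \<in> W \<and> W \<inter> X \<subseteq> U \<and>
        h' \<in> reg Y W \<and> (\<forall>y \<in> W \<inter> X. h y = h' y))"
  by (simp add: sub_space_def)

lemma reg_sub_spaceE:
  assumes "h \<in> reg (sub_space Y X) U" "x \<in> U"
  obtains W h' where "openin (ztop Y) W" "x \<in> W" "W \<inter> X \<subseteq> U" "h' \<in> reg Y W"
    "\<forall>y \<in> W \<inter> X. h y = h' y"
  using bspec[OF assms(1)[unfolded reg_sub_space_iff] assms(2)] by (elim exE conjE) (rule that)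

lemma openin_sub_space_iff:
  "openin (ztop (sub_space Y X)) U \<longleftrightarrow> (\<exists>T. openin (ztop Y) T \<and> U = T \<inter> X)"
  by (simp add: sub_space_def openin_subtopology)

lemma reg_sub_space:
  assumes "h \<in> reg Y W" "openin (ztop Y) W" "U = W \<inter> X"
  shows "h \<in> reg (sub_space Y X) U"
  unfolding reg_sub_space_iff using assms by blast

lemma function_sheaf_sub_space:
  assumes "function_sheaf Y"
  shows "function_sheaf (sub_space Y X)" (is "function_sheaf ?Z")
proof -
  interpret Y: function_sheaf Y by fact
  have sub: "U \<subseteq> X" if "openin (ztop ?Z) U" for U
    using that by (auto simp: openin_sub_space_iff)
  show ?thesis
  proof
    fix U h
    assume "openin (ztop ?Z) U" and loc: "\<And>x. x \<in> U \<Longrightarrow> \<exists>W. openin (ztop ?Z) W \<and> x \<in> W \<and> W \<subseteq> U \<and>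
         (\<exists>h' \<in> reg ?Z W. \<forall>y \<in> W. h y = h' y)"
    show "h \<in> reg ?Z U"
      unfolding reg_sub_space_iff
    proof
      fix x assume "x \<in> U"
      from loc[OF this] obtain W h'
        where W: "W \<subseteq> U" "x \<in> W" "h' \<in> reg ?Z W" "\<forall>y \<in> W. h y = h' y"
        by blast
      from W(3,2) obtain W' h'' where "openin (ztop Y) W'" "x \<in> W'" "W' \<inter> X \<subseteq> W"
        "h'' \<in> reg Y W'" "\<forall>y \<in> W' \<inter> X. h' y = h'' y"
        by (rule reg_sub_spaceE)
      moreover from this have "W' \<inter> X \<subseteq> U" "\<forall>y \<in> W' \<inter> X. h y = h'' y"
        using W(1,4) by (simp_all add: subset_iff)
      ultimately show "\<exists>W h'. openin (ztop Y) W \<and> x \<in> W \<and> W \<inter> X \<subseteq> U \<and>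
        h' \<in> reg Y W \<and> (\<forall>y \<in> W \<inter> X. h y = h' y)" by blast
    qed
  next
    fix U W h
    assume h: "h \<in> reg ?Z U" "openin (ztop ?Z) U" "openin (ztop ?Z) W" "W \<subseteq> U"
    obtain T where T: "openin (ztop Y) T" "W = T \<inter> X"
      using h(3) by (auto simp: openin_sub_space_iff)
    show "h \<in> reg ?Z W"
      unfolding reg_sub_space_iff
    proof
      fix x assume x: "x \<in> W"
      then have "x \<in> U" using h(4) by blast
      with h(1) obtain W' h' where 1: "openin (ztop Y) W'" "x \<in> W'" "W' \<inter> X \<subseteq> U"
        "h' \<in> reg Y W'" "\<forall>y \<in> W' \<inter> X. h y = h' y"
        by (rule reg_sub_spaceE)
      have "h' \<in> reg Y (W' \<inter> T)"
        using 1(1) T by (intro Y.reg_restrict[OF 1(4,1)]) auto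
      then show "\<exists>W' h'. openin (ztop Y) W' \<and> x \<in> W' \<and> W' \<inter> X \<subseteq> W \<and>
        h' \<in> reg Y W' \<and> (\<forall>y \<in> W' \<inter> X. h y = h' y)"
        using 1 T x by (intro exI[of _ "W' \<inter> T"] exI[of _ h']) auto
    qed
  next
    fix U c
    assume U: "openin (ztop ?Z) U"
    then show "(\<lambda>_. c) \<in> reg ?Z U"
      by (auto simp: openin_sub_space_iff intro: reg_sub_space Y.reg_const)
  next
    fix U f g
    assume U: "openin (ztop ?Z) U" and fg: "f \<in> reg ?Z U" "g \<in> reg ?Z U"
    have loc: "\<exists>W f' g'. openin (ztop Y) W \<and> x \<in> W \<and> W \<inter> X \<subseteq> U \<and> f' \<in> reg Y W \<and> g' \<in> reg Y W \<and>
        (\<forall>y \<in> W \<inter> X. f y = f' y \<and> g y = g' y)" if x: "x \<in> U" for x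
    proof -
      obtain V f' where 1: "openin (ztop Y) V" "x \<in> V" "V \<inter> X \<subseteq> U"
        "f' \<in> reg Y V" "\<forall>y \<in> V \<inter> X. f y = f' y"
        using fg(1) x by (rule reg_sub_spaceE)
      obtain W g' where 2: "openin (ztop Y) W" "x \<in> W" "W \<inter> X \<subseteq> U"
        "g' \<in> reg Y W" "\<forall>y \<in> W \<inter> X. g y = g' y"
        using fg(2) x by (rule reg_sub_spaceE)
      have "f' \<in> reg Y (V \<inter> W)" "g' \<in> reg Y (V \<inter> W)"
        using 1 2 by (auto intro: Y.reg_restrict)
      then show ?thesis using 1 2 by (intro exI[of _ "V \<inter> W"] exI[of _ f'] exI[of _ g']) auto
    qed
    show "(\<lambda>x. f x + g x) \<in> reg ?Z U"
      unfolding reg_sub_space_iff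
    proof
      fix x assume "x \<in> U"
      from loc[OF this] obtain W f' g' where 1: "openin (ztop Y) W" "x \<in> W" "W \<inter> X \<subseteq> U"
        "f' \<in> reg Y W" "g' \<in> reg Y W" "\<forall>y \<in> W \<inter> X. f y = f' y \<and> g y = g' y" by blast
      then show "\<exists>W h'. openin (ztop Y) W \<and> x \<in> W \<and> W \<inter> X \<subseteq> U \<and>
        h' \<in> reg Y W \<and> (\<forall>y \<in> W \<inter> X. f y + g y = h' y)"
        using Y.reg_add[OF 1(1,4,5)] by (intro exI[of _ W] exI[of _ "\<lambda>y. f' y + g' y"]) auto
    qed
    show "(\<lambda>x. f x * g x) \<in> reg ?Z U"
      unfolding reg_sub_space_iff
    proof
      fix x assume "x \<in> U"
      from loc[OF this] obtain W f' g' where 1: "openin (ztop Y) W" "x \<in> W" "W \<inter> X \<subseteq> U"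
        "f' \<in> reg Y W" "g' \<in> reg Y W" "\<forall>y \<in> W \<inter> X. f y = f' y \<and> g y = g' y" by blast
      then show "\<exists>W h'. openin (ztop Y) W \<and> x \<in> W \<and> W \<inter> X \<subseteq> U \<and>
        h' \<in> reg Y W \<and> (\<forall>y \<in> W \<inter> X. f y * g y = h' y)"
        using Y.reg_mult[OF 1(1,4,5)] by (intro exI[of _ W] exI[of _ "\<lambda>y. f' y * g' y"]) auto
    qed
  next
    fix U f
    assume U: "openin (ztop ?Z) U" and f: "f \<in> reg ?Z U"
    show "openin (ztop ?Z) {x \<in> U. f x \<noteq> 0}"
    proof (subst openin_subopen, intro ballI)
      fix x assume x: "x \<in> {x \<in> U. f x \<noteq> 0}"
      then have "x \<in> U" by blast
      with f obtain V f' where 1: "openin (ztop Y) V" "x \<in> V" "V \<inter> X \<subseteq> U"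
        "f' \<in> reg Y V" "\<forall>y \<in> V \<inter> X. f y = f' y"
        by (rule reg_sub_spaceE)
      show "\<exists>T. openin (ztop ?Z) T \<and> x \<in> T \<and> T \<subseteq> {x \<in> U. f x \<noteq> 0}"
        using 1 x Y.reg_nonzero[OF 1(1,4)] sub[OF U] unfolding openin_sub_space_iff
        by (intro exI[of _ "{x \<in> V. f' x \<noteq> 0} \<inter> X"]) auto
    qed
  next
    fix U f
    assume U: "openin (ztop ?Z) U" and f: "f \<in> reg ?Z U" and nz: "\<And>x. x \<in> U \<Longrightarrow> f x \<noteq> 0"
    show "(\<lambda>x. inverse (f x)) \<in> reg ?Z U"
      unfolding reg_sub_space_iff
    proof
      fix x assume x: "x \<in> U"
      with f obtain V f' where 1: "openin (ztop Y) V" "x \<in> V" "V \<inter> X \<subseteq> U"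
        "f' \<in> reg Y V" "\<forall>y \<in> V \<inter> X. f y = f' y"
        by (rule reg_sub_spaceE)
      \<comment> \<open>The ambient extension \<open>f'\<close> may vanish at points off
        \<open>X\<close>, so its domain is shrunk before inverting.\<close>
      let ?V = "{x \<in> V. f' x \<noteq> 0}"
      have V: "openin (ztop Y) ?V" by (rule Y.reg_nonzero[OF 1(1,4)])
      have "(\<lambda>x. inverse (f' x)) \<in> reg Y ?V"
        by (rule Y.reg_inverse[OF V Y.reg_restrict[OF 1(4,1) V]]) auto
      moreover have "x \<in> ?V" using 1 nz[OF x] sub[OF U] x by auto
      ultimately show "\<exists>W h'. openin (ztop Y) W \<and> x \<in> W \<and> W \<inter> X \<subseteq> U \<and>
        h' \<in> reg Y W \<and> (\<forall>y \<in> W \<inter> X. inverse (f y) = h' y)"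
        using 1 V by (intro exI[of _ ?V] exI[of _ "\<lambda>x. inverse (f' x)"]) auto
    qed
  qed
qed

section \<open>The quotient structure\<close>

lemma reg_quot_space_iff:
  "h \<in> reg (quot_space q X) U \<longleftrightarrow> h \<circ> q \<in> reg X {x \<in> points X. q x \<in> U}"
  by (simp add: quot_space_def)

text \<open>Each axiom pulls back along \<open>q\<close>, since openness and regularity on the
  quotient are statements about preimages and pullbacks.\<close>

lemma function_sheaf_quot_space:
  assumes "function_sheaf X"
  shows "function_sheaf (quot_space q X)" (is "function_sheaf ?Z")
proof -
  interpret X: function_sheaf X by fact
  show ?thesis
  proof
    fix U h
    assume U: "openin (ztop ?Z) U" and loc: "\<And>x. x \<in> U \<Longrightarrow> \<exists>W. openin (ztop ?Z) W \<and> x \<in> W \<and> W \<subseteq> U \<and>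
         (\<exists>h' \<in> reg ?Z W. \<forall>y \<in> W. h y = h' y)"
    show "h \<in> reg ?Z U"
      unfolding reg_quot_space_iff
    proof (rule X.reg_local)
      show "openin (ztop X) {x \<in> points X. q x \<in> U}" using U by (simp add: openin_quot_space)
      fix x assume x: "x \<in> {x \<in> points X. q x \<in> U}"
      then have "q x \<in> U" by simp
      from loc[OF this] obtain W h' where "openin (ztop ?Z) W" "q x \<in> W" "W \<subseteq> U" "h' \<in> reg ?Z W"
        "\<forall>y \<in> W. h y = h' y" by blast
      then show "\<exists>W. openin (ztop X) W \<and> x \<in> W \<and> W \<subseteq> {x \<in> points X. q x \<in> U} \<and>
          (\<exists>h'\<in>reg X W. \<forall>y\<in>W. (h \<circ> q) y = h' y)"
        using x by (intro exI[of _ "{x \<in> points X. q x \<in> W}"])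
          (auto simp: openin_quot_space reg_quot_space_iff intro!: bexI[of _ "h' \<circ> q"])
    qed
  next
    fix U W h
    assume "h \<in> reg ?Z U" "openin (ztop ?Z) U" "openin (ztop ?Z) W" "W \<subseteq> U"
    then show "h \<in> reg ?Z W"
      by (auto simp: reg_quot_space_iff openin_quot_space
          elim!: X.reg_restrict[of "h \<circ> q" "{x \<in> points X. q x \<in> U}"])
  next
    fix U c assume "openin (ztop ?Z) U"
    then show "(\<lambda>_. c) \<in> reg ?Z U"
      using X.reg_const by (simp add: reg_quot_space_iff openin_quot_space comp_def)
  next
    fix U f g assume "openin (ztop ?Z) U" "f \<in> reg ?Z U" "g \<in> reg ?Z U"
    then show "(\<lambda>x. f x + g x) \<in> reg ?Z U" "(\<lambda>x. f x * g x) \<in> reg ?Z U"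
      using X.reg_add[of "{x \<in> points X. q x \<in> U}" "f \<circ> q" "g \<circ> q"]
        X.reg_mult[of "{x \<in> points X. q x \<in> U}" "f \<circ> q" "g \<circ> q"]
      by (simp_all add: reg_quot_space_iff openin_quot_space comp_def)
  next
    fix U f assume U: "openin (ztop ?Z) U" "f \<in> reg ?Z U"
    have "openin (ztop X) {x \<in> {x \<in> points X. q x \<in> U}. (f \<circ> q) x \<noteq> 0}"
      using U by (intro X.reg_nonzero[of _ "f \<circ> q"]) (simp_all add: reg_quot_space_iff openin_quot_space)
    also have "{x \<in> {x \<in> points X. q x \<in> U}. (f \<circ> q) x \<noteq> 0}
      = {x \<in> points X. q x \<in> {x \<in> U. f x \<noteq> 0}}" by auto
    finally show "openin (ztop ?Z) {x \<in> U. f x \<noteq> 0}"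
      using U by (auto simp: openin_quot_space)
  next
    fix U f assume U: "openin (ztop ?Z) U" "f \<in> reg ?Z U" "\<And>x. x \<in> U \<Longrightarrow> f x \<noteq> 0"
    have "(\<lambda>x. inverse ((f \<circ> q) x)) \<in> reg X {x \<in> points X. q x \<in> U}"
      using U by (intro X.reg_inverse[of _ "f \<circ> q"]) (auto simp: reg_quot_space_iff openin_quot_space)
    then show "(\<lambda>x. inverse (f x)) \<in> reg ?Z U"
      by (simp add: reg_quot_space_iff comp_def)
  qed
qed


section \<open>Morphisms\<close>

lemma fs_morphism_openin:
  assumes "fs_morphism X Y f" "openin (ztop Y) U"
  shows "openin (ztop X) {x \<in> points X. f x \<in> U}"
  using assms by (simp add: fs_morphism_def continuous_map points_def)

lemma fs_morphism_points: "fs_morphism X Y f \<Longrightarrow> x \<in> points X \<Longrightarrow> f x \<in> points Y"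
  by (auto simp: fs_morphism_def continuous_map_def points_def Pi_iff)

lemma fs_morphismI:
  assumes "\<And>x. x \<in> points X \<Longrightarrow> f x \<in> points Y"
    and "\<And>U. openin (ztop Y) U \<Longrightarrow> openin (ztop X) {x \<in> points X. f x \<in> U}"
    and "\<And>U h. openin (ztop Y) U \<Longrightarrow> h \<in> reg Y U \<Longrightarrow> h \<circ> f \<in> reg X {x \<in> points X. f x \<in> U}"
  shows "fs_morphism X Y f"
  using assms by (auto simp: fs_morphism_def continuous_map_def points_def Pi_iff)

lemma fs_morphism_cong:
  assumes X: "function_sheaf X" and f: "fs_morphism X Y f"
    and eq: "\<And>x. x \<in> points X \<Longrightarrow> f x = g x"
  shows "fs_morphism X Y g"
proof (rule fs_morphismI)
  interpret X: function_sheaf X by fact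
  have pre: "{x \<in> points X. g x \<in> U} = {x \<in> points X. f x \<in> U}" for U using eq by auto
  show "g x \<in> points Y" if "x \<in> points X" for x
    using fs_morphism_points[OF f that] eq[OF that] by simp
  fix U assume U: "openin (ztop Y) U"
  show op: "openin (ztop X) {x \<in> points X. g x \<in> U}"
    unfolding pre by (rule fs_morphism_openin[OF f U])
  fix h assume "h \<in> reg Y U"
  then have "h \<circ> f \<in> reg X {x \<in> points X. g x \<in> U}"
    using f U unfolding pre fs_morphism_def by blast
  then show "h \<circ> g \<in> reg X {x \<in> points X. g x \<in> U}"
    by (rule X.reg_cong[OF op]) (simp add: eq)
qed

lemma fs_morphism_comp:
  assumes f: "fs_morphism X Y f" and g: "fs_morphism Y Z g"
  shows "fs_morphism X Z (g \<circ> f)"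
proof (rule fs_morphismI)
  show "(g \<circ> f) x \<in> points Z" if "x \<in> points X" for x
    using that f g by (simp add: fs_morphism_points)
  have eq: "{x \<in> points X. f x \<in> {y \<in> points Y. g y \<in> U}} = {x \<in> points X. (g \<circ> f) x \<in> U}" for U
    using f by (auto simp: fs_morphism_points)
  show "openin (ztop X) {x \<in> points X. (g \<circ> f) x \<in> U}" if "openin (ztop Z) U" for U
    using fs_morphism_openin[OF f fs_morphism_openin[OF g that]] unfolding eq .
  show "h \<circ> (g \<circ> f) \<in> reg X {x \<in> points X. (g \<circ> f) x \<in> U}"
    if U: "openin (ztop Z) U" "h \<in> reg Z U" for U h
  proof -
    have "h \<circ> g \<in> reg Y {y \<in> points Y. g y \<in> U}" using g U by (simp add: fs_morphism_def)
    then have "(h \<circ> g) \<circ> f \<in> reg X {x \<in> points X. f x \<in> {y \<in> points Y. g y \<in> U}}"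
      using f fs_morphism_openin[OF g U(1)] unfolding fs_morphism_def by blast
    then show ?thesis unfolding eq comp_assoc .
  qed
qed

text \<open>Pullbacks of the whole coordinate ring are then regular. Principal open sets pull back
  to nonvanishing loci of regular functions, and local fractions to local fractions.\<close>

lemma fs_morphism_affine_space:
  assumes "function_sheaf X"
    and f: "\<And>x. x \<in> points X \<Longrightarrow> f x \<in> Y"
    and E: "\<And>e. e \<in> E \<Longrightarrow> e \<circ> f \<in> reg X (points X)"
  shows "fs_morphism X (affine_space Y (coord_ring Y E)) f" (is "fs_morphism X ?Y f")
proof -
  interpret X: function_sheaf X by fact
  have A: "a \<circ> f \<in> reg X (points X)" if "a \<in> coord_ring Y E" for a
    by (rule X.reg_coord_ring_comp[OF X.openin_points E f that])
  have cont: "continuous_map (ztop X) (ztop ?Y) f"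
    unfolding affine_space_def Let_def fun_space.select_convs
  proof (rule continuous_on_generated_topo)
    fix U assume "U \<in> {{x \<in> Y. a x \<noteq> 0} | a. a \<in> coord_ring Y E}"
    then obtain a where a: "a \<in> coord_ring Y E" "U = {x \<in> Y. a x \<noteq> 0}" by blast
    have "f -` U \<inter> topspace (ztop X) = {x \<in> points X. (a \<circ> f) x \<noteq> 0}"
      using f by (auto simp: a points_def)
    then show "openin (ztop X) (f -` U \<inter> topspace (ztop X))"
      using X.reg_nonzero[OF X.openin_points A[OF a(1)]] by simp
  next
    have "f ` topspace (ztop X) \<subseteq> Y" using f by (auto simp: points_def)
    also have "Y = topspace (ztop ?Y)" using points_affine_space[of Y E] by (simp add: points_def)
    finally show "f ` topspace (ztop X) \<subseteq> \<Union>{{x \<in> Y. a x \<noteq> 0} | a. a \<in> coord_ring Y E}"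
      by (simp add: affine_space_def Let_def)
  qed
  then have op: "openin (ztop X) {x \<in> points X. f x \<in> U}" if "openin (ztop ?Y) U" for U
    using that by (simp add: continuous_map points_def)
  have "h \<circ> f \<in> reg X {x \<in> points X. f x \<in> U}"
    if U: "openin (ztop ?Y) U" "h \<in> reg ?Y U" for U h
  proof (rule X.reg_local[OF op[OF U(1)]])
    fix x assume x: "x \<in> {x \<in> points X. f x \<in> U}"
    then have "f x \<in> U" by blast
    with U(2) obtain W a b where W: "a \<in> coord_ring Y E" "b \<in> coord_ring Y E" "openin (ztop ?Y) W"
      "f x \<in> W" "W \<subseteq> U" "\<forall>y \<in> W. b y \<noteq> 0 \<and> h y = a y / b y"
      by (rule reg_affine_spaceE)
    let ?W = "{x \<in> points X. f x \<in> W}"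
    have W': "openin (ztop X) ?W" by (rule op[OF W(3)])
    have ab: "a \<circ> f \<in> reg X ?W" "b \<circ> f \<in> reg X ?W"
      by (rule X.reg_restrict[OF A[OF W(1)] X.openin_points W'] X.reg_restrict[OF A[OF W(2)] X.openin_points W'],
        blast)+
    have "(\<lambda>x. (a \<circ> f) x * inverse ((b \<circ> f) x)) \<in> reg X ?W"
      using W(6) by (intro X.reg_mult X.reg_inverse W' ab) auto
    then show "\<exists>W. openin (ztop X) W \<and> x \<in> W \<and> W \<subseteq> {x \<in> points X. f x \<in> U} \<and>
        (\<exists>h'\<in>reg X W. \<forall>y\<in>W. (h \<circ> f) y = h' y)"
      using W(4-6) W' x
      by (intro exI[of _ ?W] conjI bexI[of _ "\<lambda>x. (a \<circ> f) x * inverse ((b \<circ> f) x)"])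
        (auto simp: divide_inverse)
  qed
  with cont show ?thesis by (simp add: fs_morphism_def)
qed

lemma fs_morphism_into_sub_space:
  assumes "function_sheaf X" and f: "fs_morphism X Y f" and Z: "\<And>x. x \<in> points X \<Longrightarrow> f x \<in> Z"
  shows "fs_morphism X (sub_space Y Z) f"
proof (rule fs_morphismI)
  interpret X: function_sheaf X by fact
  show "f x \<in> points (sub_space Y Z)" if "x \<in> points X" for x
    using that Z f by (simp add: points_sub_space fs_morphism_points)
  show op: "openin (ztop X) {x \<in> points X. f x \<in> U}" if U: "openin (ztop (sub_space Y Z)) U" for U
  proof -
    obtain T where T: "openin (ztop Y) T" "U = T \<inter> Z" using U by (auto simp: openin_sub_space_iff)
    then have "{x \<in> points X. f x \<in> U} = {x \<in> points X. f x \<in> T}" using Z by auto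
    then show ?thesis using fs_morphism_openin[OF f T(1)] by simp
  qed
  show "h \<circ> f \<in> reg X {x \<in> points X. f x \<in> U}"
    if U: "openin (ztop (sub_space Y Z)) U" "h \<in> reg (sub_space Y Z) U" for U h
  proof (rule X.reg_local[OF op[OF U(1)]])
    fix x assume x: "x \<in> {x \<in> points X. f x \<in> U}"
    then have "f x \<in> U" by blast
    with U(2) obtain W h' where W: "openin (ztop Y) W" "f x \<in> W" "W \<inter> Z \<subseteq> U"
      "h' \<in> reg Y W" "\<forall>y \<in> W \<inter> Z. h y = h' y"
      by (rule reg_sub_spaceE)
    then have "h' \<circ> f \<in> reg X {x \<in> points X. f x \<in> W}" using f by (simp add: fs_morphism_def)
    then show "\<exists>W. openin (ztop X) W \<and> x \<in> W \<and> W \<subseteq> {x \<in> points X. f x \<in> U} \<and>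
        (\<exists>h'\<in>reg X W. \<forall>y\<in>W. (h \<circ> f) y = h' y)"
      using W x Z fs_morphism_openin[OF f W(1)]
      by (intro exI[of _ "{x \<in> points X. f x \<in> W}"] conjI bexI[of _ "h' \<circ> f"]) auto
  qed
qed

lemma fs_morphism_quot_space: "fs_morphism X (quot_space q X) q"
  by (rule fs_morphismI) (auto simp: points_quot_space openin_quot_space reg_quot_space_iff)

text \<open>The universal property of the quotient. The factorization is only assumed on points, so
  \<open>h \<circ> f' \<circ> q\<close> and \<open>h \<circ> f\<close> are compared through
  \<open>reg_cong\<close>.\<close>

lemma fs_morphism_from_quot_space:
  assumes "function_sheaf X" and f: "fs_morphism X Y f"
    and f': "\<And>x. x \<in> points X \<Longrightarrow> f' (q x) = f x"
  shows "fs_morphism (quot_space q X) Y f'"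
proof (rule fs_morphismI)
  interpret X: function_sheaf X by fact
  show "f' z \<in> points Y" if "z \<in> points (quot_space q X)" for z
    using that f f' by (auto simp: points_quot_space fs_morphism_points)
  have eq: "{x \<in> points X. q x \<in> {z \<in> points (quot_space q X). f' z \<in> U}} = {x \<in> points X. f x \<in> U}"
    for U by (intro Collect_cong conj_cong refl) (simp add: points_quot_space f' imageI)
  show "openin (ztop (quot_space q X)) {z \<in> points (quot_space q X). f' z \<in> U}"
    if "openin (ztop Y) U" for U
    using fs_morphism_openin[OF f that] unfolding openin_quot_space eq
    by (auto simp: points_quot_space)
  show "h \<circ> f' \<in> reg (quot_space q X) {z \<in> points (quot_space q X). f' z \<in> U}"
    if "openin (ztop Y) U" "h \<in> reg Y U" for U h
    unfolding reg_quot_space_iff eq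
  proof (rule X.reg_cong)
    show "openin (ztop X) {x \<in> points X. f x \<in> U}" by (rule fs_morphism_openin[OF f that(1)])
    show "h \<circ> f \<in> reg X {x \<in> points X. f x \<in> U}" using f that by (simp add: fs_morphism_def)
  qed (simp add: f')
qed

text \<open>For open \<open>N\<close> the ambient local extensions can be cut down to
  \<open>N\<close> itself, so nothing is lost by passing to the induced structure. This is the fact
  behind gluing.\<close>

lemma reg_open_sub_space:
  assumes "function_sheaf Y" and N: "openin (ztop Y) N" "U \<subseteq> N"
    and U: "openin (ztop Y) U" and h: "h \<in> reg (sub_space Y N) U"
  shows "h \<in> reg Y U"
proof -
  interpret Y: function_sheaf Y by fact
  show ?thesis
  proof (rule Y.reg_local[OF U])
    fix x assume x: "x \<in> U"
    with h obtain W h' where W: "openin (ztop Y) W" "x \<in> W" "W \<inter> N \<subseteq> U"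
      "h' \<in> reg Y W" "\<forall>y \<in> W \<inter> N. h y = h' y"
      by (rule reg_sub_spaceE)
    have "h' \<in> reg Y (W \<inter> N)" using W(1) N by (intro Y.reg_restrict[OF W(4,1)]) auto
    then show "\<exists>W. openin (ztop Y) W \<and> x \<in> W \<and> W \<subseteq> U \<and> (\<exists>h'\<in>reg Y W. \<forall>y\<in>W. h y = h' y)"
      using W N x by (intro exI[of _ "W \<inter> N"] conjI bexI[of _ h']) auto
  qed
qed

text \<open>Gluing of morphisms over an open cover of the source. It lets the map to the cosets be
  checked one chart at a time, each chart with its own section.\<close>

lemma fs_morphism_local:
  assumes "function_sheaf X"
    and loc: "\<And>x. x \<in> points X \<Longrightarrow> \<exists>N f'. openin (ztop X) N \<and> x \<in> N \<and>
       fs_morphism (sub_space X N) Y f' \<and> (\<forall>y \<in> N. f y = f' y)"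
  shows "fs_morphism X Y f"
proof -
  interpret X: function_sheaf X by fact
  \<comment> \<open>The neighbourhood \<open>W\<close> is chosen before \<open>h\<close>, so one
    statement yields both continuity and regularity.\<close>
  have chart: "\<exists>W. openin (ztop X) W \<and> x \<in> W \<and> W \<subseteq> {x \<in> points X. f x \<in> U} \<and>
      (\<forall>h \<in> reg Y U. \<exists>h' \<in> reg X W. \<forall>y \<in> W. (h \<circ> f) y = h' y)"
    if U: "openin (ztop Y) U" and x: "x \<in> points X" "f x \<in> U" for U x
  proof -
    obtain N f' where N: "openin (ztop X) N" "x \<in> N" "fs_morphism (sub_space X N) Y f'"
      "\<forall>y \<in> N. f y = f' y" using loc[OF x(1)] by blast
    let ?W = "{y \<in> points (sub_space X N). f' y \<in> U}"
    have NX: "N \<subseteq> points X" using openin_subset[OF N(1)] by (simp add: points_def)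
    have "openin (ztop (sub_space X N)) ?W" by (rule fs_morphism_openin[OF N(3) U])
    then have W: "openin (ztop X) ?W" using N(1) by (auto simp: openin_sub_space_iff)
    have "h \<circ> f' \<in> reg X ?W" if "h \<in> reg Y U" for h
      using N(3) U that
      by (intro reg_open_sub_space[OF assms(1) N(1) _ W]) (auto simp: fs_morphism_def points_sub_space)
    moreover have "x \<in> ?W" "?W \<subseteq> {x \<in> points X. f x \<in> U}" using N x by (auto simp: points_sub_space)
    moreover have "\<forall>y \<in> ?W. f y = f' y" using N(4) by (simp add: points_sub_space)
    ultimately show ?thesis using W
      by (intro exI[of _ ?W] conjI ballI bexI[where x = "_ \<circ> f'"]) auto
  qed
  show ?thesis
  proof (rule fs_morphismI)
    fix x assume x: "x \<in> points X"
    obtain N f' where N: "openin (ztop X) N" "x \<in> N" "fs_morphism (sub_space X N) Y f'"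
      "\<forall>y \<in> N. f y = f' y" using loc[OF x] by blast
    then have "f' x \<in> points Y" using x by (simp add: fs_morphism_points points_sub_space)
    then show "f x \<in> points Y" using N by simp
  next
    fix U assume U: "openin (ztop Y) U"
    show op: "openin (ztop X) {x \<in> points X. f x \<in> U}"
    proof (subst openin_subopen, intro ballI)
      fix x assume "x \<in> {x \<in> points X. f x \<in> U}"
      then have "x \<in> points X" "f x \<in> U" by simp_all
      from chart[OF U this] show "\<exists>T. openin (ztop X) T \<and> x \<in> T \<and> T \<subseteq> {x \<in> points X. f x \<in> U}"
        by (elim exE conjE) (intro exI conjI)
    qed
    fix h assume h: "h \<in> reg Y U"
    show "h \<circ> f \<in> reg X {x \<in> points X. f x \<in> U}"
    proof (rule X.reg_local[OF op])
      fix x assume "x \<in> {x \<in> points X. f x \<in> U}"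
      then have "x \<in> points X" "f x \<in> U" by simp_all
      from chart[OF U this] obtain W where W: "openin (ztop X) W" "x \<in> W"
        "W \<subseteq> {x \<in> points X. f x \<in> U}"
        and reg: "\<forall>h \<in> reg Y U. \<exists>h' \<in> reg X W. \<forall>y \<in> W. (h \<circ> f) y = h' y"
        by (elim exE conjE)
      from W bspec[OF reg h]
      show "\<exists>W. openin (ztop X) W \<and> x \<in> W \<and> W \<subseteq> {x \<in> points X. f x \<in> U} \<and>
          (\<exists>h'\<in>reg X W. \<forall>y\<in>W. (h \<circ> f) y = h' y)"
        by (intro exI conjI)
    qed
  qed
qed

section \<open>Summands of a module over a set of operators\<close>

text \<open>If \<open>W\<close> is the graph of \<open>h\<close>, the vector \<open>u\<close> is
  \<open>p v + h (p v)\<close>, so the value is \<open>v + h (p v)\<close>. The projection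
  \<open>p\<close> stays fixed while \<open>W\<close> varies, which makes the values functions on
  the Grassmannian; off the chart of \<open>p\<close> the definite description is
  unspecified.\<close>

definition graph_map :: "('v::ab_group_add \<Rightarrow> 'v) \<Rightarrow> 'v set \<Rightarrow> 'v \<Rightarrow> 'v" where
  "graph_map p W v = v - p v + (THE u. u \<in> W \<and> p u = p v)"

context finite_dimensional_vector_space
begin

lemma linear_sub: "Vector_Spaces.linear scale scale f \<Longrightarrow> f (x - y) = f x - f y"
  and linear_plus: "Vector_Spaces.linear scale scale f \<Longrightarrow> f (x + y) = f x + f y"
  and linear_times: "Vector_Spaces.linear scale scale f \<Longrightarrow> f (scale a x) = scale a (f x)"
  and linear_0: "Vector_Spaces.linear scale scale f \<Longrightarrow> f 0 = 0"
  by (simp_all add: module_hom.diff module_hom.add module_hom.scale module_hom.zero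
      flip: module_hom_eq_linear)

lemma linearI:
  assumes "\<And>x y. f (x + y) = f x + f y" "\<And>a x. f (scale a x) = scale a (f x)"
  shows "Vector_Spaces.linear scale scale f"
  using assms by (simp add: Vector_Spaces.linear_iff vector_space_axioms)

lemma dim_image_linear:
  assumes "Vector_Spaces.linear scale scale f" "inj_on f W" "subspace W"
  shows "dim (f ` W) = dim W"
proof -
  interpret finite_dimensional_vector_space_pair scale Basis scale Basis by unfold_locales
  show ?thesis using assms by (intro dim_image_eq) (simp_all add: span_subspace[of W W] span_superset)
qed

lemma subspace_image_linear:
  "Vector_Spaces.linear scale scale f \<Longrightarrow> subspace W \<Longrightarrow> subspace (f ` W)"
  by (rule module_hom.subspace_image) (simp add: module_hom_eq_linear)

lemma dim_image_bij:
  assumes "Vector_Spaces.linear scale scale f" "bij f" "subspace W"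
  shows "dim (f ` W) = dim W"
  using assms by (intro dim_image_linear) (auto simp: bij_def intro: inj_on_subset)

lemma linear_inv:
  assumes "Vector_Spaces.linear scale scale f" "bij f"
  shows "Vector_Spaces.linear scale scale (inv_into UNIV f)"
proof (rule linearI)
  have f: "f (inv_into UNIV f x) = x" for x using assms(2) by (simp add: bij_is_surj surj_f_inv_f)
  have eq: "inv_into UNIV f y = x" if "f x = y" for x y
    using assms(2) that by (auto simp: bij_def inv_f_f)
  show "inv_into UNIV f (x + y) = inv_into UNIV f x + inv_into UNIV f y" for x y
    by (rule eq) (simp add: linear_plus[OF assms(1)] f)
  show "inv_into UNIV f (scale a x) = scale a (inv_into UNIV f x)" for a x
    by (rule eq) (simp add: linear_times[OF assms(1)] f)
qed

text \<open>Eigenvectors for distinct eigenvalues are independent, and independent sets are finite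
  here. Needed to find a scalar in general position.\<close>

lemma finite_eigenvalues:
  assumes "Vector_Spaces.linear scale scale T"
  shows "finite {a. \<exists>v. v \<noteq> 0 \<and> T v = scale a v}" (is "finite ?E")
proof -
  obtain v where v: "\<And>a. a \<in> ?E \<Longrightarrow> v a \<noteq> 0 \<and> T (v a) = scale a (v a)"
    using bchoice[of ?E "\<lambda>a v. v \<noteq> 0 \<and> T v = scale a v"] by blast
  have zero: "\<forall>a\<in>F. c a = 0" if "finite F" "F \<subseteq> ?E" "(\<Sum>a\<in>F. scale (c a) (v a)) = 0" for F c
    using that
  proof (induction F arbitrary: c rule: finite_induct)
    case (insert b F)
    \<comment> \<open>Applying \<open>T - b\<close> to the relation kills the term of
      \<open>b\<close> and multiplies the term of \<open>a\<close> by \<open>a - b\<close>, which is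
      nonzero for \<open>a\<close> in \<open>F\<close>.\<close>
    have "0 = T (\<Sum>a\<in>insert b F. scale (c a) (v a)) - scale b (\<Sum>a\<in>insert b F. scale (c a) (v a))"
      using insert.prems(2) by (simp add: linear_0[OF assms])
    also have "T (\<Sum>a\<in>insert b F. scale (c a) (v a)) = (\<Sum>a\<in>insert b F. scale (c a) (T (v a)))"
      using assms
      by (simp add: module_hom.sum module_hom.scale flip: module_hom_eq_linear del: sum.insert)
    also have "\<dots> = (\<Sum>a\<in>insert b F. scale (c a * a) (v a))"
    proof (rule sum.cong)
      fix a assume "a \<in> insert b F"
      then have "a \<in> ?E" using insert.prems(1) by blast
      then show "scale (c a) (T (v a)) = scale (c a * a) (v a)" using v[of a] by simp
    qed simp
    also have "\<dots> - scale b (\<Sum>a\<in>insert b F. scale (c a) (v a))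
        = (\<Sum>a\<in>insert b F. scale (c a * (a - b)) (v a))"
      by (simp add: scale_sum_right algebra_simps flip: sum_subtractf del: sum.insert)
    also have "\<dots> = (\<Sum>a\<in>F. scale (c a * (a - b)) (v a))" using insert.hyps by simp
    finally have "\<forall>a\<in>F. c a * (a - b) = 0"
      using insert.prems(1) by (intro insert.IH) auto
    then have F: "\<forall>a\<in>F. c a = 0" using insert.hyps by auto
    then have "scale (c b) (v b) = 0" using insert.prems(2) insert.hyps by simp
    then show ?case using F v[of b] insert.prems(1) by simp
  qed simp
  have inj: "inj_on v ?E"
  proof (rule inj_onI, rule ccontr)
    fix a b assume ab: "a \<in> ?E" "b \<in> ?E" "v a = v b" "a \<noteq> b"
    then have "scale a (v a) = scale b (v a)" using v[of a] v[of b] by metis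
    then show False using ab v[of a] by simp
  qed
  have "independent (v ` ?E)"
    unfolding independent_explicit_finite_subsets
  proof (intro allI impI)
    fix A u assume A: "A \<subseteq> v ` ?E" "finite A" "(\<Sum>w\<in>A. scale (u w) w) = 0"
    obtain F where F: "F \<subseteq> ?E" "A = v ` F" using A(1) by (auto simp: subset_image_iff)
    have injF: "inj_on v F" by (rule inj_on_subset[OF inj F(1)])
    have "finite F" using A(2) F(2) finite_imageD[OF _ injF] by simp
    moreover have "(\<Sum>a\<in>F. scale ((u \<circ> v) a) (v a)) = 0"
      using A(3) by (simp add: F(2) sum.reindex[OF injF])
    ultimately have "\<forall>a\<in>F. (u \<circ> v) a = 0" using F(1) by (intro zero)
    then show "\<forall>w\<in>A. u w = 0" by (simp add: F(2))
  qed
  then show ?thesis using finiteI_independent finite_imageD[OF _ inj] by blast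
qed

end

text \<open>A subspace \<open>W\<close> on which the projection \<open>p\<close> to \<open>W0\<close> is bijective is the graph of a map
  \<open>W0 \<rightarrow> ker p\<close>; then \<open>graph_map p W\<close> is the corresponding unipotent automorphism.\<close>

locale graph_chart = finite_dimensional_vector_space scale Basis
  for scale :: "'k::field \<Rightarrow> 'v::ab_group_add \<Rightarrow> 'v" and Basis +
  fixes p :: "'v \<Rightarrow> 'v" and W0 W :: "'v set"
  assumes lin: "Vector_Spaces.linear scale scale p" and rng: "range p = W0" and idem: "\<And>x. x \<in> W0 \<Longrightarrow> p x = x"
    and sub: "subspace W" and inj: "inj_on p W" and dim: "dim W = dim W0"
begin

definition lift where "lift v = (THE u. u \<in> W \<and> p u = p v)"

lemma subspace_W0: "subspace W0"
  using subspace_image_linear[OF lin subspace_UNIV] rng by simp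

text \<open>An injective image of the right dimension fills \<open>W0\<close>, so every vector of
  \<open>W0\<close> has a lift to \<open>W\<close>, unique by injectivity.\<close>

lemma image_p: "p ` W = W0"
proof (rule subspace_dim_equal)
  show "subspace (p ` W)" by (rule subspace_image_linear[OF lin sub])
  show "p ` W \<subseteq> W0" using rng by auto
  show "dim W0 \<le> dim (p ` W)" by (simp add: dim_image_linear[OF lin inj sub] dim)
qed (rule subspace_W0)

lemma lift_eq: "u \<in> W \<Longrightarrow> p u = p v \<Longrightarrow> lift v = u"
  unfolding lift_def using inj by (intro the_equality) (auto simp: inj_on_def)

lemma lift: "lift v \<in> W" "p (lift v) = p v"
proof -
  have "p v \<in> p ` W" using rng image_p by auto
  then obtain u where u: "u \<in> W" "p u = p v" by auto
  with lift_eq[OF u] show "lift v \<in> W" "p (lift v) = p v" by auto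
qed

lemma graph_map_lift: "graph_map p W v = v - p v + lift v"
  by (simp add: graph_map_def lift_def)

lemma linear_lift: "Vector_Spaces.linear scale scale lift"
  by (rule linearI; rule lift_eq)
    (simp_all add: lift subspace_add[OF sub] subspace_scale[OF sub] linear_plus[OF lin]
      linear_times[OF lin])

lemma linear_graph_map: "Vector_Spaces.linear scale scale (graph_map p W)"
  by (rule linearI)
    (simp_all add: graph_map_lift linear_plus[OF lin] linear_times[OF lin] linear_plus[OF linear_lift]
      linear_times[OF linear_lift] algebra_simps)

lemma p_p: "p (p v) = p v"
  using idem rng by blast

text \<open>With \<open>u = graph_map p W = 1 + h p\<close>, the map \<open>u - 1\<close> has square
  zero because \<open>h\<close> takes values in \<open>ker p\<close>. Hence the inverse of
  \<open>u\<close> is \<open>2 - u\<close>, written with \<open>v + v\<close>. As this is affine in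
  \<open>u\<close>, regularity of the coefficients of \<open>u\<close> carries over to its
  inverse.\<close>

lemma graph_map_inverse: "graph_map p W (v + v - graph_map p W v) = v"
  "graph_map p W v + graph_map p W v - graph_map p W (graph_map p W v) = v"
proof -
  have 1: "p (v + v - graph_map p W v) = p v" "p (graph_map p W v) = p v" for v
    by (simp_all add: graph_map_lift linear_plus[OF lin] linear_sub[OF lin] lift p_p)
  then have 2: "lift (v + v - graph_map p W v) = lift v" "lift (graph_map p W v) = lift v" for v
    by (simp_all add: lift lift_eq)
  show "graph_map p W (v + v - graph_map p W v) = v"
    by (simp add: graph_map_lift[of "v + v - graph_map p W v"] 1 2) (simp add: graph_map_lift)
  show "graph_map p W v + graph_map p W v - graph_map p W (graph_map p W v) = v"
    by (simp add: graph_map_lift[of "graph_map p W v"] 1 2) (simp add: graph_map_lift)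
qed

lemma bij_graph_map: "bij (graph_map p W)"
  using graph_map_inverse
  by (intro o_bij[of "\<lambda>v. v + v - graph_map p W v"]) (auto simp: fun_eq_iff)

lemma inv_graph_map: "inv_into UNIV (graph_map p W) v = v + v - graph_map p W v"
  using bij_graph_map graph_map_inverse(1)[of v] by (metis bij_inv_eq_iff)

lemma graph_map_image: "graph_map p W ` W0 = W"
proof
  show "graph_map p W ` W0 \<subseteq> W" using idem by (auto simp: graph_map_lift lift)
  show "W \<subseteq> graph_map p W ` W0"
  proof
    fix w assume w: "w \<in> W"
    have "graph_map p W (p w) = w" using w by (simp add: graph_map_lift p_p lift_eq)
    moreover have "p w \<in> W0" using rng by auto
    ultimately show "w \<in> graph_map p W ` W0" by force
  qed
qed

text \<open>The vector \<open>d (lift v)\<close> lies in \<open>W\<close> above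
  \<open>p (d v)\<close>, and such a vector is unique; so \<open>lift\<close> commutes with
  \<open>d\<close>.\<close>

lemma graph_map_in_centralizer:
  assumes add: "\<And>d x y. d \<in> D \<Longrightarrow> d (x + y) = d x + d y"
    and comm: "\<And>d x. d \<in> D \<Longrightarrow> p (d x) = d (p x)"
    and stable: "\<And>d w. d \<in> D \<Longrightarrow> w \<in> W \<Longrightarrow> d w \<in> W"
  shows "graph_map p W \<in> centralizer scale D"
proof -
  have "graph_map p W (d v) = d (graph_map p W v)" if d: "d \<in> D" for d v
  proof -
    have "lift (d v) = d (lift v)"
      by (rule lift_eq) (simp_all add: stable d lift comm)
    moreover have "d (x - y) = d x - d y" for x y
      using add[OF d, of "x - y" y] by (simp add: eq_diff_eq)
    ultimately show ?thesis by (simp add: graph_map_lift comm d add)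
  qed
  then show ?thesis
    by (simp add: centralizer_def linear_graph_map bij_graph_map fun_eq_iff)
qed

end

text \<open>Separates the linear algebra of summands from the distribution algebra: any set of
  linear operators is allowed here, and the image of the distributions is substituted later.\<close>

locale operator_module = finite_dimensional_vector_space scale Basis
  for scale :: "'k::field \<Rightarrow> 'v::ab_group_add \<Rightarrow> 'v" and Basis +
  fixes D :: "('v \<Rightarrow> 'v) set"
  assumes op_add: "\<And>d x y. d \<in> D \<Longrightarrow> d (x + y) = d x + d y"
    and op_scale: "\<And>d a x. d \<in> D \<Longrightarrow> d (scale a x) = scale a (d x)"
begin

abbreviation "C \<equiv> centralizer scale D"

text \<open>An idempotent commuting with the operators encodes \<open>W\<close> together with a
  chosen complement, its kernel. This is the datum on which a chart depends.\<close>

definition D_projection :: "('v \<Rightarrow> 'v) \<Rightarrow> 'v set \<Rightarrow> bool" where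
  "D_projection p W \<longleftrightarrow> Vector_Spaces.linear scale scale p \<and> (\<forall>d \<in> D. \<forall>x. p (d x) = d (p x)) \<and>
     range p = W \<and> (\<forall>x \<in> W. p x = x)"

lemma op_0: "d \<in> D \<Longrightarrow> d 0 = 0"
  using op_add[of d 0 0] by simp

lemma centralizer_linear: "c \<in> C \<Longrightarrow> Vector_Spaces.linear scale scale c"
  and centralizer_bij: "c \<in> C \<Longrightarrow> bij c"
  and centralizer_comm: "c \<in> C \<Longrightarrow> d \<in> D \<Longrightarrow> c (d x) = d (c x)"
  by (auto simp: centralizer_def fun_eq_iff)

lemma centralizer_id: "id \<in> C"
  by (auto simp: centralizer_def intro: linearI)

lemma centralizer_comp: "c \<in> C \<Longrightarrow> c' \<in> C \<Longrightarrow> c \<circ> c' \<in> C"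
  by (auto simp: centralizer_def bij_comp fun_eq_iff intro!: linearI)
    (simp_all add: linear_plus linear_times)

lemma centralizer_inv:
  assumes "c \<in> C"
  shows "inv_into UNIV c \<in> C"
proof -
  have c: "c (inv_into UNIV c x) = x" "inv_into UNIV c (c x) = x" for x
    using centralizer_bij[OF assms] by (simp_all add: bij_is_inj bij_is_surj surj_f_inv_f)
  have "inv_into UNIV c (d x) = d (inv_into UNIV c x)" if "d \<in> D" for d x
    using centralizer_comm[OF assms that, of "inv_into UNIV c x"] c by metis
  then show ?thesis
    using assms by (simp add: centralizer_def linear_inv bij_imp_bij_inv fun_eq_iff)
qed

lemma D_summand_iff: "D_summand scale D W \<longleftrightarrow> (\<exists>p. D_projection p W)"
proof
  assume "D_summand scale D W"
  then obtain W' where WD: "D_submodule scale D W" and W'D: "D_submodule scale D W'"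
    and int: "W \<inter> W' = {0}" and sum: "{x + y | x y. x \<in> W \<and> y \<in> W'} = UNIV"
    by (auto simp: D_summand_def)
  have W: "subspace W" "\<And>d x. d \<in> D \<Longrightarrow> x \<in> W \<Longrightarrow> d x \<in> W"
    and W': "subspace W'" "\<And>d x. d \<in> D \<Longrightarrow> x \<in> W' \<Longrightarrow> d x \<in> W'"
    using WD W'D unfolding D_submodule_def by blast+
  define p where "p v = (THE x. x \<in> W \<and> v - x \<in> W')" for v
  have eq: "p v = x" if x: "x \<in> W" "v - x \<in> W'" for v x
    unfolding p_def
  proof (rule the_equality)
    fix x' assume x': "x' \<in> W \<and> v - x' \<in> W'"
    have "x - x' \<in> W" using x x' W(1) by (simp add: subspace_diff)
    moreover have "(v - x') - (v - x) \<in> W'" using x x' W'(1) by (blast intro: subspace_diff)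
    ultimately have "x - x' \<in> W \<inter> W'" by simp
    then show "x' = x" using int by simp
  qed (use x in simp)
  have p: "p v \<in> W" "v - p v \<in> W'" for v
  proof -
    have "v \<in> {x + y | x y. x \<in> W \<and> y \<in> W'}" by (simp add: sum)
    then obtain x y where "v = x + y" "x \<in> W" "y \<in> W'" by blast
    then show "p v \<in> W" "v - p v \<in> W'" using eq[of x v] by auto
  qed
  have "Vector_Spaces.linear scale scale p"
  proof (rule linearI; rule eq)
    fix x y a
    show "p x + p y \<in> W" "scale a (p x) \<in> W"
      using p W(1) by (auto intro: subspace_add subspace_scale)
    have "(x - p x) + (y - p y) \<in> W'" using p W'(1) by (blast intro: subspace_add)
    then show "x + y - (p x + p y) \<in> W'" by (simp add: algebra_simps)
    have "scale a (x - p x) \<in> W'" using p W'(1) by (blast intro: subspace_scale)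
    then show "scale a x - scale a (p x) \<in> W'" by (simp add: algebra_simps)
  qed
  moreover have "p (d x) = d (p x)" if d: "d \<in> D" for d x
  proof (rule eq)
    show "d (p x) \<in> W" using W d p by blast
    have "d (x - p x) \<in> W'" using W' d p by blast
    then show "d x - d (p x) \<in> W'" using op_add[OF d, of "x - p x" "p x"] by simp
  qed
  moreover have id: "p x = x" if "x \<in> W" for x
    using that subspace_0[OF W'(1)] by (intro eq) auto
  moreover have "range p = W"
  proof
    show "W \<subseteq> range p" using id by (metis rangeI subsetI)
  qed (use p in auto)
  ultimately show "\<exists>p. D_projection p W" unfolding D_projection_def by blast
next
  assume "\<exists>p. D_projection p W"
  then obtain p where p: "Vector_Spaces.linear scale scale p" "\<And>d x. d \<in> D \<Longrightarrow> p (d x) = d (p x)"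
    "range p = W" "\<And>x. x \<in> W \<Longrightarrow> p x = x"
    unfolding D_projection_def by blast
  have "D_submodule scale D W"
    unfolding D_submodule_def
  proof (intro conjI ballI)
    show "subspace W" using subspace_image_linear[OF p(1) subspace_UNIV] p(3) by simp
    show "d ` W \<subseteq> W" if "d \<in> D" for d
      using p(2)[OF that] p(3,4) by (metis image_subsetI rangeI)
  qed
  moreover have "D_submodule scale D {x. p x = 0}"
    unfolding D_submodule_def
    by (auto simp: subspace_def linear_plus[OF p(1)] linear_times[OF p(1)] linear_0[OF p(1)] p(2) op_0)
  moreover have "W \<inter> {x. p x = 0} = {0}"
  proof -
    have "0 \<in> W" using p(3) linear_0[OF p(1)] by (metis rangeI)
    then show ?thesis using p(4) linear_0[OF p(1)] by fastforce
  qed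
  moreover have "{x + y | x y. x \<in> W \<and> y \<in> {x. p x = 0}} = UNIV"
  proof -
    have "\<exists>x y. v = x + y \<and> x \<in> W \<and> p y = 0" for v
    proof (intro exI conjI)
      show "p v \<in> W" using p(3) by blast
      then show "p (v - p v) = 0" using p(4) by (simp add: linear_sub[OF p(1)])
    qed simp
    then show ?thesis by auto
  qed
  ultimately show "D_summand scale D W" unfolding D_summand_def by blast
qed

lemma D_projection_submodule:
  assumes "D_projection p W"
  shows "subspace W" "d \<in> D \<Longrightarrow> x \<in> W \<Longrightarrow> d x \<in> W"
  using D_summand_iff[of W] assms unfolding D_summand_def D_submodule_def by blast+

text \<open>The hypothesis covers two cases at once: an element of the centralizer fixes every
  operator under conjugation, whereas \<open>\<phi> g\<close> only carries \<open>D\<close> into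
  itself.\<close>

lemma D_projection_conj:
  assumes p: "D_projection p W" and c: "Vector_Spaces.linear scale scale c" "bij c"
    and conj: "\<And>d. d \<in> D \<Longrightarrow> inv_into UNIV c \<circ> d \<circ> c \<in> D"
  shows "D_projection (c \<circ> p \<circ> inv_into UNIV c) (c ` W)"
proof -
  let ?i = "inv_into UNIV c"
  have i: "c (?i x) = x" "?i (c x) = x" for x
    using c(2) by (simp_all add: bij_is_inj bij_is_surj surj_f_inv_f)
  have pl: "Vector_Spaces.linear scale scale p" using p by (simp add: D_projection_def)
  have il: "Vector_Spaces.linear scale scale ?i" by (rule linear_inv[OF c])
  have "Vector_Spaces.linear scale scale (c \<circ> p \<circ> ?i)"
    by (rule linearI)
      (simp_all add: linear_plus[OF c(1)] linear_plus[OF pl] linear_plus[OF il]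
        linear_times[OF c(1)] linear_times[OF pl] linear_times[OF il])
  moreover have "c (p (?i (d x))) = d (c (p (?i x)))" if "d \<in> D" for d x
  proof -
    have "p ((?i \<circ> d \<circ> c) (?i x)) = (?i \<circ> d \<circ> c) (p (?i x))"
      using p conj[OF that] unfolding D_projection_def by blast
    then show ?thesis by (simp add: i)
  qed
  moreover have "range (c \<circ> p \<circ> ?i) = c ` W"
  proof -
    have "range ?i = UNIV" using c(2) by (simp add: bij_imp_bij_inv bij_is_surj)
    then have "range (c \<circ> p \<circ> ?i) = c ` range p" by (simp only: image_comp[symmetric])
    then show ?thesis using p by (simp add: D_projection_def)
  qed
  ultimately show ?thesis
    using p unfolding D_projection_def by (auto simp: i)
qed

lemma centralizer_conj:
  assumes "c \<in> C" "d \<in> D"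
  shows "inv_into UNIV c \<circ> d \<circ> c = d"
proof
  fix x show "(inv_into UNIV c \<circ> d \<circ> c) x = d x"
    using centralizer_comm[OF assms, of x] centralizer_bij[OF assms(1)]
    by (simp add: bij_is_inj flip: centralizer_comm[OF assms])
qed

lemma D_isomorphic_centralizer:
  assumes "c \<in> C"
  shows "D_isomorphic scale D W (c ` W)"
  unfolding D_isomorphic_def
  using assms
  by (intro exI[of _ c])
    (auto simp: centralizer_comm linear_plus[OF centralizer_linear] linear_times[OF centralizer_linear]
      intro!: bij_betw_imageI inj_on_subset[OF bij_is_inj[OF centralizer_bij]])

text \<open>Requiring of \<open>W\<close> only that it be a submodule matters: the interpolating
  submodule in the next proof is not known to be a summand in advance.\<close>

lemma graph_chart_centralizer:
  assumes p: "D_projection p W0" and W: "D_submodule scale D W" "dim W = dim W0" "inj_on p W"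
  shows "graph_chart scale Basis p W0 W" "graph_map p W \<in> C" "graph_map p W ` W0 = W"
proof -
  show *: "graph_chart scale Basis p W0 W"
    by (intro graph_chart.intro graph_chart_axioms.intro finite_dimensional_vector_space_axioms)
      (use assms in \<open>simp_all add: D_projection_def D_submodule_def\<close>)
  interpret graph_chart scale Basis p W0 W by fact
  show "graph_map p W \<in> C"
    using assms by (intro graph_map_in_centralizer) (auto simp: D_projection_def D_submodule_def op_add)
  show "graph_map p W ` W0 = W" by (rule graph_map_image)
qed

text \<open>For an isomorphism \<open>f : M \<rightarrow> W\<close> and generic \<open>a\<close>, the image of \<open>a + f\<close> on \<open>M\<close> is complementary to
  given complements of both \<open>M\<close> and \<open>W\<close>. So it lies in the charts around \<open>M\<close> and \<open>W\<close>; this replaces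
  the Krull-Schmidt theorem.\<close>

lemma isomorphic_summands_conjugate:
  assumes inf: "infinite (UNIV :: 'k set)"
    and p: "D_projection p M" and q: "D_projection q W" and iso: "D_isomorphic scale D M W"
  shows "\<exists>c \<in> C. c ` M = W"
proof -
  obtain f where f: "bij_betw f M W" "\<And>x y. x \<in> M \<Longrightarrow> y \<in> M \<Longrightarrow> f (x + y) = f x + f y"
    "\<And>a x. x \<in> M \<Longrightarrow> f (scale a x) = scale a (f x)" "\<And>d x. d \<in> D \<Longrightarrow> x \<in> M \<Longrightarrow> f (d x) = d (f x)"
    using iso unfolding D_isomorphic_def by blast
  define f' where "f' = inv_into M f"
  have M: "subspace M" and W: "subspace W" using D_projection_submodule p q by blast+
  have pl: "Vector_Spaces.linear scale scale p" and ql: "Vector_Spaces.linear scale scale q"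
    using p q by (simp_all add: D_projection_def)
  have pM: "p x \<in> M" and qW: "q x \<in> W" for x using p q by (auto simp: D_projection_def)
  have pid: "x \<in> M \<Longrightarrow> p x = x" and qid: "x \<in> W \<Longrightarrow> q x = x" for x
    using p q by (auto simp: D_projection_def)
  have fW: "x \<in> M \<Longrightarrow> f x \<in> W" for x using f(1) by (auto simp: bij_betw_def)
  have f'M: "y \<in> W \<Longrightarrow> f' y \<in> M" and ff': "y \<in> W \<Longrightarrow> f (f' y) = y"
    and f'f: "x \<in> M \<Longrightarrow> f' (f x) = x" for x y
    using f(1) by (auto simp: f'_def bij_betw_def inv_into_into f_inv_into_f)
  have f'eq: "f' y = x" if "x \<in> M" "f x = y" for x y using f'f that by blast
  have f'add: "f' (x + y) = f' x + f' y" if "x \<in> W" "y \<in> W" for x y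
    using that M by (intro f'eq) (simp_all add: f f'M ff' subspace_add)
  have f'scale: "f' (scale a x) = scale a (f' x)" if "x \<in> W" for a x
    using that M by (intro f'eq) (simp_all add: f f'M ff' subspace_scale)
  \<comment> \<open>On \<open>M\<close> let \<open>g = a + f\<close>. If \<open>p (g x) = 0\<close>
    then \<open>p (f x) = - a x\<close>, so \<open>- a\<close> is an eigenvalue of the first
    operator. If \<open>q (g x) = 0\<close> then \<open>f x = - a q x\<close>, so
    \<open>- inverse a\<close> is an eigenvalue of the second. Both operators are precomposed with
    \<open>p\<close> because \<open>f\<close> is only controlled on \<open>M\<close>.\<close>
  have T1: "Vector_Spaces.linear scale scale (\<lambda>x. p (f (p x)))"
    by (rule linearI)
      (simp_all add: linear_plus[OF pl] linear_times[OF pl] f pM)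
  have T2: "Vector_Spaces.linear scale scale (\<lambda>x. f' (q (p x)))"
    by (rule linearI)
      (simp_all add: linear_plus[OF pl] linear_times[OF pl] linear_plus[OF ql] linear_times[OF ql]
        f'add f'scale qW)
  let ?E1 = "{a. \<exists>v. v \<noteq> 0 \<and> p (f (p v)) = scale a v}"
  let ?E2 = "{a. \<exists>v. v \<noteq> 0 \<and> f' (q (p v)) = scale a v}"
  have "finite ({0} \<union> uminus ` ?E1 \<union> (\<lambda>a. - inverse a) ` ?E2)"
    using finite_eigenvalues[OF T1] finite_eigenvalues[OF T2] by simp
  from ex_new_if_finite[OF inf this]
  obtain a where a: "a \<notin> {0} \<union> uminus ` ?E1 \<union> (\<lambda>a. - inverse a) ` ?E2" by (rule exE)
  have a0: "a \<noteq> 0" using a by blast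
  have a1: "- a \<notin> ?E1"
  proof
    assume "- a \<in> ?E1"
    then have "- (- a) \<in> uminus ` ?E1" by (rule imageI)
    then show False using a unfolding minus_minus by blast
  qed
  have a2: "- inverse a \<notin> ?E2"
  proof
    assume "- inverse a \<in> ?E2"
    then have "- inverse (- inverse a) \<in> (\<lambda>a. - inverse a) ` ?E2" by (rule imageI)
    then have "a \<in> (\<lambda>a. - inverse a) ` ?E2"
      by (simp only: inverse_minus_eq minus_minus inverse_inverse_eq)
    with a show False by (simp only: Un_iff simp_thms)
  qed
  define g where "g x = scale a (p x) + f (p x)" for x
  have gl: "Vector_Spaces.linear scale scale g"
    by (rule linearI)
      (simp_all add: g_def linear_plus[OF pl] linear_times[OF pl] f pM algebra_simps)
  have gd: "g (d x) = d (g x)" if d: "d \<in> D" for d x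
  proof -
    have "p (d x) = d (p x)" using p d unfolding D_projection_def by blast
    then show ?thesis by (simp add: g_def op_add[OF d] op_scale[OF d] f(4)[OF d pM])
  qed
  have zero1: "x = 0" if "x \<in> M" "p (g x) = 0" for x
  proof (rule ccontr)
    assume "x \<noteq> 0"
    have "scale a x + p (f x) = 0"
      using that(2) by (simp add: g_def pid[OF that(1)] linear_plus[OF pl] linear_times[OF pl])
    then have "p (f (p x)) = scale (- a) x" by (simp add: pid[OF that(1)] add_eq_0_iff)
    then show False using a1 \<open>x \<noteq> 0\<close> by blast
  qed
  have zero2: "x = 0" if "x \<in> M" "q (g x) = 0" for x
  proof (rule ccontr)
    assume "x \<noteq> 0"
    have "scale a (q x) + f x = 0"
      using that(2) by (simp add: g_def pid[OF that(1)] qid[OF fW[OF that(1)]] linear_plus[OF ql] linear_times[OF ql])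
    then have "f x = scale (- a) (q x)" by (simp add: add_eq_0_iff2)
    then have "x = scale (- a) (f' (q x))" using f'f[OF that(1)] f'scale[OF qW] by metis
    then have "scale (- inverse a) x = scale (- inverse a) (scale (- a) (f' (q x)))" by simp
    then have "f' (q (p x)) = scale (- inverse a) x" using a0 by (simp add: pid[OF that(1)])
    then show False using a2 \<open>x \<noteq> 0\<close> by blast
  qed
  define N where "N = g ` M"
  have injg: "inj_on g M"
  proof (rule inj_onI)
    fix x y assume "x \<in> M" "y \<in> M" "g x = g y"
    then have "x - y \<in> M" "p (g (x - y)) = 0"
      by (simp_all add: subspace_diff[OF M] linear_sub[OF gl] linear_0[OF pl])
    then have "x - y = 0" by (rule zero1)
    then show "x = y" by simp
  qed
  have dimN: "dim N = dim M" unfolding N_def by (rule dim_image_linear[OF gl injg M])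
  have "dim (f ` M) = dim M"
  proof -
    have "dim ((f \<circ> p) ` M) = dim M"
      using f(1) M by (intro dim_image_linear linearI)
        (auto simp: linear_plus[OF pl] linear_times[OF pl] f pM pid bij_betw_def inj_on_def)
    then show ?thesis by (simp add: pid cong: image_cong)
  qed
  then have dimW: "dim W = dim M" using f(1) by (simp add: bij_betw_def)
  have N: "D_submodule scale D N"
    unfolding D_submodule_def N_def
  proof (intro conjI ballI image_subsetI)
    fix d y assume d: "d \<in> D" and "y \<in> g ` M"
    then obtain x where "x \<in> M" "y = g x" by blast
    then show "d y \<in> g ` M" using D_projection_submodule(2)[OF p d] gd[OF d] by (metis imageI)
  qed (rule subspace_image_linear[OF gl M])
  have inj: "inj_on h N" if h: "Vector_Spaces.linear scale scale h" "\<And>x. x \<in> M \<Longrightarrow> h (g x) = 0 \<Longrightarrow> x = 0" for h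
  proof (rule inj_onI)
    fix x y assume xy: "x \<in> N" "y \<in> N" "h x = h y"
    then obtain x' y' where x': "x' \<in> M" "x = g x'" and y': "y' \<in> M" "y = g y'"
      by (auto simp: N_def)
    have "x' - y' \<in> M" "h (g (x' - y')) = 0"
      using x' y' xy(3) by (simp_all add: subspace_diff[OF M] linear_sub[OF gl] linear_sub[OF h(1)])
    then have "x' - y' = 0" by (rule h(2))
    then show "x = y" using x' y' by simp
  qed
  have c1: "graph_map p N \<in> C" "graph_map p N ` M = N"
    by (rule graph_chart_centralizer[OF p N dimN inj[OF pl zero1]]; assumption)+
  have c2: "graph_map q N \<in> C" "graph_map q N ` W = N"
    by (rule graph_chart_centralizer[OF q N dimN[folded dimW] inj[OF ql zero2]]; assumption)+
  show ?thesis
  proof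
    \<comment> \<open>Both \<open>M\<close> and \<open>W\<close> have been moved to
      \<open>N\<close>; go from \<open>M\<close> to \<open>N\<close> and return to
      \<open>W\<close>.\<close>
    show "inv_into UNIV (graph_map q N) \<circ> graph_map p N \<in> C"
      using c1 c2 by (intro centralizer_comp centralizer_inv)
    have "inv_into UNIV (graph_map q N) ` N = W"
      using centralizer_bij[OF c2(1)] c2(2) by (metis bij_is_inj image_inv_f_f)
    then show "(inv_into UNIV (graph_map q N) \<circ> graph_map p N) ` M = W"
      using c1(2) by (simp only: image_comp[symmetric])
  qed
qed

end

section \<open>Charts of the Grassmannian\<close>

abbreviation fun_mat :: "nat \<Rightarrow> (nat \<Rightarrow> nat \<Rightarrow> 'k) \<Rightarrow> 'k mat" where
  "fun_mat m a \<equiv> mat m m (\<lambda>(i, j). a i j)"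

lemma adj_mat_sum:
  fixes a :: "nat \<Rightarrow> nat \<Rightarrow> 'k::comm_ring_1"
  assumes "i < m" "k < m"
  shows "(\<Sum>j<m. a i j * adj_mat (fun_mat m a) $$ (j, k)) = (if i = k then det (fun_mat m a) else 0)"
    and "(\<Sum>j<m. adj_mat (fun_mat m a) $$ (i, j) * a j k) = (if i = k then det (fun_mat m a) else 0)"
proof -
  have A: "fun_mat m a \<in> carrier_mat m m" by simp
  note adj = adj_mat[OF A]
  have "(fun_mat m a * adj_mat (fun_mat m a)) $$ (i, k) = (det (fun_mat m a) \<cdot>\<^sub>m 1\<^sub>m m) $$ (i, k)"
    by (simp only: adj)
  moreover have "(fun_mat m a * adj_mat (fun_mat m a)) $$ (i, k)
      = (\<Sum>j<m. a i j * adj_mat (fun_mat m a) $$ (j, k))"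
    using assms adj(1) by (auto simp: scalar_prod_def lessThan_atLeast0 intro!: sum.cong)
  ultimately show "(\<Sum>j<m. a i j * adj_mat (fun_mat m a) $$ (j, k)) = (if i = k then det (fun_mat m a) else 0)"
    using assms by simp
  have "(adj_mat (fun_mat m a) * fun_mat m a) $$ (i, k) = (det (fun_mat m a) \<cdot>\<^sub>m 1\<^sub>m m) $$ (i, k)"
    by (simp only: adj)
  moreover have "(adj_mat (fun_mat m a) * fun_mat m a) $$ (i, k)
      = (\<Sum>j<m. adj_mat (fun_mat m a) $$ (i, j) * a j k)"
    using assms adj(1) by (auto simp: scalar_prod_def lessThan_atLeast0 intro!: sum.cong)
  ultimately show "(\<Sum>j<m. adj_mat (fun_mat m a) $$ (i, j) * a j k) = (if i = k then det (fun_mat m a) else 0)"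
    using assms by simp
qed

section \<open>Determinants and adjugates of matrices of regular functions\<close>

context function_sheaf
begin

lemma reg_det:
  assumes U: "openin (ztop X) U" and a: "\<And>i j. i < m \<Longrightarrow> j < m \<Longrightarrow> (\<lambda>x. a x i j) \<in> reg X U"
  shows "(\<lambda>x. det (fun_mat m (a x))) \<in> reg X U"
proof -
  have "(\<lambda>x. \<Sum>p | p permutes {0..<m}. signof p * (\<Prod>i = 0..<m. a x i (p i))) \<in> reg X U"
  proof (intro reg_sum reg_mult reg_prod reg_const U)
    fix p i assume "p \<in> {p. p permutes {0..<m}}" "i \<in> {0..<m}"
    then have "i < m" "p i < m" using permutes_in_image[of p "{0..<m}" i] by auto
    then show "(\<lambda>x. a x i (p i)) \<in> reg X U" by (rule a)
  qed
  also have "(\<lambda>x. \<Sum>p | p permutes {0..<m}. signof p * (\<Prod>i = 0..<m. a x i (p i)))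
      = (\<lambda>x. det (fun_mat m (a x)))"
  proof
    fix x
    have "(\<Prod>i = 0..<m. fun_mat m (a x) $$ (i, p i)) = (\<Prod>i = 0..<m. a x i (p i))"
      if "p permutes {0..<m}" for p
      using permutes_in_image[OF that] by (intro prod.cong) auto
    then show "(\<Sum>p | p permutes {0..<m}. signof p * (\<Prod>i = 0..<m. a x i (p i)))
        = det (fun_mat m (a x))"
      by (subst det_def'[of _ m]) (auto intro!: sum.cong)
  qed
  finally show ?thesis .
qed

lemma reg_adj_mat:
  assumes U: "openin (ztop X) U" and a: "\<And>i j. i < m \<Longrightarrow> j < m \<Longrightarrow> (\<lambda>x. a x i j) \<in> reg X U"
    and ij: "i < m" "j < m"
  shows "(\<lambda>x. adj_mat (fun_mat m (a x)) $$ (i, j)) \<in> reg X U"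
proof -
  \<comment> \<open>\<open>?s k\<close> is the increasing enumeration of the indices other than
    \<open>k\<close>. With it a minor is again of the form \<open>fun_mat\<close>, so that
    \<open>reg_det\<close> applies; the adjugate transposes, hence row \<open>j\<close> and column
    \<open>i\<close> are deleted.\<close>
  let ?s = "\<lambda>k l :: nat. if l < k then l else Suc l"
  have "(\<lambda>x. (-1) ^ (j + i) * det (fun_mat (m - 1) (\<lambda>i' j'. a x (?s j i') (?s i j')))) \<in> reg X U"
    using ij by (intro reg_mult reg_const reg_det U a) auto
  also have "(\<lambda>x. (-1) ^ (j + i) * det (fun_mat (m - 1) (\<lambda>i' j'. a x (?s j i') (?s i j'))))
      = (\<lambda>x. adj_mat (fun_mat m (a x)) $$ (i, j))"
  proof
    fix x
    have "mat_delete (fun_mat m (a x)) j i = fun_mat (m - 1) (\<lambda>i' j'. a x (?s j i') (?s i j'))"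
      using ij by (intro eq_matI) (auto simp: mat_delete_def)
    then show "(-1) ^ (j + i) * det (fun_mat (m - 1) (\<lambda>i' j'. a x (?s j i') (?s i j')))
        = adj_mat (fun_mat m (a x)) $$ (i, j)"
      using ij by (simp add: adj_mat_def cofactor_def)
  qed
  finally show ?thesis .
qed

end

section \<open>Linear forms, independent tuples and coordinates\<close>

context finite_dimensional_vector_space
begin

lemma functional_add: "functional scale \<xi> \<Longrightarrow> \<xi> (x + y) = \<xi> x + \<xi> y"
  and functional_diff: "functional scale \<xi> \<Longrightarrow> \<xi> (x - y) = \<xi> x - \<xi> y"
  and functional_scale: "functional scale \<xi> \<Longrightarrow> \<xi> (scale a x) = a * \<xi> x"
  and functional_sum: "functional scale \<xi> \<Longrightarrow> \<xi> (sum f I) = (\<Sum>i\<in>I. \<xi> (f i))"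
  by (simp_all add: module_hom.add module_hom.diff module_hom.scale module_hom.sum
      flip: module_hom_eq_linear)

lemma functionalI:
  assumes "\<And>x y. \<xi> (x + y) = \<xi> x + \<xi> y" "\<And>a x. \<xi> (scale a x) = a * \<xi> x"
  shows "functional scale \<xi>"
proof -
  have "vector_space ((*) :: 'a \<Rightarrow> 'a \<Rightarrow> 'a)" by unfold_locales (simp_all add: algebra_simps)
  then show ?thesis using assms by (simp add: Vector_Spaces.linear_iff vector_space_axioms)
qed

lemma functional_comp_linear:
  "functional scale \<xi> \<Longrightarrow> Vector_Spaces.linear scale scale f \<Longrightarrow> functional scale (\<lambda>x. \<xi> (f x))"
  by (rule functionalI) (simp_all add: functional_add functional_scale linear_plus linear_times)

abbreviation indep_tuples :: "nat \<Rightarrow> 'b list set" where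
  "indep_tuples m \<equiv> {vs. length vs = m \<and> distinct vs \<and> independent (set vs)}"

text \<open>Independence concerns the set of entries; as the tuple is distinct, coefficients can be
  moved between positions and entries.\<close>

lemma tuple_sum_eq_0:
  assumes vs: "vs \<in> indep_tuples m" and sum: "(\<Sum>i<m. scale (y i) (vs ! i)) = 0" and i: "i < m"
  shows "y i = 0"
proof -
  have bij: "bij_betw ((!) vs) {..<m} (set vs)" using vs by (auto intro: bij_betw_nth)
  define idx where "idx = inv_into {..<m} ((!) vs)"
  have idx: "idx (vs ! i) = i" if "i < m" for i
    using bij that by (simp add: idx_def bij_betw_def)
  have "(\<Sum>v\<in>set vs. scale (y (idx v)) v) = (\<Sum>i<m. scale (y (idx (vs ! i))) (vs ! i))"
    by (rule sum.reindex_bij_betw[OF bij, symmetric])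
  also have "\<dots> = 0" using sum idx by simp
  finally have "y (idx (vs ! i)) = 0"
    using vs i by (intro independentD[of "set vs" "set vs" "\<lambda>v. y (idx v)"]) auto
  then show ?thesis using idx[OF i] by simp
qed

lemma tuple_span:
  assumes vs: "length vs = m" "distinct vs" and u: "u \<in> span (set vs)"
  shows "\<exists>y. u = (\<Sum>i<m. scale (y i) (vs ! i))"
proof -
  have bij: "bij_betw ((!) vs) {..<m} (set vs)" using vs by (auto intro: bij_betw_nth)
  obtain f where "u = (\<Sum>v\<in>set vs. scale (f v) v)" using u by (auto simp: span_finite)
  also have "\<dots> = (\<Sum>i<m. scale (f (vs ! i)) (vs ! i))"
    by (rule sum.reindex_bij_betw[OF bij, symmetric])
  finally show ?thesis by (intro exI)
qed

lemma tuple_of_subspace: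
  assumes "subspace W" "dim W = m"
  obtains vs where "vs \<in> indep_tuples m" "span (set vs) = W"
proof -
  have "W \<in> points (Grass scale m)"
    using assms points_Grass[OF finite_dimensional_vector_space_axioms] by simp
  then have "W \<in> (\<lambda>vs. span (set vs)) ` indep_tuples m"
    by (auto simp: Grass_def points_quot_space points_sub_space)
  then show ?thesis using that by blast
qed

text \<open>The coordinate forms of a basis of \<open>range p\<close>, pulled back along
  \<open>p\<close>: they are defined on the whole space and vanish on \<open>ker p\<close>.\<close>

lemma projection_coordinates:
  assumes p: "Vector_Spaces.linear scale scale p" "\<And>x. p (p x) = p x" and dim: "dim (range p) = m"
  obtains \<eta> w where "\<And>j. j < m \<Longrightarrow> functional scale (\<eta> j)"
    "\<And>v. p v = (\<Sum>j<m. scale (\<eta> j v) (w j))" "\<And>j v. j < m \<Longrightarrow> \<eta> j (p v) = \<eta> j v"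
proof -
  have "subspace (range p)" by (rule subspace_image_linear[OF p(1) subspace_UNIV])
  then obtain ws where ws: "ws \<in> indep_tuples m" "span (set ws) = range p"
    using dim by (rule tuple_of_subspace)
  define \<eta> where "\<eta> j v = representation (set ws) (p v) (ws ! j)" for j v
  have mem: "p v \<in> span (set ws)" for v using ws(2) by blast
  have ind: "independent (set ws)" using ws(1) by simp
  have bij: "bij_betw ((!) ws) {..<m} (set ws)" using ws(1) by (auto intro: bij_betw_nth)
  show ?thesis
  proof (rule that)
    show "functional scale (\<eta> j)" for j
      by (rule functionalI)
        (simp_all add: \<eta>_def linear_plus[OF p(1)] linear_times[OF p(1)] representation_add[OF ind mem mem]
          representation_scale[OF ind mem])
    show "p v = (\<Sum>j<m. scale (\<eta> j v) (ws ! j))" for v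
    proof -
      have "p v = (\<Sum>b\<in>set ws. scale (representation (set ws) (p v) b) b)"
        by (rule sum_representation_eq[OF ind mem, symmetric]) simp_all
      also have "\<dots> = (\<Sum>j<m. scale (representation (set ws) (p v) (ws ! j)) (ws ! j))"
        by (rule sum.reindex_bij_betw[OF bij, symmetric])
      finally show ?thesis by (simp add: \<eta>_def)
    qed
    show "\<eta> j (p v) = \<eta> j v" for j v by (simp add: \<eta>_def p(2))
  qed
qed

lemma function_sheaf_tuples: "function_sheaf (sub_space (tuple_space scale m) Y)"
  unfolding tuple_space_def Let_def
  by (intro function_sheaf_sub_space function_sheaf_affine_space)

lemma function_sheaf_Grass: "function_sheaf (Grass scale m)"
  unfolding Grass_def by (intro function_sheaf_quot_space function_sheaf_tuples)

lemma reg_tuple_coordinate: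
  assumes "functional scale \<xi>" "i < m" and U: "openin (ztop (sub_space (tuple_space scale m) Y)) U"
  shows "(\<lambda>vs. \<xi> (vs ! i)) \<in> reg (sub_space (tuple_space scale m) Y) U"
proof -
  obtain T where T: "openin (ztop (tuple_space scale m)) T" "U = T \<inter> Y"
    using U by (auto simp: openin_sub_space_iff)
  have "(\<lambda>vs. \<xi> (vs ! i)) \<in> reg (tuple_space scale m) T"
    using T(1) assms(1,2) unfolding tuple_space_def Let_def by (intro reg_gen) blast
  then show ?thesis by (rule reg_sub_space) (rule T)+
qed

lemma points_tuples: "points (sub_space (tuple_space scale m) (indep_tuples m)) = indep_tuples m"
  by (auto simp: points_sub_space tuple_space_def Let_def points_affine_space)

text \<open>When \<open>p\<close> is a projection of rank \<open>m\<close>, this is the big cell of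
  subspaces complementary to \<open>ker p\<close>, that is, of graphs of linear maps from
  \<open>range p\<close> to \<open>ker p\<close>.\<close>

definition chart :: "nat \<Rightarrow> ('b \<Rightarrow> 'b) \<Rightarrow> 'b set set" where
  "chart m p = {W \<in> points (Grass scale m). inj_on p W}"

end

text \<open>The chart around \<open>range p\<close> in coordinates: \<open>p v = \<Sum>j. \<eta> j v * w j\<close>, and the coordinates
  \<open>\<eta> j (vs ! i)\<close> of a tuple form a matrix that is invertible iff the span of the tuple lies in
  the chart. Its inverse, given by Cramer's rule, is regular.\<close>

locale coordinate_chart = finite_dimensional_vector_space scale Basis
  for scale :: "'k::field \<Rightarrow> 'v::ab_group_add \<Rightarrow> 'v" and Basis +
  fixes p :: "'v \<Rightarrow> 'v" and m :: nat and \<eta> :: "nat \<Rightarrow> 'v \<Rightarrow> 'k" and w :: "nat \<Rightarrow> 'v"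
  assumes lin: "Vector_Spaces.linear scale scale p" and idem: "\<And>x. p (p x) = p x"
    and dim: "dim (range p) = m"
    and \<eta>: "\<And>j. j < m \<Longrightarrow> functional scale (\<eta> j)"
    and p_\<eta>: "\<And>v. p v = (\<Sum>j<m. scale (\<eta> j v) (w j))"
    and \<eta>_p: "\<And>j v. j < m \<Longrightarrow> \<eta> j (p v) = \<eta> j v"
begin

abbreviation a :: "'v list \<Rightarrow> nat \<Rightarrow> nat \<Rightarrow> 'k" where
  "a vs i j \<equiv> \<eta> j (vs ! i)"

lemma p_eq_iff: "p u = p v \<longleftrightarrow> (\<forall>j<m. \<eta> j u = \<eta> j v)"
proof
  assume "p u = p v"
  then show "\<forall>j<m. \<eta> j u = \<eta> j v" using \<eta>_p by metis
qed (simp add: p_\<eta>)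

lemma \<eta>_sum: "j < m \<Longrightarrow> \<eta> j (\<Sum>i<m. scale (y i) (vs ! i)) = (\<Sum>i<m. y i * a vs i j)"
  by (simp add: functional_sum[OF \<eta>] functional_scale[OF \<eta>])

text \<open>In the coordinates \<open>\<eta>\<close>, the restriction of \<open>p\<close> to the
  span is multiplication of the row vector \<open>y\<close> of coefficients by the matrix
  \<open>a vs\<close>.\<close>

lemma inj_on_iff_det:
  assumes vs: "vs \<in> indep_tuples m"
  shows "inj_on p (span (set vs)) \<longleftrightarrow> det (fun_mat m (a vs)) \<noteq> 0"
proof
  assume det: "det (fun_mat m (a vs)) \<noteq> 0"
  show "inj_on p (span (set vs))"
  proof (rule inj_onI)
    fix u v assume uv: "u \<in> span (set vs)" "v \<in> span (set vs)" "p u = p v"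
    obtain y where y: "u - v = (\<Sum>i<m. scale (y i) (vs ! i))"
      using vs span_diff[OF uv(1,2)] tuple_span[of vs m "u - v"] by auto
    have 0: "(\<Sum>i<m. y i * a vs i j) = 0" if "j < m" for j
      using that uv(3) unfolding p_eq_iff
      by (simp add: functional_diff[OF \<eta>] flip: \<eta>_sum[OF that] y)
    have "y k = 0" if k: "k < m" for k
    proof -
      \<comment> \<open>Multiplying \<open>y A = 0\<close> by the adjugate on the right leaves
        \<open>det A\<close> times \<open>y\<close>.\<close>
      have "0 = (\<Sum>j<m. (\<Sum>i<m. y i * a vs i j) * adj_mat (fun_mat m (a vs)) $$ (j, k))"
        by (simp add: 0)
      also have "\<dots> = (\<Sum>i<m. \<Sum>j<m. y i * (a vs i j * adj_mat (fun_mat m (a vs)) $$ (j, k)))"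
        by (subst sum.swap) (simp add: sum_distrib_right mult.assoc)
      also have "\<dots> = (\<Sum>i<m. y i * (if i = k then det (fun_mat m (a vs)) else 0))"
        unfolding sum_distrib_left[symmetric]
        by (rule sum.cong) (simp_all add: adj_mat_sum(1)[OF _ k, of _ "a vs"])
      also have "\<dots> = y k * det (fun_mat m (a vs))"
        using k by (simp add: if_distrib[of "\<lambda>x. _ * x"] cong: if_cong)
      finally show ?thesis using det by simp
    qed
    then show "u = v" using y by simp
  qed
next
  assume inj: "inj_on p (span (set vs))"
  show "det (fun_mat m (a vs)) \<noteq> 0"
  proof
    assume "det (fun_mat m (a vs)) = 0"
    \<comment> \<open>The coefficients \<open>y\<close> act from the left, whereas the criterion for
      a zero determinant yields a column vector; hence the transpose.\<close>
    then have "det (transpose_mat (fun_mat m (a vs))) = 0" by (subst det_transpose[of _ m]) simp_all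
    then obtain y where y: "y \<in> carrier_vec m" "y \<noteq> 0\<^sub>v m"
      "transpose_mat (fun_mat m (a vs)) *\<^sub>v y = 0\<^sub>v m"
      using det_0_iff_vec_prod_zero_field[of "transpose_mat (fun_mat m (a vs))" m] by auto
    let ?u = "\<Sum>i<m. scale (y $ i) (vs ! i)"
    have "\<eta> j ?u = 0" if "j < m" for j
    proof -
      have "(transpose_mat (fun_mat m (a vs)) *\<^sub>v y) $ j = 0" using y(3) that by simp
      moreover have "(transpose_mat (fun_mat m (a vs)) *\<^sub>v y) $ j = (\<Sum>i<m. a vs i j * y $ i)"
        using that y(1) by (auto simp: scalar_prod_def lessThan_atLeast0 intro!: sum.cong)
      ultimately show ?thesis by (simp add: \<eta>_sum[OF that] mult.commute)
    qed
    moreover have "\<eta> j 0 = 0" if "j < m" for j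
      using functional_scale[OF \<eta>[OF that], of 0 0] by simp
    ultimately have "p ?u = p 0" by (simp add: p_eq_iff)
    moreover have "?u \<in> span (set vs)"
      using vs by (intro span_sum span_scale span_base) auto
    ultimately have "?u = 0" using inj span_zero by (auto dest: inj_onD)
    then have "y $ i = 0" if "i < m" for i using tuple_sum_eq_0[OF vs _ that] by blast
    then show False using y(1,2) by (auto intro: eq_vecI)
  qed
qed

text \<open>The lift of \<open>v\<close> to the span has as coefficients the row
  \<open>\<eta> v\<close> times the inverse matrix, the adjugate over the determinant. Since lifts
  are unique, it is enough that this candidate has the same coordinates \<open>\<eta>\<close> as
  \<open>v\<close>.\<close>

lemma graph_map_coordinates:
  assumes vs: "vs \<in> indep_tuples m" and det: "det (fun_mat m (a vs)) \<noteq> 0"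
  shows "graph_map p (span (set vs)) v = v - p v +
    (\<Sum>i<m. scale (\<Sum>j<m. \<eta> j v * adj_mat (fun_mat m (a vs)) $$ (j, i) * inverse (det (fun_mat m (a vs))))
       (vs ! i))" (is "_ = v - p v + ?u")
proof -
  interpret graph_chart scale Basis p "range p" "span (set vs)"
  proof (intro graph_chart.intro graph_chart_axioms.intro finite_dimensional_vector_space_axioms)
    show "inj_on p (span (set vs))" using inj_on_iff_det[OF vs] det by simp
    show "local.dim (span (set vs)) = local.dim (range p)"
      using vs dim by (simp add: dim_eq_card_independent distinct_card)
  qed (auto simp: lin idem)
  let ?d = "det (fun_mat m (a vs))"
  have "\<eta> l ?u = \<eta> l v" if l: "l < m" for l
  proof -
    have "\<eta> l ?u = (\<Sum>i<m. \<Sum>j<m. \<eta> j v * inverse ?d * (adj_mat (fun_mat m (a vs)) $$ (j, i) * a vs i l))"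
      unfolding \<eta>_sum[OF l] by (simp add: sum_distrib_left sum_distrib_right ac_simps)
    also have "\<dots> = (\<Sum>j<m. \<eta> j v * inverse ?d * (if j = l then ?d else 0))"
      by (subst sum.swap)
        (auto intro!: sum.cong simp: adj_mat_sum(2)[OF _ l, of _ "a vs"] simp flip: sum_distrib_left)
    also have "\<dots> = \<eta> l v"
      using l det by (simp add: if_distrib[of "\<lambda>x. _ * x"] cong: if_cong)
    finally show ?thesis .
  qed
  then have "lift v = ?u"
    using vs by (intro lift_eq span_sum span_scale span_base) (auto simp: p_eq_iff)
  then show ?thesis by (simp add: graph_map_lift)
qed

abbreviation "T \<equiv> sub_space (tuple_space scale m) (indep_tuples m)"

lemma chart_preimage:
  "{vs \<in> points T. span (set vs) \<in> chart m p} = {vs \<in> points T. det (fun_mat m (a vs)) \<noteq> 0}"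
  unfolding chart_def points_tuples
  by (auto simp: inj_on_iff_det Grass_def points_quot_space points_tuples)

text \<open>Openness in the quotient is tested on tuples, where the chart becomes the nonvanishing
  locus of a determinant in the coordinates.\<close>

lemma openin_chart: "openin (ztop (Grass scale m)) (chart m p)"
proof -
  interpret T: function_sheaf T by (rule function_sheaf_tuples)
  have "openin (ztop T) {vs \<in> points T. span (set vs) \<in> chart m p}"
    unfolding chart_preimage
    by (intro T.reg_nonzero T.reg_det T.openin_points reg_tuple_coordinate \<eta>)
  moreover have "chart m p \<subseteq> points (Grass scale m)" by (auto simp: chart_def)
  ultimately show ?thesis by (simp add: Grass_def openin_quot_space points_quot_space)
qed

text \<open>The explicit formula involves a tuple, but \<open>graph_map\<close> depends only on its
  span; so regularity of the formula on tuples is regularity on the Grassmannian.\<close>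

lemma reg_graph_map:
  assumes \<xi>: "functional scale \<xi>"
  shows "(\<lambda>W. \<xi> (graph_map p W v)) \<in> reg (Grass scale m) (chart m p)"
  unfolding Grass_def reg_quot_space_iff
proof -
  interpret T: function_sheaf T by (rule function_sheaf_tuples)
  let ?U = "{vs \<in> points T. span (set vs) \<in> chart m p}"
  have U: "openin (ztop T) ?U"
    using openin_chart by (simp add: Grass_def openin_quot_space)
  let ?d = "\<lambda>vs. det (fun_mat m (a vs))"
  have a: "(\<lambda>vs. a vs i j) \<in> reg T ?U" if "i < m" "j < m" for i j
    by (rule reg_tuple_coordinate[OF \<eta>[OF that(2)] that(1) U])
  have d: "?d vs \<noteq> 0" "vs \<in> indep_tuples m" if "vs \<in> ?U" for vs
    using that unfolding chart_preimage by (simp_all add: points_tuples)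
  have "(\<lambda>vs. \<xi> (v - p v) + (\<Sum>i<m. (\<Sum>j<m. \<eta> j v * adj_mat (fun_mat m (a vs)) $$ (j, i) * inverse (?d vs))
      * \<xi> (vs ! i))) \<in> reg T ?U"
    by (intro T.reg_add T.reg_const T.reg_sum T.reg_mult T.reg_inverse T.reg_det T.reg_adj_mat
        reg_tuple_coordinate[OF \<xi>] U a d) simp_all
  then show "(\<lambda>W. \<xi> (graph_map p W v)) \<circ> (\<lambda>vs. span (set vs)) \<in> reg T ?U"
  proof (rule T.reg_cong[OF U])
    fix vs assume "vs \<in> ?U"
    from graph_map_coordinates[OF d(2)[OF this] d(1)[OF this], of v]
    show "((\<lambda>W. \<xi> (graph_map p W v)) \<circ> (\<lambda>vs. span (set vs))) vs = \<xi> (v - p v) +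
        (\<Sum>i<m. (\<Sum>j<m. \<eta> j v * adj_mat (fun_mat m (a vs)) $$ (j, i) * inverse (?d vs)) * \<xi> (vs ! i))"
      by (simp add: functional_add[OF \<xi>] functional_sum[OF \<xi>] functional_scale[OF \<xi>])
  qed
qed

end

context finite_dimensional_vector_space
begin

lemma coordinate_chart_exists:
  assumes p: "Vector_Spaces.linear scale scale p" "\<And>x. p (p x) = p x" "dim (range p) = m"
  obtains \<eta> w where "coordinate_chart scale Basis p m \<eta> w"
proof -
  obtain \<eta> w where "\<And>j. j < m \<Longrightarrow> functional scale (\<eta> j)"
    "\<And>v. p v = (\<Sum>j<m. scale (\<eta> j v) (w j))" "\<And>j v. j < m \<Longrightarrow> \<eta> j (p v) = \<eta> j v"
    using projection_coordinates[OF p] by metis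
  then have "coordinate_chart scale Basis p m \<eta> w"
    by (intro coordinate_chart.intro coordinate_chart_axioms.intro finite_dimensional_vector_space_axioms p)
  then show ?thesis by (rule that)
qed

end

section \<open>Conjugation and distributions\<close>

lemma coord_ring_sum:
  assumes "\<And>i. i \<in> I \<Longrightarrow> f i \<in> coord_ring X E"
  shows "(\<lambda>x. \<Sum>i\<in>I. f i x) \<in> coord_ring X E"
proof -
  have zero: "(\<lambda>_. 0) \<in> coord_ring X E"
    using coord_ring_const[of X 0 E] by (simp add: on_set_def)
  show ?thesis
    using assms by (induction I rule: infinite_finite_induct) (simp_all add: zero coord_ring_add)
qed

lemma coord_ring_cmult:
  assumes "f \<in> coord_ring X E"
  shows "(\<lambda>x. c * f x) \<in> coord_ring X E"
proof -
  have "(\<lambda>x. c * f x) = (\<lambda>x. on_set X (\<lambda>_. c) x * f x)"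
    using coord_ring_outside[OF assms] by (auto simp: on_set_def)
  then show ?thesis using coord_ring_mult[OF coord_ring_const assms] by simp
qed

lemma group_GL: "group (GL n :: 'k::field mat monoid)"
  unfolding GL_def by (rule monoid.units_group) (rule ring.is_monoid[OF ring_mat])

lemma carrier_GL: "g \<in> carrier (GL n) \<Longrightarrow> g \<in> carrier_mat n n"
  by (auto simp: GL_def units_of_def Units_def ring_mat_simps)

lemma mult_GL: "g \<otimes>\<^bsub>GL n\<^esub> h = g * h"
  by (simp add: GL_def units_of_def ring_mat_simps)

text \<open>Translation by fixed matrices turns entries into linear combinations of entries and
  \<open>1/det\<close> into a multiple of itself. The statement is about a polynomial
  \<open>f\<close> rather than its restriction to \<open>G\<close>, so that induction over the
  generated algebra applies.\<close>

lemma conj_fun_alg: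
  fixes g :: "'k::field mat"
  assumes G: "G \<subseteq> carrier (GL n)" and g: "g \<in> carrier_mat n n" "h \<in> carrier_mat n n"
    and f: "f \<in> fun_alg (GL_gens n)"
  shows "on_set G (\<lambda>x. f (g * x * h)) \<in> grp_coord n G"
  using f unfolding grp_coord_def
proof induction
  case (const a)
  then show ?case by (rule coord_ring_const)
next
  case (gen e)
  have x: "x \<in> carrier_mat n n" if "x \<in> G" for x using that G carrier_GL by blast
  from gen consider i j where "i < n" "j < n" "e = (\<lambda>g. g $$ (i, j))" | "e = (\<lambda>g. inverse (det g))"
    unfolding GL_gens_def by blast
  then show ?case
  proof cases
    case 1
    have "on_set G (\<lambda>x. e (g * x * h))
        = (\<lambda>x. \<Sum>b<n. \<Sum>a<n. (g $$ (i, a) * h $$ (b, j)) * on_set G (\<lambda>x. x $$ (a, b)) x)"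
    proof
      fix x
      show "on_set G (\<lambda>x. e (g * x * h)) x
          = (\<Sum>b<n. \<Sum>a<n. (g $$ (i, a) * h $$ (b, j)) * on_set G (\<lambda>x. x $$ (a, b)) x)"
      proof (cases "x \<in> G")
        case True
        have "(g * x * h) $$ (i, j) = (\<Sum>b<n. (g * x) $$ (i, b) * h $$ (b, j))"
          using 1 g x[OF True]
          by (auto simp: scalar_prod_def lessThan_atLeast0 simp del: assoc_mult_mat intro!: sum.cong)
        also have "\<dots> = (\<Sum>b<n. (\<Sum>a<n. g $$ (i, a) * x $$ (a, b)) * h $$ (b, j))"
          using 1 g x[OF True]
          by (auto simp: scalar_prod_def lessThan_atLeast0 simp del: assoc_mult_mat intro!: sum.cong)
        also have "\<dots> = (\<Sum>b<n. \<Sum>a<n. (g $$ (i, a) * h $$ (b, j)) * x $$ (a, b))"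
          by (simp add: sum_distrib_left sum_distrib_right ac_simps)
        finally show ?thesis using True by (simp add: on_set_in 1)
      qed (simp add: on_set_def)
    qed
    moreover have "on_set G (\<lambda>x. x $$ (a, b)) \<in> coord_ring G (GL_gens n)" if "a < n" "b < n" for a b
      using that by (intro coord_ring_gen) (auto simp: GL_gens_def)
    ultimately show ?thesis by (auto intro!: coord_ring_sum coord_ring_cmult)
  next
    case 2
    \<comment> \<open>This also holds for singular \<open>g\<close> or \<open>h\<close>, both sides
      being zero by the convention \<open>inverse 0 = 0\<close>.\<close>
    have "on_set G (\<lambda>x. e (g * x * h))
        = (\<lambda>x. (inverse (det g) * inverse (det h)) * on_set G (\<lambda>x. inverse (det x)) x)"
    proof
      fix x
      show "on_set G (\<lambda>x. e (g * x * h)) x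
          = (inverse (det g) * inverse (det h)) * on_set G (\<lambda>x. inverse (det x)) x"
      proof (cases "x \<in> G")
        case True
        have "det (g * x * h) = det g * det x * det h"
          using g x[OF True] by (simp add: det_mult[of _ n])
        then show ?thesis using True by (simp add: on_set_in 2 inverse_mult_distrib ac_simps)
      qed (simp add: on_set_def)
    qed
    moreover have "on_set G (\<lambda>x. inverse (det x)) \<in> coord_ring G (GL_gens n)"
      by (intro coord_ring_gen) (auto simp: GL_gens_def)
    ultimately show ?thesis by (auto intro!: coord_ring_cmult)
  qed
next
  case (add f1 f2)
  have "on_set G (\<lambda>x. f1 (g * x * h) + f2 (g * x * h))
      = (\<lambda>x. on_set G (\<lambda>x. f1 (g * x * h)) x + on_set G (\<lambda>x. f2 (g * x * h)) x)"
    by (auto simp: on_set_def)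
  then show ?case using coord_ring_add[OF add.IH] by simp
next
  case (mult f1 f2)
  have "on_set G (\<lambda>x. f1 (g * x * h) * f2 (g * x * h))
      = (\<lambda>x. on_set G (\<lambda>x. f1 (g * x * h)) x * on_set G (\<lambda>x. f2 (g * x * h)) x)"
    by (auto simp: on_set_def)
  then show ?case using coord_ring_mult[OF mult.IH] by simp
qed

locale frobenius_module = finite_dimensional_vector_space scale B
  for scale :: "'k::field \<Rightarrow> 'v::ab_group_add \<Rightarrow> 'v" and B +
  fixes n r :: nat and G :: "'k mat set" and \<phi> :: "'k mat \<Rightarrow> 'v \<Rightarrow> 'v"
  assumes subgroup_G: "subgroup G (GL n)" and rational: "rational_module n G scale \<phi>"
    and char_pos: "CHAR('k) > 0"
begin

abbreviation gmult (infixl "\<cdot>" 70) where "g \<cdot> h \<equiv> g \<otimes>\<^bsub>GL n\<^esub> h"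
abbreviation ginv where "ginv g \<equiv> inv\<^bsub>GL n\<^esub> g"

text \<open>The comorphism of the inner automorphism of \<open>G\<close> given by
  \<open>g\<close>.\<close>

definition conj_fun :: "'k mat \<Rightarrow> ('k mat \<Rightarrow> 'k) \<Rightarrow> 'k mat \<Rightarrow> 'k" where
  "conj_fun g u = on_set G (\<lambda>x. u (g \<cdot> x \<cdot> ginv g))"

definition coeff :: "'v \<Rightarrow> 'v \<Rightarrow> 'k mat \<Rightarrow> 'k" where
  "coeff v b = on_set G (\<lambda>g. representation B (\<phi> g v) b)"

lemma G_closed: "g \<in> G \<Longrightarrow> h \<in> G \<Longrightarrow> g \<cdot> h \<in> G" "g \<in> G \<Longrightarrow> ginv g \<in> G" "\<one>\<^bsub>GL n\<^esub> \<in> G"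
  and G_GL: "g \<in> G \<Longrightarrow> g \<in> carrier (GL n)"
  using subgroup_G by (auto simp: subgroup.m_closed subgroup.m_inv_closed subgroup.one_closed
      dest: subgroup.mem_carrier)

lemma G_group: "g \<in> G \<Longrightarrow> h \<in> G \<Longrightarrow> l \<in> G \<Longrightarrow> g \<cdot> h \<cdot> l = g \<cdot> (h \<cdot> l)"
  "g \<in> G \<Longrightarrow> ginv g \<cdot> g = \<one>\<^bsub>GL n\<^esub>" "g \<in> G \<Longrightarrow> g \<cdot> ginv g = \<one>\<^bsub>GL n\<^esub>"
  "g \<in> G \<Longrightarrow> \<one>\<^bsub>GL n\<^esub> \<cdot> g = g" "g \<in> G \<Longrightarrow> g \<cdot> \<one>\<^bsub>GL n\<^esub> = g"
  by (simp_all add: G_GL group.l_inv[OF group_GL] group.r_inv[OF group_GL]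
      monoid.m_assoc[OF group.is_monoid[OF group_GL]] monoid.l_one[OF group.is_monoid[OF group_GL]]
      monoid.r_one[OF group.is_monoid[OF group_GL]])

lemma \<phi>_linear: "g \<in> G \<Longrightarrow> Vector_Spaces.linear scale scale (\<phi> g)"
  and \<phi>_one: "\<phi> \<one>\<^bsub>GL n\<^esub> = id"
  and \<phi>_mult: "g \<in> G \<Longrightarrow> h \<in> G \<Longrightarrow> \<phi> (g \<cdot> h) = \<phi> g \<circ> \<phi> h"
  and \<phi>_coeff: "functional scale \<xi> \<Longrightarrow> on_set G (\<lambda>g. \<xi> (\<phi> g v)) \<in> grp_coord n G"
  using rational unfolding rational_module_def by blast+

lemma \<phi>_inverse: "g \<in> G \<Longrightarrow> \<phi> g (\<phi> (ginv g) x) = x" "g \<in> G \<Longrightarrow> \<phi> (ginv g) (\<phi> g x) = x"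
  using \<phi>_mult[of g "ginv g"] \<phi>_mult[of "ginv g" g] G_closed(2)[of g]
  by (auto simp: G_group \<phi>_one fun_eq_iff)

lemma \<phi>_bij: "g \<in> G \<Longrightarrow> bij (\<phi> g)"
  by (rule o_bij[of "\<phi> (ginv g)"]) (auto simp: fun_eq_iff \<phi>_inverse)

lemma \<phi>_inv: "g \<in> G \<Longrightarrow> inv_into UNIV (\<phi> g) = \<phi> (ginv g)"
  by (rule inv_equality) (simp_all add: \<phi>_inverse)

lemma coeff_in: "coeff v b \<in> grp_coord n G"
  unfolding coeff_def by (rule \<phi>_coeff) (rule linear_representation[OF independent_Basis span_Basis])

lemma sum_representation: "(\<Sum>b\<in>B. scale (representation B v b) b) = v"
  by (rule sum_representation_eq[OF independent_Basis _ finite_Basis]) (simp_all add: span_Basis)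

lemma conj_fun_in:
  assumes "g \<in> G" "u \<in> grp_coord n G"
  shows "conj_fun g u \<in> grp_coord n G"
proof -
  obtain f where f: "f \<in> fun_alg (GL_gens n)" "u = on_set G f"
    using assms(2) by (auto simp: grp_coord_def coord_ring_def)
  have "conj_fun g u = on_set G (\<lambda>x. f (g * x * ginv g))"
  proof
    fix x
    have "g * x * ginv g \<in> G" if "x \<in> G"
      using G_closed(1)[OF G_closed(1)[OF assms(1) that] G_closed(2)[OF assms(1)]]
      by (simp only: mult_GL)
    then show "conj_fun g u x = on_set G (\<lambda>x. f (g * x * ginv g)) x"
      by (simp add: conj_fun_def on_set_def f mult_GL)
  qed
  also have "\<dots> \<in> grp_coord n G"
    using assms(1) by (intro conj_fun_alg f carrier_GL G_GL G_closed subsetI)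
  finally show ?thesis .
qed

text \<open>Normality of the Frobenius kernel: conjugation fixes the identity, hence preserves the
  augmentation ideal and the set of powers of its elements that generate this ideal.\<close>

lemma conj_fun_frob_ideal:
  assumes g: "g \<in> G" and u: "u \<in> frob_ideal n G r"
  shows "conj_fun g u \<in> frob_ideal n G r"
  using u unfolding frob_ideal_def
proof induction
  case zero
  have "conj_fun g (\<lambda>_. 0) = (\<lambda>_. 0)" by (simp add: conj_fun_def on_set_def)
  then show ?case by (simp add: ideal_gen.zero)
next
  case (step f a e)
  obtain w where w: "w \<in> aug_ideal n G" "e = (\<lambda>g. w g ^ (CHAR('k) ^ r))" using step.hyps by blast
  have "conj_fun g w \<one>\<^bsub>GL n\<^esub> = 0"
    using w(1) g by (simp add: conj_fun_def on_set_def aug_ideal_def G_group)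
  then have "conj_fun g w \<in> aug_ideal n G"
    using w(1) conj_fun_in[OF g] by (simp add: aug_ideal_def)
  \<comment> \<open>Off \<open>G\<close> the right side is a power of zero; it vanishes because the
    exponent is positive, the characteristic being so.\<close>
  moreover have "conj_fun g e = (\<lambda>x. conj_fun g w x ^ (CHAR('k) ^ r))"
    using char_pos by (auto simp: conj_fun_def on_set_def w(2) power_0_left)
  ultimately have "(\<lambda>x. conj_fun g f x + conj_fun g a x * conj_fun g e x)
      \<in> ideal_gen (grp_coord n G) {\<lambda>g. u g ^ (CHAR('k) ^ r) | u. u \<in> aug_ideal n G}"
    using step conj_fun_in[OF g] by (intro ideal_gen.step) auto
  also have "(\<lambda>x. conj_fun g f x + conj_fun g a x * conj_fun g e x) = conj_fun g (\<lambda>x. f x + a x * e x)"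
    by (auto simp: conj_fun_def on_set_def)
  finally show ?case .
qed

text \<open>The adjoint action of \<open>g\<close> on distributions, dual to conjugation of
  functions.\<close>

lemma conj_fun_dist:
  assumes g: "g \<in> G" and \<mu>: "\<mu> \<in> dist_frob n G r"
  shows "(\<lambda>u. \<mu> (conj_fun g u)) \<in> dist_frob n G r"
proof -
  have "conj_fun g (\<lambda>x. u x + w x) = (\<lambda>x. conj_fun g u x + conj_fun g w x)"
    "conj_fun g (\<lambda>x. a * u x) = (\<lambda>x. a * conj_fun g u x)" for u w a
    by (auto simp: conj_fun_def on_set_def)
  then show ?thesis
    using \<mu> conj_fun_in[OF g] conj_fun_frob_ideal[OF g] by (simp add: dist_frob_def)
qed

lemma dist_sum:
  assumes \<mu>: "\<mu> \<in> dist_frob n G r" and f: "\<And>i. i \<in> I \<Longrightarrow> f i \<in> grp_coord n G"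
  shows "\<mu> (\<lambda>x. \<Sum>i\<in>I. c i * f i x) = (\<Sum>i\<in>I. c i * \<mu> (f i))"
proof -
  have add: "\<mu> (\<lambda>g. u g + w g) = \<mu> u + \<mu> w" if "u \<in> grp_coord n G" "w \<in> grp_coord n G" for u w
    using \<mu> that by (simp add: dist_frob_def)
  have scale: "\<mu> (\<lambda>g. a * u g) = a * \<mu> u" if "u \<in> grp_coord n G" for u a
    using \<mu> that by (simp add: dist_frob_def)
  have zero: "\<mu> (\<lambda>_. 0) = 0"
    using \<mu> ideal_gen.zero[of "grp_coord n G"] unfolding dist_frob_def frob_ideal_def by blast
  show ?thesis
    using f
  proof (induction I rule: infinite_finite_induct)
    case (insert i I)
    have "(\<lambda>x. c i * f i x) \<in> grp_coord n G" "(\<lambda>x. \<Sum>i\<in>I. c i * f i x) \<in> grp_coord n G"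
      using insert.prems unfolding grp_coord_def by (auto intro!: coord_ring_sum coord_ring_cmult)
    from add[OF this] show ?case using insert by (simp add: scale)
  qed (simp_all add: zero)
qed

lemma coeff_linear:
  "coeff (x + y) b = (\<lambda>g. coeff x b g + coeff y b g)"
  "coeff (scale a x) b = (\<lambda>g. a * coeff x b g)"
  by (auto simp: coeff_def on_set_def fun_eq_iff linear_plus[OF \<phi>_linear] linear_times[OF \<phi>_linear]
      representation_add[OF independent_Basis] representation_scale[OF independent_Basis] span_Basis)

lemma dist_act_coeff: "dist_act G scale B \<phi> \<mu> v = (\<Sum>b\<in>B. scale (\<mu> (coeff v b)) b)"
  by (simp add: dist_act_def coeff_def)

text \<open>Expands \<open>\<phi> g (\<phi> x (\<phi> (ginv g) v))\<close> in the basis so that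
  \<open>x\<close> occurs only inside coefficient functions; a distribution can then be applied term
  by term.\<close>

lemma coeff_conj:
  assumes g: "g \<in> G"
  shows "conj_fun g (coeff v b') = (\<lambda>x. \<Sum>b\<in>B. representation B (\<phi> g b) b' * coeff (\<phi> (ginv g) v) b x)"
proof
  fix x
  have lin: "Vector_Spaces.linear scale (*) (\<lambda>v. representation B v b')"
    by (rule linear_representation[OF independent_Basis span_Basis])
  show "conj_fun g (coeff v b') x
      = (\<Sum>b\<in>B. representation B (\<phi> g b) b' * coeff (\<phi> (ginv g) v) b x)"
  proof (cases "x \<in> G")
    case True
    let ?w = "\<phi> x (\<phi> (ginv g) v)"
    have "conj_fun g (coeff v b') x = representation B (\<phi> g ?w) b'"
      using True g by (simp add: conj_fun_def coeff_def on_set_in G_closed \<phi>_mult)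
    also have "\<phi> g ?w = \<phi> g (\<Sum>b\<in>B. scale (representation B ?w b) b)"
      by (simp only: sum_representation)
    also have "\<dots> = (\<Sum>b\<in>B. scale (representation B ?w b) (\<phi> g b))"
      using \<phi>_linear[OF g] by (simp add: module_hom.sum module_hom.scale flip: module_hom_eq_linear)
    also have "representation B \<dots> b' = (\<Sum>b\<in>B. representation B ?w b * representation B (\<phi> g b) b')"
      by (simp add: functional_sum[OF lin] functional_scale[OF lin])
    finally show ?thesis using True by (simp add: coeff_def on_set_in mult.commute)
  qed (simp add: conj_fun_def coeff_def on_set_def)
qed

lemma dist_act_conj:
  assumes g: "g \<in> G" and \<mu>: "\<mu> \<in> dist_frob n G r"
  shows "dist_act G scale B \<phi> (\<lambda>u. \<mu> (conj_fun g u)) v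
    = \<phi> g (dist_act G scale B \<phi> \<mu> (\<phi> (ginv g) v))"
proof -
  let ?c = "\<lambda>b. \<mu> (coeff (\<phi> (ginv g) v) b)"
  have "dist_act G scale B \<phi> (\<lambda>u. \<mu> (conj_fun g u)) v
      = (\<Sum>b'\<in>B. \<Sum>b\<in>B. scale (?c b) (scale (representation B (\<phi> g b) b') b'))"
    unfolding dist_act_coeff coeff_conj[OF g] dist_sum[OF \<mu> coeff_in]
    by (simp add: scale_sum_left mult.commute)
  also have "\<dots> = (\<Sum>b\<in>B. scale (?c b) (\<phi> g b))"
    by (subst sum.swap) (simp only: sum_representation scale_sum_right[symmetric])
  also have "\<dots> = \<phi> g (dist_act G scale B \<phi> \<mu> (\<phi> (ginv g) v))"
    using \<phi>_linear[OF g]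
    by (simp add: dist_act_coeff module_hom.sum module_hom.scale flip: module_hom_eq_linear)
  finally show ?thesis .
qed

abbreviation "D \<equiv> dist_image n G r scale B \<phi>"

text \<open>Coefficient functions depend linearly on the vector and distributions are linear on
  them, so the results on summands apply to \<open>D\<close>.\<close>

sublocale operator_module scale B D
proof
  fix d x y a assume "d \<in> D"
  then obtain \<mu> where \<mu>: "\<mu> \<in> dist_frob n G r" "d = dist_act G scale B \<phi> \<mu>"
    by (auto simp: dist_image_def)
  have "\<mu> (\<lambda>g. coeff x b g + coeff y b g) = \<mu> (coeff x b) + \<mu> (coeff y b)"
    "\<mu> (\<lambda>g. a * coeff x b g) = a * \<mu> (coeff x b)" for b
    using \<mu>(1) coeff_in by (simp_all add: dist_frob_def)
  then show "d (x + y) = d x + d y" "d (scale a x) = scale a (d x)"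
    by (simp_all add: \<mu>(2) dist_act_coeff coeff_linear scale_left_distrib sum.distrib scale_sum_right)
qed

lemma D_conj:
  assumes g: "g \<in> G" and d: "d \<in> D"
  shows "\<phi> g \<circ> d \<circ> \<phi> (ginv g) \<in> D"
proof -
  obtain \<mu> where \<mu>: "\<mu> \<in> dist_frob n G r" "d = dist_act G scale B \<phi> \<mu>"
    using d by (auto simp: dist_image_def)
  have "\<phi> g \<circ> d \<circ> \<phi> (ginv g) = dist_act G scale B \<phi> (\<lambda>u. \<mu> (conj_fun g u))"
    by (auto simp: dist_act_conj[OF g \<mu>(1)] \<mu>(2))
  then show ?thesis using conj_fun_dist[OF g \<mu>(1)] by (simp add: dist_image_def)
qed

lemma D_conj': "g \<in> G \<Longrightarrow> d \<in> D \<Longrightarrow> inv_into UNIV (\<phi> g) \<circ> d \<circ> \<phi> g \<in> D"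
  using D_conj[of "ginv g" d]
  by (simp add: \<phi>_inv G_closed group.inv_inv[OF group_GL] G_GL)

text \<open>Moving \<open>d\<close> across \<open>\<phi> g\<close> replaces it by another operator
  of \<open>D\<close>, with which \<open>c\<close> commutes as well. This makes the semidirect
  product meaningful.\<close>

lemma C_conj:
  assumes g: "g \<in> G" and c: "c \<in> C"
  shows "\<phi> g \<circ> c \<circ> \<phi> (ginv g) \<in> C"
proof -
  have "\<phi> g (c (\<phi> (ginv g) (d x))) = d (\<phi> g (c (\<phi> (ginv g) x)))" if d: "d \<in> D" for d x
  proof -
    have "c ((\<phi> (ginv g) \<circ> d \<circ> \<phi> g) (\<phi> (ginv g) x)) = (\<phi> (ginv g) \<circ> d \<circ> \<phi> g) (c (\<phi> (ginv g) x))"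
      by (rule centralizer_comm[OF c D_conj'[OF g d, unfolded \<phi>_inv[OF g]]])
    then show ?thesis by (simp add: \<phi>_inverse[OF g])
  qed
  moreover have "bij (\<phi> g \<circ> c \<circ> \<phi> (ginv g))"
    by (intro bij_comp \<phi>_bij g centralizer_bij[OF c] G_closed)
  moreover have "Vector_Spaces.linear scale scale (\<phi> g \<circ> c \<circ> \<phi> (ginv g))"
    using \<phi>_linear[OF g] \<phi>_linear[OF G_closed(2)[OF g]] centralizer_linear[OF c]
    by (intro linearI) (simp_all add: linear_plus linear_times)
  ultimately show ?thesis by (simp add: centralizer_def fun_eq_iff)
qed


section \<open>The semidirect product\<close>

abbreviation "S \<equiv> semidirect n G \<phi> C"

lemma carrier_S: "carrier S = G \<times> C"
  by (simp add: semidirect_def)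

lemma mult_S:
  "g \<in> G \<Longrightarrow> (g, c) \<otimes>\<^bsub>S\<^esub> (g', c') = (g \<cdot> g', c \<circ> (\<phi> g \<circ> c' \<circ> \<phi> (ginv g)))"
  by (simp add: semidirect_def \<phi>_inv)

lemma one_S: "\<one>\<^bsub>S\<^esub> = (\<one>\<^bsub>GL n\<^esub>, id)"
  by (simp add: semidirect_def)

lemma group_S: "group S"
proof (rule groupI)
  fix s t u assume stu: "s \<in> carrier S" "t \<in> carrier S" "u \<in> carrier S"
  then obtain g c g' c' g'' c'' where *: "s = (g, c)" "t = (g', c')" "u = (g'', c'')"
    "g \<in> G" "g' \<in> G" "g'' \<in> G" by (auto simp: carrier_S)
  show "s \<otimes>\<^bsub>S\<^esub> t \<otimes>\<^bsub>S\<^esub> u = s \<otimes>\<^bsub>S\<^esub> (t \<otimes>\<^bsub>S\<^esub> u)"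
    using * by (simp add: mult_S G_closed G_group \<phi>_mult fun_eq_iff \<phi>_inverse G_GL
        group.inv_mult_group[OF group_GL])
next
  fix s t assume "s \<in> carrier S" "t \<in> carrier S"
  then show "s \<otimes>\<^bsub>S\<^esub> t \<in> carrier S"
    by (auto simp: carrier_S mult_S G_closed intro!: centralizer_comp C_conj)
next
  show "\<one>\<^bsub>S\<^esub> \<in> carrier S" by (simp add: carrier_S one_S G_closed centralizer_id)
next
  fix s assume "s \<in> carrier S"
  then obtain g c where s: "s = (g, c)" "g \<in> G" "c \<in> C" by (auto simp: carrier_S)
  show "\<one>\<^bsub>S\<^esub> \<otimes>\<^bsub>S\<^esub> s = s"
    using s \<phi>_inverse(1)[OF G_closed(3)] by (simp add: one_S mult_S G_closed G_group \<phi>_one fun_eq_iff)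
  have inv: "inv_into UNIV c (c x) = x" for x using centralizer_bij[OF s(3)] by (simp add: bij_is_inj)
  \<comment> \<open>The pair stands for \<open>c \<circ> \<phi> g\<close>. Its inverse is rewritten
    with the centralizer factor in front, which conjugates the inverse of \<open>c\<close> by
    \<open>\<phi> (ginv g)\<close>.\<close>
  have "(ginv g, \<phi> (ginv g) \<circ> inv_into UNIV c \<circ> \<phi> (ginv (ginv g))) \<otimes>\<^bsub>S\<^esub> s = \<one>\<^bsub>S\<^esub>"
    using s by (simp add: mult_S one_S G_closed G_group fun_eq_iff inv \<phi>_inverse
        group.inv_inv[OF group_GL] G_GL)
  moreover have "(ginv g, \<phi> (ginv g) \<circ> inv_into UNIV c \<circ> \<phi> (ginv (ginv g))) \<in> carrier S"
    using s by (simp add: carrier_S G_closed C_conj centralizer_inv)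
  ultimately show "\<exists>t \<in> carrier S. t \<otimes>\<^bsub>S\<^esub> s = \<one>\<^bsub>S\<^esub>" by blast
qed

lemma S_act_mult:
  assumes "s \<in> carrier S" "t \<in> carrier S"
  shows "S_act \<phi> (s \<otimes>\<^bsub>S\<^esub> t) W = S_act \<phi> s (S_act \<phi> t W)"
  using assms
  by (auto simp: carrier_S mult_S S_act_def image_comp \<phi>_mult \<phi>_inverse G_closed
      intro!: image_cong)

lemma S_act_one: "S_act \<phi> \<one>\<^bsub>S\<^esub> W = W"
  by (simp add: S_act_def one_S \<phi>_one)

abbreviation "S_stab M \<equiv> stabilizer S (S_act \<phi>) M"

text \<open>The orbit-stabilizer correspondence in a form free of representatives: a coset is
  determined by where it sends \<open>M\<close>.\<close>

lemma coset_eq_transporter: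
  assumes s: "s \<in> carrier S"
  shows "s <#\<^bsub>S\<^esub> S_stab M = {t \<in> carrier S. S_act \<phi> t M = S_act \<phi> s M}"
proof -
  interpret S: group S by (rule group_S)
  show ?thesis
  proof (intro equalityI subsetI)
    fix t assume "t \<in> s <#\<^bsub>S\<^esub> S_stab M"
    then obtain h where "h \<in> carrier S" "S_act \<phi> h M = M" "t = s \<otimes>\<^bsub>S\<^esub> h"
      by (auto simp: l_coset_def stabilizer_def)
    then show "t \<in> {t \<in> carrier S. S_act \<phi> t M = S_act \<phi> s M}"
      using s by (simp add: S_act_mult)
  next
    fix t assume "t \<in> {t \<in> carrier S. S_act \<phi> t M = S_act \<phi> s M}"
    then have t: "t \<in> carrier S" "S_act \<phi> t M = S_act \<phi> s M" by auto
    have "S_act \<phi> (inv\<^bsub>S\<^esub> s \<otimes>\<^bsub>S\<^esub> t) M = S_act \<phi> (inv\<^bsub>S\<^esub> s) (S_act \<phi> s M)"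
      using s t by (simp add: S_act_mult)
    also have "\<dots> = M" using s by (simp add: S_act_one flip: S_act_mult)
    finally have "inv\<^bsub>S\<^esub> s \<otimes>\<^bsub>S\<^esub> t \<in> S_stab M" using s t by (simp add: stabilizer_def)
    moreover have "t = s \<otimes>\<^bsub>S\<^esub> (inv\<^bsub>S\<^esub> s \<otimes>\<^bsub>S\<^esub> t)" using s t by (simp flip: S.m_assoc)
    ultimately show "t \<in> s <#\<^bsub>S\<^esub> S_stab M" unfolding l_coset_def by blast
  qed
qed

end

section \<open>The orbit map and its local sections\<close>

context frobenius_module
begin

abbreviation "SX \<equiv> S_space n G scale C"

lemma points_SX: "points SX = G \<times> C"
  by (simp add: S_space_def coord_prod_def points_affine_space)

lemma function_sheaf_SX: "function_sheaf SX"
  unfolding S_space_def coord_prod_def by (rule function_sheaf_affine_space)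

lemma reg_SX_fst: "f \<in> grp_coord n G \<Longrightarrow> f \<circ> fst \<in> reg SX (G \<times> C)"
  and reg_SX_snd: "h \<in> GLV_coord scale C \<Longrightarrow> h \<circ> snd \<in> reg SX (G \<times> C)"
proof -
  have "openin (ztop SX) (G \<times> C)"
    using function_sheaf.openin_points[OF function_sheaf_SX] by (simp add: points_SX)
  then show "f \<in> grp_coord n G \<Longrightarrow> f \<circ> fst \<in> reg SX (G \<times> C)"
    "h \<in> GLV_coord scale C \<Longrightarrow> h \<circ> snd \<in> reg SX (G \<times> C)"
    unfolding S_space_def coord_prod_def by (auto intro!: reg_gen)
qed

text \<open>Expanding \<open>\<phi> g v\<close> in the basis separates the variables: a sum of
  products of a function of \<open>g\<close> and a function of \<open>c\<close>.\<close>

lemma reg_SX_matrix_coefficient: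
  assumes \<xi>: "functional scale \<xi>"
  shows "(\<lambda>s. \<xi> (snd s (\<phi> (fst s) v))) \<in> reg SX (G \<times> C)"
proof -
  interpret SX: function_sheaf SX by (rule function_sheaf_SX)
  have U: "openin (ztop SX) (G \<times> C)" using SX.openin_points by (simp add: points_SX)
  have c: "on_set C (\<lambda>c. \<xi> (c b)) \<in> GLV_coord scale C" for b
    unfolding GLV_coord_def by (intro coord_ring_gen UnI1) (use \<xi> in blast)
  have "(\<lambda>s. \<Sum>b\<in>B. (coeff v b \<circ> fst) s * (on_set C (\<lambda>c. \<xi> (c b)) \<circ> snd) s) \<in> reg SX (G \<times> C)"
    by (intro SX.reg_sum SX.reg_mult U reg_SX_fst reg_SX_snd coeff_in c)
  then show ?thesis
  proof (rule SX.reg_cong[OF U])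
    fix s assume "s \<in> G \<times> C"
    then obtain g c where s: "s = (g, c)" "g \<in> G" "c \<in> C" by auto
    have \<xi>c: "functional scale (\<lambda>x. \<xi> (c x))"
      by (rule functional_comp_linear[OF \<xi> centralizer_linear[OF s(3)]])
    have "\<xi> (c (\<phi> g v)) = \<xi> (c (\<Sum>b\<in>B. scale (representation B (\<phi> g v) b) b))"
      by (simp only: sum_representation)
    also have "\<dots> = (\<Sum>b\<in>B. representation B (\<phi> g v) b * \<xi> (c b))"
      by (simp add: functional_sum[OF \<xi>c] functional_scale[OF \<xi>c])
    finally show "\<xi> (snd s (\<phi> (fst s) v))
        = (\<Sum>b\<in>B. (coeff v b \<circ> fst) s * (on_set C (\<lambda>c. \<xi> (c b)) \<circ> snd) s)"
      using s by (simp add: coeff_def on_set_in)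
  qed
qed

lemma S_act_linear:
  assumes "s \<in> carrier S"
  shows "Vector_Spaces.linear scale scale (snd s \<circ> \<phi> (fst s))" "bij (snd s \<circ> \<phi> (fst s))"
proof -
  have s: "fst s \<in> G" "snd s \<in> C" using assms by (auto simp: carrier_S)
  show "Vector_Spaces.linear scale scale (snd s \<circ> \<phi> (fst s))"
    by (rule linearI) (simp_all add: linear_plus[OF \<phi>_linear[OF s(1)]]
        linear_times[OF \<phi>_linear[OF s(1)]] linear_plus[OF centralizer_linear[OF s(2)]]
        linear_times[OF centralizer_linear[OF s(2)]])
  show "bij (snd s \<circ> \<phi> (fst s))" by (intro bij_comp \<phi>_bij centralizer_bij s)
qed

text \<open>The orbit map lifts to tuples by letting \<open>s\<close> act on a fixed basis of
  \<open>M\<close>. The lift has matrix coefficients as coordinates, and stays independent because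
  \<open>s\<close> acts injectively.\<close>

lemma orbit_map_morphism:
  assumes M: "subspace M" "dim M = m"
  shows "fs_morphism SX (Grass scale m) (\<lambda>s. S_act \<phi> s M)"
proof -
  obtain ms where ms: "ms \<in> indep_tuples m" "span (set ms) = M"
    using M by (rule tuple_of_subspace)
  let ?vs = "\<lambda>s. map (snd s \<circ> \<phi> (fst s)) ms"
  have span: "span (set (?vs s)) = S_act \<phi> s M" if "s \<in> carrier S" for s
    using module_hom.span_image[of scale scale "snd s \<circ> \<phi> (fst s)" "set ms"] S_act_linear(1)[OF that] ms
    by (simp add: S_act_def module_hom_eq_linear)
  have "?vs s \<in> indep_tuples m" if "s \<in> points SX" for s
  proof -
    have s: "s \<in> carrier S" using that by (simp add: points_SX carrier_S)
    have inj: "inj_on (snd s \<circ> \<phi> (fst s)) Y" for Y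
      using S_act_linear(2)[OF s] by (blast intro: inj_on_subset bij_is_inj)
    have "independent ((snd s \<circ> \<phi> (fst s)) ` set ms)"
      using ms S_act_linear(1)[OF s] inj
      by (intro module_hom.independent_injective_image[of scale scale]) (simp_all add: module_hom_eq_linear)
    then show ?thesis using ms inj by (simp add: distinct_map)
  qed
  moreover have "fs_morphism SX (tuple_space scale m) ?vs"
    unfolding tuple_space_def Let_def
  proof (rule fs_morphism_affine_space[OF function_sheaf_SX])
    show "?vs s \<in> {vs. length vs = m}" for s using ms by simp
    fix e assume "e \<in> {\<lambda>vs. \<xi> (vs ! i) | \<xi> i. functional scale \<xi> \<and> i < m}"
    then obtain \<xi> i where e: "e = (\<lambda>vs. \<xi> (vs ! i))" "functional scale \<xi>" "i < m" by blast
    have "e \<circ> ?vs = (\<lambda>s. \<xi> (snd s (\<phi> (fst s) (ms ! i))))"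
      using e ms by (simp add: fun_eq_iff)
    then show "e \<circ> ?vs \<in> reg SX (points SX)"
      using reg_SX_matrix_coefficient[OF e(2)] by (simp add: points_SX)
  qed
  ultimately have "fs_morphism SX (sub_space (tuple_space scale m) (indep_tuples m)) ?vs"
    by (intro fs_morphism_into_sub_space[OF function_sheaf_SX])
  then have "fs_morphism SX (Grass scale m) ((\<lambda>vs. span (set vs)) \<circ> ?vs)"
    unfolding Grass_def by (rule fs_morphism_comp) (rule fs_morphism_quot_space)
  then show ?thesis
    by (rule fs_morphism_cong[OF function_sheaf_SX])
      (use span in \<open>simp add: points_SX carrier_S\<close>)
qed

lemma D_projection_chart:
  assumes p: "D_projection p W0" "dim W0 = m"
  obtains \<eta> w where "coordinate_chart scale B p m \<eta> w"
proof -
  have "Vector_Spaces.linear scale scale p" "\<And>x. p (p x) = p x" "dim (range p) = m"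
    using p unfolding D_projection_def by blast+
  then show ?thesis by (rule coordinate_chart_exists) (rule that)
qed

lemma chart_conjugate:
  assumes p: "D_projection p W0" "dim W0 = m"
    and W: "D_submodule scale D W" "W \<in> chart m p"
  shows "graph_map p W \<in> C" "graph_map p W ` W0 = W" "graph_chart scale B p W0 W"
proof -
  have "dim W = dim W0" "inj_on p W"
    using W(2) p(2) points_Grass[OF finite_dimensional_vector_space_axioms]
    by (auto simp: chart_def)
  from graph_chart_centralizer[OF p(1) W(1) this]
  show "graph_map p W \<in> C" "graph_map p W ` W0 = W" "graph_chart scale B p W0 W" by blast+
qed

lemma self_in_chart:
  assumes p: "D_projection p W0" "dim W0 = m"
  shows "W0 \<in> chart m p"
proof -
  have "subspace W0" by (rule D_projection_submodule(1)[OF p(1)])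
  moreover have "inj_on p W0" using p(1) by (auto simp: D_projection_def inj_on_def)
  ultimately show ?thesis
    using p(2) points_Grass[OF finite_dimensional_vector_space_axioms] by (auto simp: chart_def)
qed

lemma D_projection_translate:
  assumes g: "g \<in> G" and p: "D_projection p M"
  shows "D_projection (\<phi> g \<circ> p \<circ> inv_into UNIV (\<phi> g)) (\<phi> g ` M)"
  by (rule D_projection_conj[OF p \<phi>_linear[OF g] \<phi>_bij[OF g] D_conj'[OF g]])

lemma D_projection_D_submodule: "D_projection p W \<Longrightarrow> D_submodule scale D W"
  using D_summand_iff[of W] by (auto simp: D_summand_def)

text \<open>The \<open>C\<close>-orbits on the \<open>D\<close>-summands of a given dimension are open, by the charts, so connectedness
  of \<open>G\<close> forces \<open>G\<close> to preserve each of them.\<close>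

lemma G_preserves_orbit:
  assumes conn: "connected_space (ztop (grp_space n G))"
    and p: "D_projection p M" and g: "g \<in> G"
  shows "\<exists>c \<in> C. c ` M = \<phi> g ` M"
proof -
  let ?X = "grp_space n G" and ?m = "dim M"
  have M: "subspace M" by (rule D_projection_submodule(1)[OF p])
  have sheaf: "function_sheaf ?X"
    unfolding grp_space_def grp_coord_def by (rule function_sheaf_affine_space)
  have pts: "points ?X = G" by (simp add: grp_space_def grp_coord_def points_affine_space)
  interpret X: function_sheaf ?X by fact
  \<comment> \<open>Embedding \<open>G\<close> in the semidirect product makes the
    \<open>G\<close>-orbit map a restriction of the orbit map already treated.\<close>
  have "fs_morphism ?X SX (\<lambda>g. (g, id))"
    unfolding S_space_def coord_prod_def
  proof (rule fs_morphism_affine_space[OF sheaf])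
    show "(g, id) \<in> G \<times> C" if "g \<in> points ?X" for g
      using that by (simp add: pts centralizer_id)
    fix e assume "e \<in> (\<lambda>f. f \<circ> fst) ` grp_coord n G \<union> (\<lambda>f. f \<circ> snd) ` GLV_coord scale C"
    then consider f where "f \<in> grp_coord n G" "e = f \<circ> fst" | f where "e = f \<circ> snd" by blast
    then show "e \<circ> (\<lambda>g. (g, id)) \<in> reg ?X (points ?X)"
    proof cases
      case 1
      then have "e \<circ> (\<lambda>g. (g, id)) = f" by (simp add: fun_eq_iff)
      moreover have "f \<in> reg ?X (points ?X)"
        using 1 X.openin_points unfolding grp_space_def grp_coord_def by (intro reg_coord_ring)
      ultimately show ?thesis by simp
    next
      case 2
      then have "e \<circ> (\<lambda>g. (g, id)) = (\<lambda>_. f id)" by (simp add: fun_eq_iff)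
      then show ?thesis using X.reg_const[OF X.openin_points] by simp
    qed
  qed
  from fs_morphism_comp[OF this orbit_map_morphism[OF M refl]]
  have mor: "fs_morphism ?X (Grass scale ?m) (\<lambda>g. \<phi> g ` M)"
    by (simp add: comp_def S_act_def)
  have nbhd: "\<exists>U. openin (ztop ?X) U \<and> h \<in> U \<and> (\<forall>h' \<in> U. \<exists>c \<in> C. \<phi> h' ` M = c ` \<phi> h ` M)"
    if h: "h \<in> G" for h
  proof -
    let ?p = "\<phi> h \<circ> p \<circ> inv_into UNIV (\<phi> h)"
    have p': "D_projection ?p (\<phi> h ` M)" by (rule D_projection_translate[OF h p])
    have dim: "dim (\<phi> h ` M) = ?m" by (rule dim_image_bij[OF \<phi>_linear[OF h] \<phi>_bij[OF h] M])
    obtain \<eta> w where "coordinate_chart scale B ?p ?m \<eta> w" using p' dim by (rule D_projection_chart)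
    then have "openin (ztop (Grass scale ?m)) (chart ?m ?p)" by (rule coordinate_chart.openin_chart)
    then have "openin (ztop ?X) {h' \<in> points ?X. \<phi> h' ` M \<in> chart ?m ?p}"
      by (rule fs_morphism_openin[OF mor])
    moreover have "h \<in> {h' \<in> points ?X. \<phi> h' ` M \<in> chart ?m ?p}"
      using h self_in_chart[OF p' dim] by (simp add: pts)
    moreover have "\<exists>c \<in> C. \<phi> h' ` M = c ` \<phi> h ` M" if "h' \<in> points ?X" "\<phi> h' ` M \<in> chart ?m ?p" for h'
    proof -
      have "D_submodule scale D (\<phi> h' ` M)"
        using that(1) by (intro D_projection_D_submodule[OF D_projection_translate[OF _ p]]) (simp add: pts)
      from chart_conjugate[OF p' dim this that(2)] show ?thesis by metis
    qed
    ultimately show ?thesis by blast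
  qed
  let ?A = "{h \<in> G. \<exists>c \<in> C. c ` M = \<phi> h ` M}"
  have "openin (ztop ?X) ?A"
  proof (subst openin_subopen, intro ballI)
    fix h assume "h \<in> ?A"
    then obtain c where h: "h \<in> G" "c \<in> C" "c ` M = \<phi> h ` M" by blast
    from nbhd[OF h(1)] obtain U where U: "openin (ztop ?X) U" "h \<in> U"
      "\<forall>h' \<in> U. \<exists>c \<in> C. \<phi> h' ` M = c ` \<phi> h ` M" by blast
    have "U \<subseteq> ?A"
    proof
      fix h' assume h': "h' \<in> U"
      then obtain c' where "c' \<in> C" "\<phi> h' ` M = c' ` \<phi> h ` M" using U(3) by blast
      then have "c' \<circ> c \<in> C" "(c' \<circ> c) ` M = \<phi> h' ` M"
        using h(2,3) by (simp_all only: centralizer_comp image_comp[symmetric])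
      moreover have "h' \<in> G" using openin_subset[OF U(1)] h' pts by (auto simp: points_def)
      ultimately show "h' \<in> ?A" by blast
    qed
    then show "\<exists>T. openin (ztop ?X) T \<and> h \<in> T \<and> T \<subseteq> ?A" using U by blast
  qed
  \<comment> \<open>Being in one \<open>C\<close>-orbit is symmetric, so a point of
    \<open>?A\<close> close to \<open>h\<close> would force \<open>h\<close> into
    \<open>?A\<close>.\<close>
  moreover have "openin (ztop ?X) (G - ?A)"
  proof (subst openin_subopen, intro ballI)
    fix h assume h: "h \<in> G - ?A"
    then have "h \<in> G" by blast
    from nbhd[OF this] obtain U where U: "openin (ztop ?X) U" "h \<in> U"
      "\<forall>h' \<in> U. \<exists>c \<in> C. \<phi> h' ` M = c ` \<phi> h ` M" by blast
    have "U \<subseteq> G - ?A"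
    proof
      fix h' assume h': "h' \<in> U"
      then obtain c' where c': "c' \<in> C" "\<phi> h' ` M = c' ` \<phi> h ` M" using U(3) by blast
      have "h' \<notin> ?A"
      proof
        assume "h' \<in> ?A"
        then obtain c where c: "c \<in> C" "c ` M = \<phi> h' ` M" by blast
        have "inv_into UNIV c' ` \<phi> h' ` M = \<phi> h ` M"
          unfolding c'(2) by (rule image_inv_f_f[OF bij_is_inj[OF centralizer_bij[OF c'(1)]]])
        then have "(inv_into UNIV c' \<circ> c) ` M = \<phi> h ` M"
          using c(2) by (simp only: image_comp[symmetric])
        moreover have "inv_into UNIV c' \<circ> c \<in> C" by (intro centralizer_comp centralizer_inv c c')
        ultimately show False using h by blast
      qed
      moreover have "h' \<in> G" using openin_subset[OF U(1)] h' pts by (auto simp: points_def)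
      ultimately show "h' \<in> G - ?A" by blast
    qed
    then show "\<exists>T. openin (ztop ?X) T \<and> h \<in> T \<and> T \<subseteq> G - ?A" using U by blast
  qed
  moreover have "\<one>\<^bsub>GL n\<^esub> \<in> ?A"
    using G_closed(3) centralizer_id by (auto simp: \<phi>_one intro!: bexI[of _ id])
  ultimately have "G - ?A = {}"
    using conn pts connected_spaceD[of "ztop ?X" ?A "G - ?A"] unfolding points_def by blast
  then show ?thesis using g by blast
qed

text \<open>For \<open>W\<close> in the orbit of \<open>M\<close> this is the coset belonging to
  \<open>W\<close>. It involves no choice, so it can be compared on each chart with the projection
  of whatever section is available there.\<close>

definition transporter :: "'v set \<Rightarrow> 'v set \<Rightarrow> ('k mat \<times> ('v \<Rightarrow> 'v)) set" where
  "transporter M W = {s \<in> carrier S. S_act \<phi> s M = W}"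

lemma transporter_coset:
  assumes "s \<in> carrier S" "S_act \<phi> s M = W"
  shows "transporter M W = s <#\<^bsub>S\<^esub> S_stab M"
  using coset_eq_transporter[OF assms(1)] assms(2) by (simp add: transporter_def)

lemma centralizer_in_S: "c \<in> C \<Longrightarrow> (\<one>\<^bsub>GL n\<^esub>, c) \<in> carrier S"
  and G_in_S: "g \<in> G \<Longrightarrow> (g, id) \<in> carrier S"
  and S_act_centralizer: "S_act \<phi> (\<one>\<^bsub>GL n\<^esub>, c) W = c ` W"
  and S_act_G: "S_act \<phi> (g, id) W = \<phi> g ` W"
  by (simp_all add: carrier_S G_closed centralizer_id S_act_def \<phi>_one)

text \<open>The coefficients of \<open>graph_map p W\<close> are regular on the chart, and composing
  with the fixed \<open>c\<close> only changes the vector or the linear form. In the application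
  \<open>c\<close> carries \<open>M\<close> to \<open>W0\<close>, so the value at \<open>W\<close>
  carries \<open>M\<close> to \<open>W\<close>.\<close>

lemma local_section_morphism:
  assumes p: "D_projection p W0" "dim W0 = m" and c: "c \<in> C"
    and N: "N = chart m p \<inter> Y" and Y: "\<And>W. W \<in> Y \<Longrightarrow> D_submodule scale D W"
  shows "fs_morphism (sub_space (sub_space (Grass scale m) Y) N) SX
    (\<lambda>W. (\<one>\<^bsub>GL n\<^esub>, graph_map p W \<circ> c))" (is "fs_morphism ?Z SX ?\<sigma>")
proof -
  obtain \<eta> w where "coordinate_chart scale B p m \<eta> w" using p by (rule D_projection_chart)
  then interpret chart: coordinate_chart scale B p m \<eta> w .
  interpret Z: function_sheaf ?Z
    by (intro function_sheaf_sub_space function_sheaf_Grass)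
  have chart_pts: "chart m p \<subseteq> points (Grass scale m)" by (auto simp: chart_def)
  then have pts: "points ?Z = N" using N by (auto simp: points_sub_space)
  have op: "openin (ztop ?Z) N" using Z.openin_points pts by simp
  have chart: "openin (ztop (sub_space (Grass scale m) Y)) N"
    using chart.openin_chart N by (auto simp: openin_sub_space_iff)
  have reg: "(\<lambda>W. \<xi> (graph_map p W v)) \<in> reg ?Z N" if "functional scale \<xi>" for \<xi> v
  proof (rule reg_sub_space[OF _ chart])
    show "(\<lambda>W. \<xi> (graph_map p W v)) \<in> reg (sub_space (Grass scale m) Y) N"
      by (rule reg_sub_space[OF chart.reg_graph_map[OF that] chart.openin_chart N])
  qed simp
  have conj: "graph_map p W \<circ> c \<in> C" "graph_chart scale B p W0 W" "graph_map p W \<in> C" if "W \<in> N" for W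
    using that N Y chart_conjugate[OF p] c by (auto intro: centralizer_comp)
  have snd: "h \<circ> (\<lambda>W. graph_map p W \<circ> c) \<in> reg ?Z N" if h: "h \<in> GLV_coord scale C" for h
  proof (rule Z.reg_coord_ring_comp[OF op _ _ h[unfolded GLV_coord_def]])
    show "graph_map p W \<circ> c \<in> C" if "W \<in> N" for W by (rule conj(1)[OF that])
    fix e assume "e \<in> {\<lambda>c. \<xi> (c v) | \<xi> v. functional scale \<xi>} \<union>
      {\<lambda>c. \<xi> (inv_into UNIV c v) | \<xi> v. functional scale \<xi>}"
    then consider \<xi> v where "functional scale \<xi>" "e = (\<lambda>c. \<xi> (c v))"
      | \<xi> v where "functional scale \<xi>" "e = (\<lambda>c. \<xi> (inv_into UNIV c v))" by blast
    then show "e \<circ> (\<lambda>W. graph_map p W \<circ> c) \<in> reg ?Z N"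
    proof cases
      case 1
      then show ?thesis using reg[OF 1(1), of "c v"] by (simp add: comp_def)
    next
      case 2
      let ?\<xi> = "\<lambda>x. \<xi> (inv_into UNIV c x)"
      have \<xi>: "functional scale ?\<xi>"
        by (rule functional_comp_linear[OF 2(1) centralizer_linear[OF centralizer_inv[OF c]]])
      \<comment> \<open>The inverse of the unipotent factor is \<open>2 - u\<close>, and applying
        the inverse of \<open>c\<close> afterwards is absorbed into the form \<open>?\<xi>\<close>.
        The difference is spelled with the operations that preserve regularity.\<close>
      have "(\<lambda>W. ?\<xi> (v + v) + (- 1) * ?\<xi> (graph_map p W v)) \<in> reg ?Z N"
        by (intro Z.reg_add Z.reg_mult Z.reg_const op reg \<xi>)
      then show ?thesis
      proof (rule Z.reg_cong[OF op])
        fix W assume W: "W \<in> N"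
        have "inv_into UNIV (graph_map p W \<circ> c) v = inv_into UNIV c (inv_into UNIV (graph_map p W) v)"
          using centralizer_bij[OF c] centralizer_bij[OF conj(3)[OF W]]
          by (simp add: o_inv_distrib)
        then show "(e \<circ> (\<lambda>W. graph_map p W \<circ> c)) W = ?\<xi> (v + v) + (- 1) * ?\<xi> (graph_map p W v)"
          using functional_diff[OF \<xi>]
          by (simp add: 2(2) graph_chart.inv_graph_map[OF conj(2)[OF W]])
      qed
    qed
  qed
  show ?thesis
    unfolding S_space_def coord_prod_def
  proof (rule fs_morphism_affine_space[OF Z.function_sheaf_axioms])
    show "?\<sigma> W \<in> G \<times> C" if "W \<in> points ?Z" for W
      using that conj(1) by (simp add: pts G_closed)
    fix e assume "e \<in> (\<lambda>f. f \<circ> fst) ` grp_coord n G \<union> (\<lambda>f. f \<circ> snd) ` GLV_coord scale C"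
    then consider f where "e = f \<circ> fst" | f where "f \<in> GLV_coord scale C" "e = f \<circ> snd" by blast
    then show "e \<circ> ?\<sigma> \<in> reg ?Z (points ?Z)"
    proof cases
      case 1
      then have "e \<circ> ?\<sigma> = (\<lambda>_. f \<one>\<^bsub>GL n\<^esub>)" by (simp add: fun_eq_iff)
      then show ?thesis using Z.reg_const[OF op] by (simp add: pts)
    next
      case 2
      then have "e \<circ> ?\<sigma> = f \<circ> (\<lambda>W. graph_map p W \<circ> c)" by (simp add: fun_eq_iff)
      then show ?thesis using snd[OF 2(1)] by (simp add: pts)
    qed
  qed
qed

section \<open>The variety of summands as an orbit, and the isomorphism\<close>

context
  fixes M p
  assumes inf: "infinite (UNIV :: 'k set)"
    and conn: "connected_space (ztop (grp_space n G))"
    and p: "D_projection p M"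
begin

lemma X_set_eq_C_orbit: "X_set scale D M = {c ` M | c. c \<in> C}"
proof
  show "X_set scale D M \<subseteq> {c ` M | c. c \<in> C}"
  proof
    fix W assume "W \<in> X_set scale D M"
    then obtain q where "D_projection q W" "D_isomorphic scale D M W"
      by (auto simp: X_set_def D_summand_iff)
    from isomorphic_summands_conjugate[OF inf p this] show "W \<in> {c ` M | c. c \<in> C}" by blast
  qed
  show "{c ` M | c. c \<in> C} \<subseteq> X_set scale D M"
  proof
    fix W assume "W \<in> {c ` M | c. c \<in> C}"
    then obtain c where c: "c \<in> C" "W = c ` M" by blast
    have "D_projection (c \<circ> p \<circ> inv_into UNIV c) (c ` M)"
      using centralizer_conj[OF c(1)]
      by (intro D_projection_conj[OF p] centralizer_linear centralizer_bij c) simp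
    then have "D_summand scale D W" using c(2) D_summand_iff by blast
    then show "W \<in> X_set scale D M"
      using D_isomorphic_centralizer[OF c(1)] c(2) by (simp add: X_set_def)
  qed
qed

text \<open>The translation by \<open>g\<close> can be replaced, as far as \<open>M\<close> is
  concerned, by an element \<open>c'\<close> of \<open>C\<close>, and \<open>c \<circ> c'\<close> is
  again in \<open>C\<close>.\<close>

lemma X_set_eq_S_orbit: "X_set scale D M = {S_act \<phi> s M | s. s \<in> carrier S}"
proof
  show "X_set scale D M \<subseteq> {S_act \<phi> s M | s. s \<in> carrier S}"
    unfolding X_set_eq_C_orbit using centralizer_in_S S_act_centralizer by blast
  show "{S_act \<phi> s M | s. s \<in> carrier S} \<subseteq> X_set scale D M"
  proof
    fix W assume "W \<in> {S_act \<phi> s M | s. s \<in> carrier S}"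
    then obtain g c where s: "g \<in> G" "c \<in> C" "W = c ` \<phi> g ` M"
      by (auto simp: carrier_S S_act_def image_comp)
    obtain c' where "c' \<in> C" "c' ` M = \<phi> g ` M" using G_preserves_orbit[OF conn p s(1)] by blast
    then have "c \<circ> c' \<in> C" "(c \<circ> c') ` M = W"
      using s by (simp_all only: centralizer_comp image_comp[symmetric])
    then show "W \<in> X_set scale D M" unfolding X_set_eq_C_orbit by blast
  qed
qed

text \<open>A map out of the cosets is a map on the group that is constant on cosets, so the orbit
  map descends globally. A map into the cosets is obtained by projecting a map into the group, which
  is available only chart by chart.\<close>

lemma orbit_iso:
  "fs_iso (X_variety scale D M) (coset_space S SX (S_stab M)) (transporter M)"
proof -
  let ?X = "X_set scale D M" and ?m = "dim M" and ?q = "\<lambda>s. s <#\<^bsub>S\<^esub> S_stab M"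
  have M: "subspace M" by (rule D_projection_submodule(1)[OF p])
  have XG: "?X \<subseteq> points (Grass scale ?m)"
  proof
    fix W assume "W \<in> ?X"
    then obtain c where "c \<in> C" "W = c ` M" unfolding X_set_eq_C_orbit by blast
    then show "W \<in> points (Grass scale ?m)"
      using M points_Grass[OF finite_dimensional_vector_space_axioms]
      by (simp add: subspace_image_linear dim_image_bij centralizer_linear centralizer_bij)
  qed
  then have pts: "points (X_variety scale D M) = ?X" by (auto simp: X_variety_def points_sub_space)
  have sheaf: "function_sheaf (X_variety scale D M)"
    unfolding X_variety_def by (intro function_sheaf_sub_space function_sheaf_Grass)
  have fwd: "fs_morphism (X_variety scale D M) (coset_space S SX (S_stab M)) (transporter M)"
  proof (rule fs_morphism_local[OF sheaf])
    fix W0 assume "W0 \<in> points (X_variety scale D M)"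
    then have W0: "W0 \<in> ?X" by (simp add: pts)
    then obtain q where q: "D_projection q W0" by (auto simp: X_set_def D_summand_iff)
    obtain c where c: "c \<in> C" "c ` M = W0" using W0 unfolding X_set_eq_C_orbit by blast
    have dim: "dim W0 = ?m"
      using XG W0 points_Grass[OF finite_dimensional_vector_space_axioms] by auto
    have DX: "D_submodule scale D W" if "W \<in> ?X" for W
      using that by (simp add: X_set_def D_summand_def)
    \<comment> \<open>First \<open>c\<close> takes \<open>M\<close> to the centre \<open>W0\<close>
      of the chart, then \<open>graph_map q W\<close> takes \<open>W0\<close> to
      \<open>W\<close>.\<close>
    let ?N = "chart ?m q \<inter> ?X" and ?\<sigma> = "\<lambda>W. (\<one>\<^bsub>GL n\<^esub>, graph_map q W \<circ> c)"
    obtain \<eta> w where "coordinate_chart scale B q ?m \<eta> w" using q dim by (rule D_projection_chart)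
    then have "openin (ztop (X_variety scale D M)) ?N"
      unfolding X_variety_def openin_sub_space_iff
      by (intro exI[of _ "chart ?m q"] conjI coordinate_chart.openin_chart refl)
    moreover have "W0 \<in> ?N" using self_in_chart[OF q dim] W0 by blast
    moreover have "fs_morphism (sub_space (X_variety scale D M) ?N) (coset_space S SX (S_stab M)) (?q \<circ> ?\<sigma>)"
      unfolding X_variety_def coset_space_def
      by (rule fs_morphism_comp[OF local_section_morphism[OF q dim c(1) refl DX] fs_morphism_quot_space])
    moreover have "transporter M W = (?q \<circ> ?\<sigma>) W" if "W \<in> ?N" for W
    proof -
      have W: "W \<in> chart ?m q" "W \<in> ?X" using that by simp_all
      from chart_conjugate[OF q dim DX[OF W(2)] W(1)]
      have "graph_map q W \<circ> c \<in> C" "(graph_map q W \<circ> c) ` M = W"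
        using c by (simp_all only: centralizer_comp image_comp[symmetric])
      then have "transporter M W = ?\<sigma> W <#\<^bsub>S\<^esub> S_stab M"
        by (intro transporter_coset centralizer_in_S) (simp_all only: S_act_centralizer)
      then show ?thesis by simp
    qed
    ultimately show "\<exists>N f'. openin (ztop (X_variety scale D M)) N \<and> W0 \<in> N \<and>
       fs_morphism (sub_space (X_variety scale D M) N) (coset_space S SX (S_stab M)) f' \<and>
       (\<forall>W \<in> N. transporter M W = f' W)"
      by (intro exI[of _ ?N] exI[of _ "?q \<circ> ?\<sigma>"]) blast
  qed
  \<comment> \<open>The choice of representative is harmless: all members of a coset send
    \<open>M\<close> to the same subspace.\<close>
  let ?F = "\<lambda>K. S_act \<phi> (SOME s. s \<in> K) M"
  have F: "?F (?q s) = S_act \<phi> s M" if s: "s \<in> carrier S" for s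
  proof -
    have "s \<in> ?q s" using s by (simp add: coset_eq_transporter)
    then have "(SOME t. t \<in> ?q s) \<in> ?q s" by (rule someI)
    then show ?thesis using s by (simp add: coset_eq_transporter)
  qed
  have "fs_morphism SX (X_variety scale D M) (\<lambda>s. S_act \<phi> s M)"
    unfolding X_variety_def
    by (rule fs_morphism_into_sub_space[OF function_sheaf_SX orbit_map_morphism[OF M refl]])
      (auto simp: X_set_eq_S_orbit points_SX carrier_S)
  then have bwd: "fs_morphism (coset_space S SX (S_stab M)) (X_variety scale D M) ?F"
    unfolding coset_space_def
    by (rule fs_morphism_from_quot_space[OF function_sheaf_SX]) (simp add: F points_SX carrier_S)
  have "?F (transporter M W) = W" if "W \<in> points (X_variety scale D M)" for W
  proof -
    obtain s where "s \<in> carrier S" "S_act \<phi> s M = W"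
      using \<open>W \<in> points _\<close> by (auto simp: pts X_set_eq_S_orbit)
    then show ?thesis by (simp add: transporter_coset[of s] F)
  qed
  moreover have "transporter M (?F K) = K" if K: "K \<in> points (coset_space S SX (S_stab M))" for K
  proof -
    obtain s where "s \<in> carrier S" "K = ?q s"
      using K by (auto simp: coset_space_def points_quot_space points_SX carrier_S)
    then show ?thesis by (simp add: F transporter_coset[of s])
  qed
  ultimately show ?thesis using fwd bwd unfolding fs_iso_def by blast
qed

lemma transporter_equivariant:
  assumes s: "s \<in> carrier S" and W: "W \<in> X_set scale D M"
  shows "transporter M (S_act \<phi> s W) = s <#\<^bsub>S\<^esub> transporter M W"
proof -
  interpret S: group S by (rule group_S)
  obtain t where t: "t \<in> carrier S" "S_act \<phi> t M = W" using W by (auto simp: X_set_eq_S_orbit)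
  have "transporter M (S_act \<phi> s W) = (s \<otimes>\<^bsub>S\<^esub> t) <#\<^bsub>S\<^esub> S_stab M"
    using s t by (intro transporter_coset) (simp_all add: S_act_mult)
  also have "\<dots> = s <#\<^bsub>S\<^esub> (t <#\<^bsub>S\<^esub> S_stab M)"
    using s t by (intro S.lcos_m_assoc[symmetric]) (auto simp: stabilizer_def)
  finally show ?thesis using transporter_coset[OF t] by simp
qed

end

end

lemma infinite_alg_closed: "infinite (UNIV :: 'k::alg_closed_field set)"
proof
  assume fin: "finite (UNIV :: 'k set)"
  \<comment> \<open>Over a finite field this polynomial would have positive degree and yet take the
    value \<open>1\<close> everywhere.\<close>
  let ?P = "(\<Prod>a\<in>UNIV. [:- a, 1:]) + 1 :: 'k poly"
  have deg: "degree (\<Prod>a\<in>UNIV. [:- a, 1 :: 'k:]) = card (UNIV :: 'k set)"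
    by (subst degree_prod_eq_sum_degree) simp_all
  have "card (UNIV :: 'k set) > 0" using fin by (simp add: card_gt_0_iff)
  then have "degree ?P > 0" using deg by (simp add: degree_add_eq_left)
  then obtain x where "poly ?P x = 0" using alg_closed_imp_poly_has_root by blast
  moreover have "poly ?P x = 1"
    using fin by (simp add: poly_prod prod_zero_iff)
  ultimately show False by simp
qed

theorem theorem3p1p4:
  fixes n r :: nat
    and G :: "'k::alg_closed_field mat set"
    and scale :: "'k \<Rightarrow> 'v::ab_group_add \<Rightarrow> 'v"
    and B M :: "'v set"
    and \<phi> :: "'k mat \<Rightarrow> 'v \<Rightarrow> 'v"
  defines "D \<equiv> dist_image n G r scale B \<phi>"
  defines "C \<equiv> centralizer scale D"
  defines "S \<equiv> semidirect n G \<phi> C"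
  defines "S_M \<equiv> stabilizer S (S_act \<phi>) M"
  assumes "CHAR('k) > 0"
    and "simple_alg_group n G"
    and "simply_connected_group n G"
    and "r \<ge> 1"
    and "finite_dimensional_vector_space scale B"
    and "rational_module n G scale \<phi>"
    and "D_summand scale D M"
  shows "\<exists>F. equivariant_iso S
               (X_variety scale D M) (S_act \<phi>)
               (coset_space S (S_space n G scale C) S_M) (\<lambda>s K. s <#\<^bsub>S\<^esub> K) F \<and>
             (\<forall>g \<in> G. \<forall>W \<in> X_set scale D M. F (\<phi> g ` W) = (g, id) <#\<^bsub>S\<^esub> F W)"
proof -
  have conn: "connected_space (ztop (grp_space n G))" and sub: "subgroup G (GL n)"
    using assms(6) by (simp_all add: simple_alg_group_def connected_alg_group_def closed_subgroup_def)
  interpret fm: frobenius_module scale B n r G \<phi>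
    by (intro frobenius_module.intro frobenius_module_axioms.intro assms sub)
  obtain p where p: "fm.D_projection p M"
    using assms(11) fm.D_summand_iff unfolding D_def by blast
  note orbit = fm.orbit_iso[OF infinite_alg_closed conn p]
    fm.transporter_equivariant[OF infinite_alg_closed conn p]
  have "equivariant_iso S (X_variety scale D M) (S_act \<phi>)
      (coset_space S (S_space n G scale C) S_M) (\<lambda>s K. s <#\<^bsub>S\<^esub> K) (fm.transporter M)"
    unfolding equivariant_iso_def S_M_def S_def C_def D_def
    using orbit by (auto simp: X_variety_def points_sub_space)
  moreover have "fm.transporter M (\<phi> g ` W) = (g, id) <#\<^bsub>S\<^esub> fm.transporter M W"
    if "g \<in> G" "W \<in> X_set scale D M" for g W
    \<comment> \<open>Equivariance under \<open>G\<close> is equivariance under the elements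
      \<open>(g, id)\<close>, which act on subspaces through \<open>\<phi> g\<close>.\<close>
    using orbit(2)[OF fm.G_in_S[OF that(1)]] that(2)
    unfolding S_def C_def D_def by (simp add: fm.S_act_G)
  ultimately show ?thesis by blast
qed

end
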